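(* There exist $\mu>0$ (sufficiently large), $\delta_0>0$ and $C>0$, independent of $k$ and $h$, such that for every time mesh with $k-k_{\min}\le\delta_0$ and every conformal triangulation $\mathcal T$ of $\Omega$ the following holds. Let $1\le p<\infty$, $f\in L^p(I;L^2(\Omega))$, $u_0=0$, and let $u_{kh}\in X^{0,r}_{k,h}$ be the fully discrete solution with data $f$ and $u_0=0$. Then $$\left[\sum_{m=1}^M\left(\|A_{kh,m}u_{kh,m}\|^p_{L^p(I_m;L^2(\Omega))}+k_m\left\|\frac{[u_{kh}]_{m-1}}{k_m}\right\|^p_{L^2(\Omega)}\right)\right]^{\frac1p}\le Ce^{\mu T}\ln\frac{T}{k}\,\|f\|_{L^p(I;L^2(\Omega))}.$$
   Context: Problem data. $\Omega\subset\mathbb R^d$, $d\ge1$, is a bounded polygonal/polyhedral Lipschitz domain, $T>0$, $I=(0,T)$. The coefficients $a_{ij}\in L^\infty(I\times\Omega)$ ($1\le i,j\le d$) satisfy $a_{ij}=a_{ji}$ and $\sum_{i,j}a_{ij}(t,x)\xi_i\xi_j\ge\alpha|\xi|^2$ for all $\xi\in\mathbb R^d$ and a.e. $(t,x)$, with a constant $\alpha>0$; they are continuous in $t$ on $\bar I$ for almost all $x$, and $|a_{ij}(t_1,x)-a_{ij}(t_2,x)|\le\omega(|t_1-t_2|)$ for all $t_1,t_2\in\bar I$ and almost all $x\in\Omega$, where $\omega:[0,T]\to[0,\infty)$ is nondecreasing, $\omega(t)/t^{3/2}$ is non-increasing on $(0,T]$, and $\int_0^T\omega(t)t^{-3/2}\,dt<\infty$.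 For $u,v\in H^1_0(\Omega)$ set $a(t;u,v)=\int_\Omega\sum_{i,j}a_{ij}(t,x)\partial_iu\,\partial_jv\,dx$. Time meshes. $0=t_0<t_1<\dots<t_M=T$, $I_m=(t_{m-1},t_m]$, $k_m=t_m-t_{m-1}$, $k=\max_mk_m$, $k_{\min}=\min_mk_m$. All meshes satisfy, with fixed constants $c,\beta,\kappa>0$: (i) $k_{\min}\ge ck^\beta$; (ii) $\kappa^{-1}\le k_m/k_{m+1}\le\kappa$ for $1\le m\le M-1$; (iii) $k\le T/4$. Space discretization. $\mathcal T=\{\tau\}$ is a conformal (no hanging nodes) partition of $\Omega$ into simplices, $h$ the maximal diameter; no shape regularity or quasi-uniformity is assumed. $V_h$ is the set of functions in $H^1_0(\Omega)$ that are polynomials of degree $r\ge1$ on each $\tau$. $A_h(t):V_h\to V_h$ is defined by $(A_h(t)v_h,\chi)_\Omega=a(t;v_h,\chi)$ for all $\chi\in V_h$, and $A_{kh,m}=\frac1{k_m}\int_{I_m}A_h(t)\,dt:V_h\to V_h$. Full discretization. $X^{0,r}_{k,h}$ is the space of functions on $I$ with values in $V_h$ that are constant in time on each $I_m$; $v_{kh,m}:=v_{kh}|_{I_m}$. The fully discrete solution $u_{kh}\in X^{0,r}_{k,h}$ with data $f$ and $u_0=0$ is defined by $$\int_Ia(t;u_{kh},\varphi_{kh})\,dt+\sum_{m=2}^M(u_{kh,m}-u_{kh,m-1},\varphi_{kh,m})_\Omega+(u_{kh,1},\varphi_{kh,1})_\Omega=\int_I(f,\varphi_{kh})_\Omega\,dt\quad\forall\varphi_{kh}\in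 X^{0,r}_{k,h}.$$ Jumps: $[u_{kh}]_m=u_{kh,m+1}-u_{kh,m}$ for $1\le m\le M-1$, and $[u_{kh}]_0=u_{kh,1}$. "Independent of $k$ and $h$" means: depending only on $\Omega,d,T$, the coefficients $a_{ij}$ (including $\alpha,\omega$) and $c,\beta,\kappa$, and not otherwise on the time mesh, nor on the triangulation or $f$. *)

theory Defs
  imports "HOL-Analysis.Analysis"
begin

section \<open>Domains and triangulations\<close>

text \<open>Near every boundary point, in suitable orthonormal coordinates with last direction \<open>e\<close>,
  the set is the strict epigraph of a Lipschitz function of the remaining coordinates, which are
  represented by the orthogonal projection onto the hyperplane \<open>y \<bullet> e = 0\<close>.\<close>

definition lipschitz_domain :: "(real^'d) set \<Rightarrow> bool" where
  "lipschitz_domain \<Omega> \<longleftrightarrow>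
     open \<Omega> \<and> connected \<Omega> \<and> \<Omega> \<noteq> {} \<and>
     (\<forall>x\<in>frontier \<Omega>. \<exists>\<rho>>0. \<exists>e \<gamma> L. norm e = 1 \<and> L-lipschitz_on {y. y \<bullet> e = 0} \<gamma> \<and>
        (\<forall>y\<in>ball x \<rho>. y \<in> \<Omega> \<longleftrightarrow> (\<gamma> (y - (y \<bullet> e) *\<^sub>R e) :: real) < y \<bullet> e))"

definition polyhedral_lipschitz_domain :: "(real^'d) set \<Rightarrow> bool" where
  "polyhedral_lipschitz_domain \<Omega> \<longleftrightarrow>
     bounded \<Omega> \<and> lipschitz_domain \<Omega> \<and>
     (\<exists>\<P>. finite \<P> \<and> (\<forall>P\<in>\<P>. polytope P) \<and> closure \<Omega> = \<Union>\<P>)"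

text \<open>The elements are closed simplices; \<^const>\<open>triangulation\<close> says that any two of them meet
  in a common (possibly empty) face, i.e. there are no hanging nodes.\<close>

definition conformal_triangulation :: "(real^'d) set \<Rightarrow> (real^'d) set set \<Rightarrow> bool" where
  "conformal_triangulation \<Omega> \<T> \<longleftrightarrow>
     triangulation \<T> \<and> (\<forall>\<tau>\<in>\<T>. int CARD('d) simplex \<tau>) \<and> \<Union>\<T> = closure \<Omega>"


section \<open>Function spaces on the domain\<close>

text \<open>Elements of $L^2$ and of Sobolev spaces are represented by functions on the whole space, of
  which only the values on \<open>\<Omega>\<close> matter.\<close>

definition L2_fun :: "(real^'d) set \<Rightarrow> (real^'d \<Rightarrow> real) \<Rightarrow> bool" where
  "L2_fun \<Omega> v \<longleftrightarrow> v \<in> borel_measurable (lebesgue_on \<Omega>) \<and> integrable (lebesgue_on \<Omega>) (\<lambda>x. (v x)\<^sup>2)"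

definition L2_inner :: "(real^'d) set \<Rightarrow> (real^'d \<Rightarrow> real) \<Rightarrow> (real^'d \<Rightarrow> real) \<Rightarrow> real" where
  "L2_inner \<Omega> u v = (LINT x|lebesgue_on \<Omega>. u x * v x)"

definition L2_norm :: "(real^'d) set \<Rightarrow> (real^'d \<Rightarrow> real) \<Rightarrow> real" where
  "L2_norm \<Omega> v = sqrt (L2_inner \<Omega> v v)"

definition pderiv_at :: "'d \<Rightarrow> (real^'d \<Rightarrow> real) \<Rightarrow> real^'d \<Rightarrow> real" where
  "pderiv_at i \<phi> x = frechet_derivative \<phi> (at x) (axis i 1)"

primrec Ck_fun :: "nat \<Rightarrow> (real^'d \<Rightarrow> real) \<Rightarrow> bool" where
  "Ck_fun 0 \<phi> \<longleftrightarrow> continuous_on UNIV \<phi>"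
| "Ck_fun (Suc n) \<phi> \<longleftrightarrow> \<phi> differentiable_on UNIV \<and> (\<forall>i. Ck_fun n (pderiv_at i \<phi>))"

definition test_fun :: "(real^'d) set \<Rightarrow> (real^'d \<Rightarrow> real) \<Rightarrow> bool" where
  "test_fun \<Omega> \<phi> \<longleftrightarrow> (\<forall>n. Ck_fun n \<phi>) \<and> (\<exists>K. compact K \<and> K \<subseteq> \<Omega> \<and> (\<forall>x. x \<notin> K \<longrightarrow> \<phi> x = 0))"

definition L1loc_fun :: "(real^'d) set \<Rightarrow> (real^'d \<Rightarrow> real) \<Rightarrow> bool" where
  "L1loc_fun \<Omega> v \<longleftrightarrow> (\<forall>K. compact K \<and> K \<subseteq> \<Omega> \<longrightarrow> integrable (lebesgue_on K) v)"

definition has_weak_pderiv ::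
    "(real^'d) set \<Rightarrow> 'd \<Rightarrow> (real^'d \<Rightarrow> real) \<Rightarrow> (real^'d \<Rightarrow> real) \<Rightarrow> bool" where
  "has_weak_pderiv \<Omega> i u g \<longleftrightarrow>
     L1loc_fun \<Omega> u \<and> L1loc_fun \<Omega> g \<and>
     (\<forall>\<phi>. test_fun \<Omega> \<phi> \<longrightarrow>
        (LINT x|lebesgue_on \<Omega>. u x * pderiv_at i \<phi> x) = - (LINT x|lebesgue_on \<Omega>. g x * \<phi> x))"

text \<open>Weak derivatives are unique up to null sets, so the choice below is immaterial under integrals
  over \<open>\<Omega>\<close>.\<close>

definition weak_pderiv :: "(real^'d) set \<Rightarrow> 'd \<Rightarrow> (real^'d \<Rightarrow> real) \<Rightarrow> real^'d \<Rightarrow> real" where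
  "weak_pderiv \<Omega> i u = (SOME g. has_weak_pderiv \<Omega> i u g)"

definition H1_fun :: "(real^'d) set \<Rightarrow> (real^'d \<Rightarrow> real) \<Rightarrow> bool" where
  "H1_fun \<Omega> u \<longleftrightarrow> L2_fun \<Omega> u \<and> (\<forall>i. \<exists>g. L2_fun \<Omega> g \<and> has_weak_pderiv \<Omega> i u g)"

definition H1_norm :: "(real^'d) set \<Rightarrow> (real^'d \<Rightarrow> real) \<Rightarrow> real" where
  "H1_norm \<Omega> u = sqrt ((L2_norm \<Omega> u)\<^sup>2 + (\<Sum>i\<in>UNIV. (L2_norm \<Omega> (weak_pderiv \<Omega> i u))\<^sup>2))"

definition H10_fun :: "(real^'d) set \<Rightarrow> (real^'d \<Rightarrow> real) \<Rightarrow> bool" where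
  "H10_fun \<Omega> u \<longleftrightarrow>
     H1_fun \<Omega> u \<and>
     (\<exists>\<phi>. (\<forall>n::nat. test_fun \<Omega> (\<phi> n)) \<and> (\<lambda>n. H1_norm \<Omega> (\<lambda>x. \<phi> n x - u x)) \<longlonglongrightarrow> 0)"


section \<open>Bochner spaces in time\<close>

definition simple_L2_fun :: "(real^'d) set \<Rightarrow> real set \<Rightarrow> (real \<Rightarrow> real^'d \<Rightarrow> real) \<Rightarrow> bool" where
  "simple_L2_fun \<Omega> J s \<longleftrightarrow>
     finite (s ` J) \<and> (\<forall>v\<in>s ` J. L2_fun \<Omega> v \<and> {t \<in> J. s t = v} \<in> sets lebesgue)"

text \<open>Strong (Bochner) measurability of an $L^2(\Omega)$-valued function on \<open>J\<close>.\<close>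

definition strongly_measurable_L2 ::
    "(real^'d) set \<Rightarrow> real set \<Rightarrow> (real \<Rightarrow> real^'d \<Rightarrow> real) \<Rightarrow> bool" where
  "strongly_measurable_L2 \<Omega> J g \<longleftrightarrow>
     (AE t in lebesgue_on J. L2_fun \<Omega> (g t)) \<and>
     (\<exists>s. (\<forall>n::nat. simple_L2_fun \<Omega> J (s n)) \<and>
        (AE t in lebesgue_on J. (\<lambda>n. L2_norm \<Omega> (\<lambda>x. s n t x - g t x)) \<longlonglongrightarrow> 0))"

definition Lp_L2_fun ::
    "real \<Rightarrow> (real^'d) set \<Rightarrow> real set \<Rightarrow> (real \<Rightarrow> real^'d \<Rightarrow> real) \<Rightarrow> bool" where
  "Lp_L2_fun p \<Omega> J g \<longleftrightarrow>
     strongly_measurable_L2 \<Omega> J g \<and> integrable (lebesgue_on J) (\<lambda>t. L2_norm \<Omega> (g t) powr p)"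

definition Lp_L2_norm ::
    "real \<Rightarrow> (real^'d) set \<Rightarrow> real set \<Rightarrow> (real \<Rightarrow> real^'d \<Rightarrow> real) \<Rightarrow> real" where
  "Lp_L2_norm p \<Omega> J g = (LINT t|lebesgue_on J. L2_norm \<Omega> (g t) powr p) powr (1 / p)"


section \<open>Coefficients and bilinear form\<close>

definition admissible_coeffs ::
    "(real^'d) set \<Rightarrow> real \<Rightarrow> ('d \<Rightarrow> 'd \<Rightarrow> real \<Rightarrow> real^'d \<Rightarrow> real) \<Rightarrow> real \<Rightarrow> (real \<Rightarrow> real) \<Rightarrow> bool" where
  "admissible_coeffs \<Omega> T a \<alpha> \<omega> \<longleftrightarrow>
     (\<forall>i j. (\<lambda>(t, x). a i j t x) \<in> borel_measurable (lebesgue_on ({0<..<T} \<times> \<Omega>))) \<and>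
     (\<forall>i j. \<exists>B. AE (t, x) in lebesgue_on ({0<..<T} \<times> \<Omega>). \<bar>a i j t x\<bar> \<le> B) \<and>
     (\<forall>i j. AE (t, x) in lebesgue_on ({0<..<T} \<times> \<Omega>). a i j t x = a j i t x) \<and>
     \<alpha> > 0 \<and>
     (\<forall>\<xi>::real^'d. AE (t, x) in lebesgue_on ({0<..<T} \<times> \<Omega>).
        (\<Sum>i\<in>UNIV. \<Sum>j\<in>UNIV. a i j t x * \<xi> $ i * \<xi> $ j) \<ge> \<alpha> * (norm \<xi>)\<^sup>2) \<and>
     (\<forall>i j. AE x in lebesgue_on \<Omega>. continuous_on {0..T} (\<lambda>t. a i j t x)) \<and>
     (\<forall>i j. \<forall>t1\<in>{0..T}. \<forall>t2\<in>{0..T}.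
        AE x in lebesgue_on \<Omega>. \<bar>a i j t1 x - a i j t2 x\<bar> \<le> \<omega> \<bar>t1 - t2\<bar>)"

definition admissible_modulus :: "real \<Rightarrow> (real \<Rightarrow> real) \<Rightarrow> bool" where
  "admissible_modulus T \<omega> \<longleftrightarrow>
     (\<forall>s\<in>{0..T}. \<omega> s \<ge> 0) \<and> mono_on {0..T} \<omega> \<and>
     antimono_on {0<..T} (\<lambda>s. \<omega> s / s powr (3/2)) \<and>
     integrable (lebesgue_on {0<..T}) (\<lambda>s. \<omega> s * s powr (-3/2))"

definition bform ::
    "(real^'d) set \<Rightarrow> ('d \<Rightarrow> 'd \<Rightarrow> real \<Rightarrow> real^'d \<Rightarrow> real) \<Rightarrow> real
      \<Rightarrow> (real^'d \<Rightarrow> real) \<Rightarrow> (real^'d \<Rightarrow> real) \<Rightarrow> real" where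
  "bform \<Omega> a t u v = (LINT x|lebesgue_on \<Omega>.
     (\<Sum>i\<in>UNIV. \<Sum>j\<in>UNIV. a i j t x * weak_pderiv \<Omega> i u x * weak_pderiv \<Omega> j v x))"


section \<open>Time meshes\<close>

definition time_mesh :: "real \<Rightarrow> nat \<Rightarrow> (nat \<Rightarrow> real) \<Rightarrow> bool" where
  "time_mesh T M \<theta> \<longleftrightarrow> \<theta> 0 = 0 \<and> \<theta> M = T \<and> (\<forall>m<M. \<theta> m < \<theta> (Suc m))"

text \<open>In \<open>subint \<theta> m\<close> and \<open>tstep \<theta> m\<close> the index is meant to satisfy \<open>1 \<le> m \<le> M\<close>.\<close>

definition subint :: "(nat \<Rightarrow> real) \<Rightarrow> nat \<Rightarrow> real set" where
  "subint \<theta> m = {\<theta> (m - 1)<..\<theta> m}"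

definition tstep :: "(nat \<Rightarrow> real) \<Rightarrow> nat \<Rightarrow> real" where
  "tstep \<theta> m = \<theta> m - \<theta> (m - 1)"

definition kmax :: "nat \<Rightarrow> (nat \<Rightarrow> real) \<Rightarrow> real" where
  "kmax M \<theta> = Max (tstep \<theta> ` {1..M})"

definition kmin :: "nat \<Rightarrow> (nat \<Rightarrow> real) \<Rightarrow> real" where
  "kmin M \<theta> = Min (tstep \<theta> ` {1..M})"

definition mesh_conditions ::
    "real \<Rightarrow> real \<Rightarrow> real \<Rightarrow> real \<Rightarrow> nat \<Rightarrow> (nat \<Rightarrow> real) \<Rightarrow> bool" where
  "mesh_conditions T c \<beta> \<kappa> M \<theta> \<longleftrightarrow>
     kmin M \<theta> \<ge> c * kmax M \<theta> powr \<beta> \<and>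
     (\<forall>m. 1 \<le> m \<and> m \<le> M - 1 \<longrightarrow>
        inverse \<kappa> \<le> tstep \<theta> m / tstep \<theta> (m + 1) \<and> tstep \<theta> m / tstep \<theta> (m + 1) \<le> \<kappa>) \<and>
     kmax M \<theta> \<le> T / 4"


section \<open>Discrete spaces and operators\<close>

definition poly_deg_le :: "nat \<Rightarrow> (real^'d \<Rightarrow> real) \<Rightarrow> bool" where
  "poly_deg_le r q \<longleftrightarrow> (\<exists>C :: ('d \<Rightarrow> nat) \<Rightarrow> real. \<forall>x.
     q x = (\<Sum>\<nu> | (\<Sum>i\<in>UNIV. \<nu> i) \<le> r. C \<nu> * (\<Prod>i\<in>UNIV. (x $ i) ^ \<nu> i)))"

text \<open>Every element is represented by its continuous representative, extended by \<open>0\<close> outside \<open>\<Omega>\<close>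
  (piecewise polynomials in $H^1_0$ are continuous and vanish on the boundary). This makes the
  space a finite-dimensional space of functions, on which the $L^2(\Omega)$ inner product is definite.\<close>

definition fe_space :: "(real^'d) set \<Rightarrow> (real^'d) set set \<Rightarrow> nat \<Rightarrow> (real^'d \<Rightarrow> real) set" where
  "fe_space \<Omega> \<T> r = {v. H10_fun \<Omega> v \<and>
     (\<forall>\<tau>\<in>\<T>. \<exists>q. poly_deg_le r q \<and> (\<forall>x\<in>\<tau>. v x = q x)) \<and> (\<forall>x. x \<notin> \<Omega> \<longrightarrow> v x = 0)}"

definition A_h ::
    "(real^'d) set \<Rightarrow> ('d \<Rightarrow> 'd \<Rightarrow> real \<Rightarrow> real^'d \<Rightarrow> real) \<Rightarrow> (real^'d \<Rightarrow> real) set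
      \<Rightarrow> real \<Rightarrow> (real^'d \<Rightarrow> real) \<Rightarrow> real^'d \<Rightarrow> real" where
  "A_h \<Omega> a V t v = (THE w. w \<in> V \<and> (\<forall>\<psi>\<in>V. L2_inner \<Omega> w \<psi> = bform \<Omega> a t v \<psi>))"

text \<open>The mean over \<open>I\<^sub>m\<close> of the operators \<open>A\<^sub>h(t)\<close>. As the discrete space is finite-dimensional, applying
  the operator to \<open>v\<close> and evaluating at \<open>x\<close> commute with the operator-valued integral.\<close>

definition A_kh ::
    "(real^'d) set \<Rightarrow> ('d \<Rightarrow> 'd \<Rightarrow> real \<Rightarrow> real^'d \<Rightarrow> real) \<Rightarrow> (real^'d \<Rightarrow> real) set
      \<Rightarrow> (nat \<Rightarrow> real) \<Rightarrow> nat \<Rightarrow> (real^'d \<Rightarrow> real) \<Rightarrow> real^'d \<Rightarrow> real" where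
  "A_kh \<Omega> a V \<theta> m v x = (1 / tstep \<theta> m) * (LINT t|lebesgue_on (subint \<theta> m). A_h \<Omega> a V t v x)"

definition X_kh ::
    "(real^'d \<Rightarrow> real) set \<Rightarrow> nat \<Rightarrow> (nat \<Rightarrow> real) \<Rightarrow> (real \<Rightarrow> real^'d \<Rightarrow> real) set" where
  "X_kh V M \<theta> = {w. \<forall>m\<in>{1..M}. \<exists>v\<in>V. \<forall>t\<in>subint \<theta> m. w t = v}"

text \<open>The constant value on \<open>I\<^sub>m\<close>, read off at the right end point, which belongs to \<open>I\<^sub>m\<close>.\<close>

definition piece :: "(nat \<Rightarrow> real) \<Rightarrow> (real \<Rightarrow> real^'d \<Rightarrow> real) \<Rightarrow> nat \<Rightarrow> real^'d \<Rightarrow> real" where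
  "piece \<theta> w m = w (\<theta> m)"

definition jump :: "(nat \<Rightarrow> real) \<Rightarrow> (real \<Rightarrow> real^'d \<Rightarrow> real) \<Rightarrow> nat \<Rightarrow> real^'d \<Rightarrow> real" where
  "jump \<theta> w m x = (if m = 0 then piece \<theta> w 1 x else piece \<theta> w (m + 1) x - piece \<theta> w m x)"

text \<open>Solution of the fully discrete scheme with right-hand side \<open>f\<close> and zero initial value.\<close>

definition fully_discrete_solution ::
    "(real^'d) set \<Rightarrow> real \<Rightarrow> ('d \<Rightarrow> 'd \<Rightarrow> real \<Rightarrow> real^'d \<Rightarrow> real) \<Rightarrow> (real^'d \<Rightarrow> real) set
      \<Rightarrow> nat \<Rightarrow> (nat \<Rightarrow> real) \<Rightarrow> (real \<Rightarrow> real^'d \<Rightarrow> real) \<Rightarrow> (real \<Rightarrow> real^'d \<Rightarrow> real) \<Rightarrow> bool" where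
  "fully_discrete_solution \<Omega> T a V M \<theta> f u \<longleftrightarrow>
     u \<in> X_kh V M \<theta> \<and>
     (\<forall>\<phi>\<in>X_kh V M \<theta>.
        (LINT t|lebesgue_on {0<..<T}. bform \<Omega> a t (u t) (\<phi> t))
        + (\<Sum>m=2..M. L2_inner \<Omega> (\<lambda>x. piece \<theta> u m x - piece \<theta> u (m - 1) x) (piece \<theta> \<phi> m))
        + L2_inner \<Omega> (piece \<theta> u 1) (piece \<theta> \<phi> 1)
        = (LINT t|lebesgue_on {0<..<T}. L2_inner \<Omega> (f t) (\<phi> t)))"

end

theory Submission
  imports Defs "HOL-Library.Function_Algebras"
begin

text \<open>
  Fix a time step \<open>m\<close> and replace all forms by the one averaged over \<open>I\<^sub>m\<close>. With \<open>A = A\<^sub>k\<^sub>h\<^sub>,\<^sub>m\<close> and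
  \<open>s\<^sub>j = t\<^sub>m - t\<^sub>j\<^sub>-\<^sub>1\<close> the scheme then reads
  \<open>u\<^sub>j - u\<^sub>j\<^sub>-\<^sub>1 + k\<^sub>j A u\<^sub>j = k\<^sub>j f\<^sub>j + k\<^sub>j (A - A\<^sub>j) u\<^sub>j\<close>, so that \<open>A u\<^sub>m\<close> is a sum over \<open>j \<le> m\<close> of the
  operators \<open>A (I + k\<^sub>m A)\<^sup>-\<^sup>1 \<cdots> (I + k\<^sub>j A)\<^sup>-\<^sup>1\<close> applied to the right-hand sides. On \<open>f\<^sub>j\<close> such an operator
  is bounded by \<open>1 / s\<^sub>j\<close>. On the consistency term, \<open>(A - A\<^sub>j) u\<^sub>j\<close> has size
  \<open>\<omega>(s\<^sub>j) \<parallel>\<nabla>u\<^sub>j\<parallel>\<close> in the dual of the energy space, and the operator costs \<open>s\<^sub>j\<^sup>-\<^sup>3\<^sup>/\<^sup>2\<close> from there. Hence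
  \<open>\<parallel>A u\<^sub>m\<parallel> \<le> \<Sum> k\<^sub>j s\<^sub>j\<^sup>-\<^sup>1 \<parallel>f\<^sub>j\<parallel> + C \<Sum> k\<^sub>j \<omega>(s\<^sub>j) s\<^sub>j\<^sup>-\<^sup>3\<^sup>/\<^sup>2 \<parallel>\<nabla>u\<^sub>j\<parallel>\<close>.
  The first kernel has row and column sums of order \<open>1 + ln (T / k\<^sub>m\<^sub>i\<^sub>n)\<close>, which is where the
  logarithm comes from (by the lower bound on the steps it is comparable to \<open>ln (T / k)\<close>), and the second one is summable because \<open>\<omega>(t) t\<^sup>-\<^sup>3\<^sup>/\<^sup>2\<close> is integrable and non-increasing.
  Schur's test turns these bounds into bounds in discrete \<open>L\<^sup>p\<close> with constants independent of \<open>p\<close>.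

  It remains to bound the energy norms. The same representation gives
  \<open>\<parallel>\<nabla>u\<^sub>m\<parallel> \<le> C \<Sum> k\<^sub>j s\<^sub>j\<^sup>-\<^sup>1\<^sup>/\<^sup>2 \<parallel>f\<^sub>j\<parallel> + C \<Sum> k\<^sub>j \<omega>(s\<^sub>j) s\<^sub>j\<^sup>-\<^sup>1 \<parallel>\<nabla>u\<^sub>j\<parallel>\<close>; after multiplication by
  \<open>exp (- \<mu> t\<^sub>m)\<close> the last kernel has arbitrarily small norm when \<open>\<mu>\<close> is large, and the last sum is
  absorbed. Undoing the weight produces the factor \<open>exp (\<mu> T)\<close>. The two bounds are
  \<open>energy_bound\<close> and \<open>operator_bound\<close>, their summation is \<open>energy_estimate\<close> and \<open>maximal_regularity\<close>.
  The bound for the jumps follows since \<open>[u]\<^sub>m\<^sub>-\<^sub>1 / k\<^sub>m\<close> is the projected data minus \<open>A u\<^sub>m\<close>.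

  The operator bounds are proved without diagonalizing \<open>A\<close>: if \<open>v = (I + k\<^sub>m A) \<cdots> (I + k\<^sub>j A) y\<close>, then
  \<open>v\<close> is a combination of the vectors \<open>A\<^sup>i y\<close> with nonnegative coefficients, the first two of which are \<open>1\<close> and \<open>s\<^sub>j\<close>,
  and since all the numbers \<open>(A\<^sup>i y, A\<^sup>l y)\<close> are nonnegative, each single term of the expanded square is a
  lower bound for \<open>\<parallel>v\<parallel>\<^sup>2\<close> (\<open>smoothing\<close>). These bounds hold with the
  same constants in every finite-dimensional space, so that the result does not depend on the triangulation.

  The remaining work identifies the concrete objects with the abstract ones: the finite element space is a
  finite-dimensional space on which the inner product of $L^2(\Omega)$ is definite, which needs the linearity
  and hence the uniqueness of weak derivatives (\<open>AE_zero_on_open\<close>); the bilinear form is symmetric, coercive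
  and continuous in time for every single \<open>t\<close> (\<open>good_coeffs_all_times\<close>); and the mean of the operators
  \<open>A\<^sub>h(t)\<close> is the operator of the mean form (\<open>A_kh_eq\<close>).
\<close>

section \<open>Symmetric forms on spaces of functions\<close>

text \<open>Pointwise operations make every set of functions closed under linear combinations a subspace, so that spans and bases
  of spaces of functions come from the library.\<close>

instantiation "fun" :: (type, real_vector) real_vector
begin

definition scaleR_fun :: "real \<Rightarrow> ('a \<Rightarrow> 'b) \<Rightarrow> 'a \<Rightarrow> 'b" where
  "scaleR_fun c f = (\<lambda>x. c *\<^sub>R f x)"

instance
  by standard (auto simp: scaleR_fun_def plus_fun_def algebra_simps)

end

lemma scaleR_fun_apply [simp]: "(c *\<^sub>R f) x = c *\<^sub>R f x"
  by (simp add: scaleR_fun_def)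

lemma sum_fun_apply: "(\<Sum>i\<in>I. f i) x = (\<Sum>i\<in>I. f i x)"
  by (induction I rule: infinite_finite_induct) auto

text \<open>The form is only required to be linear on \<open>V\<close>: integrals of products are additive on square integrable
  functions but not on arbitrary ones. Definiteness is left to \<open>finite_inner_product\<close>, so that the energy
  forms and the inner product of the ambient space $L^2$ are covered as well.\<close>

locale symmetric_form =
  fixes V :: "'v::real_vector set" and B :: "'v \<Rightarrow> 'v \<Rightarrow> real"
  assumes subspace: "subspace V"
    and sym: "u \<in> V \<Longrightarrow> v \<in> V \<Longrightarrow> B u v = B v u"
    and add_left: "u \<in> V \<Longrightarrow> v \<in> V \<Longrightarrow> w \<in> V \<Longrightarrow> B (u + v) w = B u w + B v w"
    and scale_left: "u \<in> V \<Longrightarrow> w \<in> V \<Longrightarrow> B (c *\<^sub>R u) w = c * B u w"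
    and nonneg: "u \<in> V \<Longrightarrow> 0 \<le> B u u"
begin

definition nrm :: "'v \<Rightarrow> real" where
  "nrm u = sqrt (B u u)"

lemma closed [simp]: "0 \<in> V" "u \<in> V \<Longrightarrow> v \<in> V \<Longrightarrow> u + v \<in> V" "u \<in> V \<Longrightarrow> c *\<^sub>R u \<in> V"
  "u \<in> V \<Longrightarrow> v \<in> V \<Longrightarrow> u - v \<in> V" "u \<in> V \<Longrightarrow> - u \<in> V"
  using subspace by (auto simp: subspace_0 subspace_add subspace_scale subspace_diff subspace_neg)

lemma closed_sum [simp]: "(\<And>i. i \<in> I \<Longrightarrow> f i \<in> V) \<Longrightarrow> (\<Sum>i\<in>I. f i) \<in> V"
  using subspace by (rule subspace_sum)

lemma add_right: "u \<in> V \<Longrightarrow> v \<in> V \<Longrightarrow> w \<in> V \<Longrightarrow> B w (u + v) = B w u + B w v"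
  by (metis add_left closed(2) sym)

lemma scale_right: "u \<in> V \<Longrightarrow> w \<in> V \<Longrightarrow> B w (c *\<^sub>R u) = c * B w u"
  by (metis scale_left closed(3) sym)

lemma minus_left: "u \<in> V \<Longrightarrow> w \<in> V \<Longrightarrow> B (- u) w = - B u w"
  using scale_left[of u w "-1"] by simp

lemma diff_left: "u \<in> V \<Longrightarrow> v \<in> V \<Longrightarrow> w \<in> V \<Longrightarrow> B (u - v) w = B u w - B v w"
  using add_left[of u "- v" w] minus_left[of v w] by simp

lemma zero_left: "w \<in> V \<Longrightarrow> B 0 w = 0"
  using scale_left[of 0 w 0] by simp

lemma zero_right: "w \<in> V \<Longrightarrow> B w 0 = 0"
  using scale_right[of 0 w 0] by simp

lemma sum_left:
  assumes "\<And>i. i \<in> I \<Longrightarrow> f i \<in> V" "w \<in> V"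
  shows "B (\<Sum>i\<in>I. c i *\<^sub>R f i) w = (\<Sum>i\<in>I. c i * B (f i) w)"
  using assms
  by (induction I rule: infinite_finite_induct) (auto simp: zero_left add_left scale_left)

lemma sum_right:
  assumes "\<And>i. i \<in> I \<Longrightarrow> f i \<in> V" "w \<in> V"
  shows "B w (\<Sum>i\<in>I. c i *\<^sub>R f i) = (\<Sum>i\<in>I. c i * B w (f i))"
  using assms
  by (induction I rule: infinite_finite_induct) (auto simp: zero_right add_right scale_right)

lemma nrm_nonneg [simp]: "u \<in> V \<Longrightarrow> 0 \<le> nrm u"
  by (simp add: nrm_def nonneg)

lemma nrm_sq: "u \<in> V \<Longrightarrow> (nrm u)\<^sup>2 = B u u"
  by (simp add: nrm_def nonneg)

lemma nrm_scale: "u \<in> V \<Longrightarrow> nrm (c *\<^sub>R u) = \<bar>c\<bar> * nrm u"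
  by (simp add: nrm_def scale_left scale_right real_sqrt_mult mult.assoc[symmetric] nonneg)

lemma Cauchy_Schwarz:
  assumes u: "u \<in> V" and v: "v \<in> V"
  shows "\<bar>B u v\<bar> \<le> nrm u * nrm v"
proof -
  have quad: "0 \<le> B u u + 2 * t * B u v + t\<^sup>2 * B v v" for t
  proof -
    have "0 \<le> B (u + t *\<^sub>R v) (u + t *\<^sub>R v)"
      using u v by (intro nonneg) simp
    also have "\<dots> = B u u + 2 * t * B u v + t\<^sup>2 * B v v"
      using u v by (simp add: add_left add_right scale_left scale_right sym[of v u]
          algebra_simps power2_eq_square)
    finally show ?thesis .
  qed
  have "(B u v)\<^sup>2 \<le> B u u * B v v"
  proof (cases "B v v = 0")
    case True
    have "B u v = 0"
    proof (rule ccontr)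
      assume "B u v \<noteq> 0"
      then show False
        using quad[of "- (B u u + 1) / (2 * B u v)"] True by (simp add: field_simps)
    qed
    then show ?thesis using True by simp
  next
    case False
    then have "B v v > 0" using nonneg[OF v] by simp
    then show ?thesis
      using quad[of "- B u v / B v v"]
      by (simp add: field_simps power2_eq_square)
  qed
  then have "sqrt ((B u v)\<^sup>2) \<le> sqrt (B u u * B v v)" by (rule real_sqrt_le_mono)
  then show ?thesis by (simp add: nrm_def real_sqrt_mult)
qed

lemma nrm_triangle:
  assumes u: "u \<in> V" and v: "v \<in> V"
  shows "nrm (u + v) \<le> nrm u + nrm v"
proof -
  have "(nrm (u + v))\<^sup>2 = (nrm u)\<^sup>2 + 2 * B u v + (nrm v)\<^sup>2"
    using u v by (simp add: nrm_sq add_left add_right sym[of v u])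
  also have "\<dots> \<le> (nrm u + nrm v)\<^sup>2"
    using Cauchy_Schwarz[OF u v] by (simp add: power2_sum)
  finally show ?thesis
    using u v by (auto intro: power2_le_imp_le)
qed

lemma on_subspace: "subspace W \<Longrightarrow> W \<subseteq> V \<Longrightarrow> symmetric_form W B"
  by unfold_locales (auto intro: sym add_left scale_left nonneg)

end

locale finite_inner_product = symmetric_form +
  assumes definite: "u \<in> V \<Longrightarrow> B u u = 0 \<Longrightarrow> u = 0"
    and finite_span: "\<exists>S. finite S \<and> V \<subseteq> span S"
begin

lemma eqI:
  assumes "u \<in> V" "v \<in> V" "\<And>\<psi>. \<psi> \<in> V \<Longrightarrow> B u \<psi> = B v \<psi>"
  shows "u = v"
proof -
  have "B (u - v) (u - v) = 0" using assms by (simp add: diff_left)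
  then show ?thesis using definite[of "u - v"] assms by simp
qed

text \<open>Gram--Schmidt. The expansion is stated on the whole span, which is what the induction needs.\<close>

lemma orthonormal_span:
  assumes "finite C" "C \<subseteq> V"
  shows "\<exists>E. finite E \<and> E \<subseteq> V \<and> (\<forall>e\<in>E. \<forall>e'\<in>E. B e e' = (if e = e' then 1 else 0)) \<and>
    (\<forall>v\<in>span C. v = (\<Sum>e\<in>E. B v e *\<^sub>R e))"
  using assms
proof (induction C rule: finite_induct)
  case empty
  show ?case by (intro exI[of _ "{}"]) auto
next
  case (insert c C)
  then obtain E where E: "finite E" "E \<subseteq> V"
    and on: "\<And>e e'. e \<in> E \<Longrightarrow> e' \<in> E \<Longrightarrow> B e e' = (if e = e' then 1 else 0)"
    and rep: "\<And>v. v \<in> span C \<Longrightarrow> (\<Sum>e\<in>E. B v e *\<^sub>R e) = v"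
    by (metis insert_subset)
  have c: "c \<in> V" and spanV: "span C \<subseteq> V"
    using insert.prems subspace by (simp_all add: span_minimal)
  \<comment> \<open>the component of the new vector orthogonal to the span so far\<close>
  define q where "q = c - (\<Sum>e\<in>E. B c e *\<^sub>R e)"
  have qV: "q \<in> V" using E c by (auto simp: q_def subset_iff)
  have orth: "B q e = 0" if "e \<in> E" for e
  proof -
    have "B (\<Sum>e\<in>E. B c e *\<^sub>R e) e = (\<Sum>e'\<in>E. B c e' * B e' e)"
      using E that by (intro sum_left) auto
    also have "\<dots> = (\<Sum>e'\<in>E. if e' = e then B c e' else 0)"
      using on that by (intro sum.cong) auto
    also have "\<dots> = B c e" using E that by simp
    finally show ?thesis
      using E c that unfolding q_def by (subst diff_left) (auto simp: subset_iff)
  qed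
  show ?case
  proof (cases "q = 0")
    case True
    then have c_rep: "(\<Sum>e\<in>E. B c e *\<^sub>R e) = c" by (simp add: q_def)
    have "v = (\<Sum>e\<in>E. B v e *\<^sub>R e)" if v: "v \<in> span (insert c C)" for v
    proof -
      obtain k where k: "v - k *\<^sub>R c \<in> span C" using v by (auto simp: span_insert)
      let ?w = "v - k *\<^sub>R c"
      have wV: "?w \<in> V" using k spanV by auto
      have Bv: "B v e = B ?w e + k * B c e" if "e \<in> V" for e
        using add_left[OF wV closed(3)[OF c, of k] that] that c by (simp add: scale_left)
      have "(\<Sum>e\<in>E. B v e *\<^sub>R e) = (\<Sum>e\<in>E. B ?w e *\<^sub>R e + k *\<^sub>R (B c e *\<^sub>R e))"
        using E by (intro sum.cong refl) (auto simp: Bv scaleR_left_distrib subset_iff)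
      also have "\<dots> = ?w + k *\<^sub>R c"
        by (simp only: sum.distrib scaleR_sum_right[symmetric] rep[OF k] c_rep)
      finally show ?thesis by simp
    qed
    then show ?thesis using E on by (intro exI[of _ E] conjI ballI) blast+
  next
    case False
    then have "B q q > 0" using definite[OF qV] nonneg[OF qV] by fastforce
    define n where "n = (1 / sqrt (B q q)) *\<^sub>R q"
    have nV: "n \<in> V" using qV by (simp add: n_def)
    have nn: "B n n = 1"
      using \<open>B q q > 0\<close> qV by (simp add: n_def scale_left scale_right)
    have no_left: "B n e = 0" if "e \<in> E" for e
      using that E(2) qV orth[OF that] by (auto simp: n_def scale_left subset_iff)
    have no: "B n e = 0" "B e n = 0" if "e \<in> E" for e
      using no_left[OF that] sym[of e n] that E(2) nV by auto
    have nE: "n \<notin> E" using no nn by force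
    have qn: "q = B c n *\<^sub>R n"
    proof -
      have "B q n = B c n - B (\<Sum>e\<in>E. B c e *\<^sub>R e) n"
        unfolding q_def using c nV E(2) by (intro diff_left) (auto simp: subset_iff)
      moreover have "B (\<Sum>e\<in>E. B c e *\<^sub>R e) n = 0"
        using E nV no by (subst sum_left) auto
      moreover have "B q n = sqrt (B q q)"
        using qV \<open>B q q > 0\<close> by (simp add: n_def scale_right real_div_sqrt)
      ultimately show ?thesis using \<open>B q q > 0\<close> by (simp add: n_def)
    qed
    have "v = (\<Sum>e\<in>insert n E. B v e *\<^sub>R e)" if v: "v \<in> span (insert c C)" for v
    proof -
      obtain k where k: "v - k *\<^sub>R c \<in> span C" using v by (auto simp: span_insert)
      let ?w = "v - k *\<^sub>R c"
      have wV: "?w \<in> V" using k spanV by auto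
      have wn: "B ?w n = 0"
      proof -
        have "B ?w n = B (\<Sum>e\<in>E. B ?w e *\<^sub>R e) n" by (simp only: rep[OF k])
        also have "\<dots> = 0" using E nV no by (subst sum_left) auto
        finally show ?thesis .
      qed
      have Bv: "B v e = B ?w e + k * B c e" if "e \<in> V" for e
        using add_left[OF wV closed(3)[OF c, of k] that] that c by (simp add: scale_left)
      have "(\<Sum>e\<in>insert n E. B v e *\<^sub>R e)
          = (\<Sum>e\<in>insert n E. B ?w e *\<^sub>R e + k *\<^sub>R (B c e *\<^sub>R e))"
        using E nV by (intro sum.cong refl) (auto simp: Bv scaleR_left_distrib subset_iff)
      also have "\<dots> = (\<Sum>e\<in>E. B ?w e *\<^sub>R e) + k *\<^sub>R (\<Sum>e\<in>insert n E. B c e *\<^sub>R e)"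
        using E nE by (simp add: wn sum.distrib scaleR_sum_right scaleR_right_distrib)
      also have "(\<Sum>e\<in>insert n E. B c e *\<^sub>R e) = c"
        using E nE qn by (simp add: q_def algebra_simps)
      also have "(\<Sum>e\<in>E. B ?w e *\<^sub>R e) = ?w" by (rule rep[OF k])
      finally show ?thesis by simp
    qed
    moreover have "\<forall>e\<in>insert n E. \<forall>e'\<in>insert n E. B e e' = (if e = e' then 1 else 0)"
      using on no nn nE by auto
    ultimately show ?thesis using E nV
      by (intro exI[of _ "insert n E"] conjI) (blast | simp)+
  qed
qed

lemma orthonormal_basis:
  obtains E where "finite E" "E \<subseteq> V" "\<And>v. v \<in> V \<Longrightarrow> v = (\<Sum>e\<in>E. B v e *\<^sub>R e)"
proof -
  obtain S where S: "finite S" "V \<subseteq> span S" using finite_span by blast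
  obtain C where C: "C \<subseteq> V" "independent C" "V \<subseteq> span C"
    using maximal_independent_subset by blast
  have "finite C" using independent_span_bound[of S C] S C by blast
  from orthonormal_span[OF this C(1)] C(3) that show ?thesis by (meson subset_iff)
qed

text \<open>The representing vector is \<open>\<Sum> l e *\<^sub>R e\<close> over an orthonormal basis.\<close>

lemma Riesz:
  assumes add: "\<And>u v. u \<in> V \<Longrightarrow> v \<in> V \<Longrightarrow> l (u + v) = l u + l v"
    and scale: "\<And>c u. u \<in> V \<Longrightarrow> l (c *\<^sub>R u) = c * (l u :: real)"
  shows "\<exists>!w. w \<in> V \<and> (\<forall>v\<in>V. B w v = l v)"
proof -
  obtain E where E: "finite E" "E \<subseteq> V" "\<And>v. v \<in> V \<Longrightarrow> v = (\<Sum>e\<in>E. B v e *\<^sub>R e)"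
    using orthonormal_basis by blast
  have l0: "l 0 = 0" using scale[of 0 0] by simp
  have lsum: "F \<subseteq> V \<Longrightarrow> l (\<Sum>e\<in>F. c e *\<^sub>R e) = (\<Sum>e\<in>F. c e * l e)" for F c
    by (induction F rule: infinite_finite_induct) (auto simp: l0 add scale subset_iff)
  define w where "w = (\<Sum>e\<in>E. l e *\<^sub>R e)"
  have wV: "w \<in> V" using E(2) by (auto simp: w_def subset_iff)
  have "B w v = l v" if v: "v \<in> V" for v
  proof -
    have "B w v = (\<Sum>e\<in>E. l e * B e v)" unfolding w_def using E v by (intro sum_left) auto
    also have "\<dots> = (\<Sum>e\<in>E. B v e * l e)" using E v by (intro sum.cong) (auto simp: sym)
    also have "\<dots> = l (\<Sum>e\<in>E. B v e *\<^sub>R e)" using E lsum by simp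
    also have "\<dots> = l v" using E(3)[OF v] by simp
    finally show ?thesis .
  qed
  then show ?thesis using wV by (metis eqI)
qed

end

text \<open>The operator that represents the form \<open>a\<close> with respect to \<open>B\<close>. With the inner product of
  $L^2$ and the bilinear form at time \<open>t\<close> this is \<^const>\<open>A_h\<close>.\<close>

definition form_operator ::
    "'v set \<Rightarrow> ('v \<Rightarrow> 'v \<Rightarrow> real) \<Rightarrow> ('v \<Rightarrow> 'v \<Rightarrow> real) \<Rightarrow> 'v \<Rightarrow> 'v" where
  "form_operator V B a v = (THE w. w \<in> V \<and> (\<forall>\<psi>\<in>V. B w \<psi> = a v \<psi>))"

section \<open>Smoothing by a product of resolvents\<close>

locale form_pair = finite_inner_product V B + a: symmetric_form V a
  for V :: "'v::real_vector set" and B a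
begin

abbreviation A :: "'v \<Rightarrow> 'v" where
  "A \<equiv> form_operator V B a"

lemma A_props:
  assumes "v \<in> V"
  shows A_in [simp]: "A v \<in> V" and A_form: "\<psi> \<in> V \<Longrightarrow> B (A v) \<psi> = a v \<psi>"
proof -
  have "\<exists>!w. w \<in> V \<and> (\<forall>\<psi>\<in>V. B w \<psi> = a v \<psi>)"
    using assms by (intro Riesz) (auto simp: a.add_right a.scale_right)
  from theI'[OF this] show "A v \<in> V" "\<psi> \<in> V \<Longrightarrow> B (A v) \<psi> = a v \<psi>"
    by (auto simp: form_operator_def)
qed

lemma A_form_right: "v \<in> V \<Longrightarrow> \<psi> \<in> V \<Longrightarrow> B \<psi> (A v) = a v \<psi>"
  using A_form[of v \<psi>] sym by simp

lemma A_unique: "v \<in> V \<Longrightarrow> w \<in> V \<Longrightarrow> (\<And>\<psi>. \<psi> \<in> V \<Longrightarrow> B w \<psi> = a v \<psi>) \<Longrightarrow> A v = w"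
  by (intro eqI) (auto simp: A_form)

lemma A_add: "u \<in> V \<Longrightarrow> v \<in> V \<Longrightarrow> A (u + v) = A u + A v"
  by (intro A_unique) (auto simp: A_form add_left a.add_left)

lemma A_scale: "u \<in> V \<Longrightarrow> A (c *\<^sub>R u) = c *\<^sub>R A u"
  by (intro A_unique) (auto simp: A_form scale_left a.scale_left)

lemma A_pow_in [simp]: "u \<in> V \<Longrightarrow> (A ^^ i) u \<in> V"
  by (induction i) auto

lemma A_pow_add: "u \<in> V \<Longrightarrow> v \<in> V \<Longrightarrow> (A ^^ i) (u + v) = (A ^^ i) u + (A ^^ i) v"
  by (induction i) (auto simp: A_add)

lemma A_pow_scale: "u \<in> V \<Longrightarrow> (A ^^ i) (c *\<^sub>R u) = c *\<^sub>R (A ^^ i) u"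
  by (induction i) (auto simp: A_scale)

lemma A_symmetric: "u \<in> V \<Longrightarrow> v \<in> V \<Longrightarrow> B (A u) v = B u (A v)"
  by (simp add: A_form A_form_right a.sym)

lemma A_pow_move: "u \<in> V \<Longrightarrow> B ((A ^^ (i + l)) u) ((A ^^ j) u) = B ((A ^^ i) u) ((A ^^ (j + l)) u)"
proof (induction l arbitrary: j)
  case (Suc l)
  then show ?case using Suc.IH[of "Suc j"] by (simp add: A_symmetric)
qed simp

lemma moment_eq:
  assumes "u \<in> V" "i + j = i' + j'"
  shows "B ((A ^^ i) u) ((A ^^ j) u) = B ((A ^^ i') u) ((A ^^ j') u)"
proof -
  have "B ((A ^^ i) u) ((A ^^ j) u) = B ((A ^^ (i + j)) u) ((A ^^ 0) u)" for i j
    using A_pow_move[OF assms(1), of 0 i j] A_pow_move[OF assms(1), of 0 "i + j" 0]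
    by (simp add: add.commute)
  then show ?thesis using assms(2) by metis
qed

text \<open>The factors \<open>A\<close> can be shared equally between both arguments, up to one that is left over. An even number
  gives a square, an odd number the form \<open>a\<close> on the diagonal.\<close>

lemma moment_nonneg:
  assumes u: "u \<in> V"
  shows "0 \<le> B ((A ^^ i) u) ((A ^^ j) u)"
proof -
  have "\<exists>h. i + j = h + h \<or> i + j = Suc h + h" by presburger
  then obtain h where "i + j = h + h \<or> i + j = Suc h + h" by blast
  then show ?thesis
  proof
    assume "i + j = h + h"
    then show ?thesis using moment_eq[OF u] nonneg[OF A_pow_in[OF u]] by metis
  next
    assume "i + j = Suc h + h"
    then have "B ((A ^^ i) u) ((A ^^ j) u) = a ((A ^^ h) u) ((A ^^ h) u)"
      using moment_eq[OF u, of i j "Suc h" h] u by (simp add: A_form)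
    then show ?thesis using a.nonneg[of "(A ^^ h) u"] u by simp
  qed
qed

text \<open>The equation \<open>z + k A z = v\<close> is the Riesz representation of \<open>B v\<close> in the inner product
  \<open>B + k a\<close>.\<close>

lemma resolvent:
  assumes "k \<ge> 0" "v \<in> V"
  shows "\<exists>z\<in>V. z + k *\<^sub>R A z = v"
proof -
  interpret R: finite_inner_product V "\<lambda>u v. B u v + k * a u v"
  proof
    fix u assume "u \<in> V" "B u u + k * a u u = 0"
    moreover have "0 \<le> B u u" "0 \<le> k * a u u"
      using nonneg a.nonneg assms \<open>u \<in> V\<close> by auto
    ultimately show "u = 0" using definite[of u] by linarith
  next
    show "B u w + k * a u w = B w u + k * a w u" if "u \<in> V" "w \<in> V" for u w
      using that by (simp add: sym a.sym)
  qed (use assms subspace finite_span in \<open>auto simp: add_left a.add_left scale_left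
      a.scale_left nonneg a.nonneg algebra_simps\<close>)
  have "\<exists>!z. z \<in> V \<and> (\<forall>\<psi>\<in>V. B z \<psi> + k * a z \<psi> = B v \<psi>)"
    using assms by (intro R.Riesz) (simp_all add: add_right scale_right)
  then obtain z where z: "z \<in> V" "\<And>\<psi>. \<psi> \<in> V \<Longrightarrow> B z \<psi> + k * a z \<psi> = B v \<psi>" by blast
  have "z + k *\<^sub>R A z = v"
    using z assms by (intro eqI) (auto simp: add_left scale_left A_form)
  then show ?thesis using z by blast
qed

text \<open>\<open>v\<close> is a polynomial in \<open>A\<close> with nonnegative coefficients, beginning with \<open>1, s,
  q\<close>, applied to \<open>y\<close>. For \<open>v = \<Prod> (I + k A) y\<close> the numbers \<open>s\<close> and
  \<open>q\<close> are the first two elementary symmetric functions of the step sizes. Requiring \<open>3 \<le>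
  n\<close> keeps these coefficients inside the sum; higher ones may vanish.\<close>

definition nonneg_expansion :: "'v \<Rightarrow> 'v \<Rightarrow> real \<Rightarrow> real \<Rightarrow> bool" where
  "nonneg_expansion y v s q \<longleftrightarrow> (\<exists>n e. 3 \<le> n \<and> (\<forall>i. (0::real) \<le> e i) \<and> e 0 = 1 \<and> e 1 = s \<and> e 2 = q \<and>
     v = (\<Sum>i<n. e i *\<^sub>R (A ^^ i) y))"

lemma nonneg_expansion_refl: "nonneg_expansion v v 0 0"
  unfolding nonneg_expansion_def
  by (intro exI[of _ 3] exI[of _ "\<lambda>i. if i = 0 then 1 else 0"]) (auto simp: eval_nat_numeral)

lemma nonneg_expansion_step:
  assumes "nonneg_expansion z v s q" "y \<in> V" "k \<ge> 0" "y + k *\<^sub>R A y = z"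
  shows "nonneg_expansion y v (s + k) (q + k * s)"
proof -
  obtain n e where e: "3 \<le> n" "\<forall>i. (0::real) \<le> e i" "e 0 = 1" "e 1 = s" "e 2 = q"
    and v: "v = (\<Sum>i<n. e i *\<^sub>R (A ^^ i) z)"
    using assms(1) unfolding nonneg_expansion_def by blast
  \<comment> \<open>the coefficients after multiplication by \<open>I + k A\<close>\<close>
  define e' where "e' i = (if i < n then e i else 0) + (if i = 0 then 0 else k * e (i - 1))" for i
  have "v = (\<Sum>i<n. e i *\<^sub>R (A ^^ i) y + (k * e i) *\<^sub>R (A ^^ Suc i) y)"
    unfolding v assms(4)[symmetric] using assms(2)
    by (intro sum.cong refl)
       (simp add: A_pow_add A_pow_scale scaleR_right_distrib funpow_swap1 mult.commute)
  also have "\<dots> = (\<Sum>i<n. e i *\<^sub>R (A ^^ i) y) + (\<Sum>i<n. (k * e i) *\<^sub>R (A ^^ Suc i) y)"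
    by (rule sum.distrib)
  also have "(\<Sum>i<n. e i *\<^sub>R (A ^^ i) y) = (\<Sum>i<Suc n. (if i < n then e i else 0) *\<^sub>R (A ^^ i) y)"
    by simp
  also have "(\<Sum>i<n. (k * e i) *\<^sub>R (A ^^ Suc i) y)
      = (\<Sum>i<Suc n. (if i = 0 then 0 else k * e (i - 1)) *\<^sub>R (A ^^ i) y)"
    by (subst sum.lessThan_Suc_shift) simp
  finally have "v = (\<Sum>i<Suc n. e' i *\<^sub>R (A ^^ i) y)"
    by (simp only: e'_def scaleR_left_distrib sum.distrib)
  moreover have "\<forall>i. 0 \<le> e' i" using e assms(3) by (auto simp: e'_def)
  moreover have "e' 0 = 1" "e' 1 = s + k" "e' 2 = q + k * s" using e by (auto simp: e'_def)
  ultimately show ?thesis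
    unfolding nonneg_expansion_def using e(1) by (intro exI[of _ "Suc n"] exI[of _ e']) auto
qed

lemma nonneg_expansion_nonneg: "nonneg_expansion y v s q \<Longrightarrow> 0 \<le> s \<and> 0 \<le> q"
  unfolding nonneg_expansion_def by auto

text \<open>Every term of the expanded product \<open>B v (A\<^sup>l v)\<close> is nonnegative, so each of them is a lower bound.\<close>

lemma nonneg_expansion_bound:
  assumes ex: "v = (\<Sum>i<n. e i *\<^sub>R (A ^^ i) y)" and e: "\<And>i. (0::real) \<le> e i" and y: "y \<in> V"
    and ij: "i < n" "j < n"
  shows "e i * e j * B ((A ^^ i) y) ((A ^^ (j + l)) y) \<le> B v ((A ^^ l) v)"
proof -
  have v: "v \<in> V" using y ex by simp
  have Av: "(A ^^ l) v = (\<Sum>i<n. e i *\<^sub>R (A ^^ (i + l)) y)"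
  proof -
    have "(A ^^ l) (\<Sum>i\<in>I. e i *\<^sub>R (A ^^ i) y) = (\<Sum>i\<in>I. e i *\<^sub>R (A ^^ (i + l)) y)" if "finite I" for I
      using that
    proof (induction I rule: finite_induct)
      case empty
      show ?case using A_pow_scale[of 0 l 0] by simp
    qed (use y in \<open>auto simp: A_pow_add A_pow_scale funpow_add[symmetric] add.commute
        simp flip: comp_apply[of "A ^^ _" "A ^^ _"]\<close>)
    then show ?thesis using ex by simp
  qed
  have "B v ((A ^^ l) v) = (\<Sum>i<n. e i * B ((A ^^ i) y) ((A ^^ l) v))"
    using y v by (subst ex, subst sum_left) auto
  also have "\<dots> = (\<Sum>i<n. \<Sum>j<n. e i * e j * B ((A ^^ i) y) ((A ^^ (j + l)) y))"
    unfolding Av using y by (simp add: sum_right sum_distrib_left mult.assoc)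
  also have "\<dots> \<ge> (\<Sum>j<n. e i * e j * B ((A ^^ i) y) ((A ^^ (j + l)) y))"
    using e y ij moment_nonneg
    by (intro member_le_sum[of i "{..<n}" "\<lambda>i. \<Sum>j<n. e i * e j * B ((A ^^ i) y) ((A ^^ (j + l)) y)"])
       (auto intro!: sum_nonneg)
  moreover have "(\<Sum>j<n. e i * e j * B ((A ^^ i) y) ((A ^^ (j + l)) y))
      \<ge> e i * e j * B ((A ^^ i) y) ((A ^^ (j + l)) y)"
    using e y ij moment_nonneg
    by (intro member_le_sum[of j "{..<n}" "\<lambda>j. e i * e j * B ((A ^^ i) y) ((A ^^ (j + l)) y)"]) auto
  ultimately show ?thesis by linarith
qed

text \<open>Each estimate keeps one term of \<open>nonneg_expansion_bound\<close>. They bound \<open>A y\<close>, in the norm of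
  \<open>B\<close> and in the energy norm, by \<open>v\<close> in these two norms.\<close>

lemma smoothing:
  assumes "nonneg_expansion y v s q" and y: "y \<in> V"
  shows "v \<in> V"
    and "s * nrm (A y) \<le> nrm v"
    and "s * q * a (A y) (A y) \<le> B v v"
    and "s * B (A y) (A y) \<le> a v v"
    and "s\<^sup>2 * a (A y) (A y) \<le> a v v"
proof -
  obtain n e where n: "3 \<le> n" and e: "\<And>i. (0::real) \<le> e i" and e0: "e 0 = 1" "e 1 = s" "e 2 = q"
    and ex: "v = (\<Sum>i<n. e i *\<^sub>R (A ^^ i) y)"
    using assms(1) unfolding nonneg_expansion_def by blast
  show v: "v \<in> V" using y ex by simp
  note bound = nonneg_expansion_bound[OF ex e y]
  have "s\<^sup>2 * B (A y) (A y) \<le> B v v"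
    using bound[of 1 1 0] n e0 by (simp add: power2_eq_square)
  then have "(s * nrm (A y))\<^sup>2 \<le> (nrm v)\<^sup>2"
    using v y by (simp add: nrm_sq power_mult_distrib)
  then show "s * nrm (A y) \<le> nrm v" using v by (auto intro: power2_le_imp_le)
  have A2: "(A ^^ 2) y = A (A y)" by (simp add: eval_nat_numeral)
  show "s * q * a (A y) (A y) \<le> B v v"
    using bound[of 1 2 0] n e0 y by (simp add: A2 A_form_right)
  show "s * B (A y) (A y) \<le> a v v"
  proof -
    have "s * B ((A ^^ 0) y) ((A ^^ 2) y) \<le> a v v"
      using bound[of 0 1 1] n e0 v by (simp add: A_form_right numeral_2_eq_2)
    also have "B ((A ^^ 0) y) ((A ^^ 2) y) = B ((A ^^ 1) y) ((A ^^ 1) y)"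
      using y by (intro moment_eq) auto
    finally show ?thesis by simp
  qed
  show "s\<^sup>2 * a (A y) (A y) \<le> a v v"
    using bound[of 1 1 1] n e0 y v by (simp add: A_form_right power2_eq_square A2[unfolded numeral_2_eq_2])
qed

lemma backward_chain:
  fixes k :: "nat \<Rightarrow> real"
  assumes k: "\<And>j. 1 \<le> j \<Longrightarrow> j \<le> m \<Longrightarrow> 0 \<le> k j" and v: "v \<in> V"
  obtains y where "\<And>j. y j \<in> V" "y (Suc m) = v"
    "\<And>j. 1 \<le> j \<Longrightarrow> j \<le> m \<Longrightarrow> y j + k j *\<^sub>R A (y j) = y (Suc j)"
proof -
  \<comment> \<open>the resolvents, applied one after the other from step \<open>m\<close> down to step \<open>1\<close>\<close>
  define R where "R k v = (SOME z. z \<in> V \<and> z + k *\<^sub>R A z = v)" for k v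
  have R: "R k v \<in> V \<and> R k v + k *\<^sub>R A (R k v) = v" if "0 \<le> k" "v \<in> V" for k v
    unfolding R_def using resolvent[OF that] by (rule_tac someI_ex) blast
  define Y where "Y = rec_nat v (\<lambda>i z. R (if i < m then k (m - i) else 0) z)"
  have Y0: "Y 0 = v" and YS: "Y (Suc i) = R (if i < m then k (m - i) else 0) (Y i)" for i
    by (simp_all add: Y_def)
  have YV: "Y i \<in> V" for i
  proof (induction i)
    case (Suc i)
    then show ?case using R[of "if i < m then k (m - i) else 0" "Y i"] k[of "m - i"] by (auto simp: YS)
  qed (simp add: Y0 v)
  show ?thesis
  proof (rule that[of "\<lambda>j. Y (Suc m - j)"])
    fix j assume j: "1 \<le> j" "j \<le> m"
    then have "Suc m - j = Suc (m - j)" and "m - (m - j) = j" and "m - j < m" by auto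
    then show "Y (Suc m - j) + k j *\<^sub>R A (Y (Suc m - j)) = Y (Suc m - Suc j)"
      using R[OF k[OF j] YV[of "m - j"]] by (simp add: YS)
  qed (auto simp: YV Y0)
qed

text \<open>A product of at least two resolvents has a quadratic coefficient \<open>q\<close> comparable to
  \<open>s\<^sup>2\<close>; this is what allows three half powers of \<open>A\<close> to be gained. With a single step
  \<open>q\<close> is zero, and with two steps \<open>q\<close> is their product, which is comparable to
  \<open>s\<^sup>2\<close> only because neighbouring steps are comparable.\<close>

lemma chain_expansion:
  fixes t :: "nat \<Rightarrow> real"
  assumes V: "\<And>j. y j \<in> V"
    and chain: "\<And>j. 1 \<le> j \<Longrightarrow> j \<le> m \<Longrightarrow> y j + (t j - t (j - 1)) *\<^sub>R A (y j) = y (Suc j)"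
    and t: "\<And>j. 1 \<le> j \<Longrightarrow> j \<le> m \<Longrightarrow> t (j - 1) < t j"
    and \<kappa>: "\<kappa> > 0"
    and ratio: "\<And>j. 1 \<le> j \<Longrightarrow> j < m \<Longrightarrow> t j - t (j - 1) \<le> \<kappa> * (t (Suc j) - t j)"
      "\<And>j. 1 \<le> j \<Longrightarrow> j < m \<Longrightarrow> t (Suc j) - t j \<le> \<kappa> * (t j - t (j - 1))"
    and j: "1 \<le> j" "j \<le> m"
  shows "\<exists>q. nonneg_expansion (y j) (y (Suc m)) (t m - t (j - 1)) q \<and>
     (j < m \<longrightarrow> (t m - t (j - 1))\<^sup>2 \<le> (2 + \<kappa>)\<^sup>2 * q)"
  using j(2,1)
proof (induction j rule: inc_induct)
  case base
  then show ?case
    using nonneg_expansion_step[OF nonneg_expansion_refl V _ chain[of m]] t[of m] by auto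
next
  case (step j)
  then obtain q where q: "nonneg_expansion (y (Suc j)) (y (Suc m)) (t m - t j) q"
    and qge: "Suc j < m \<longrightarrow> (t m - t j)\<^sup>2 \<le> (2 + \<kappa>)\<^sup>2 * q" by auto
  define s where "s = t m - t j"
  define k where "k = t j - t (j - 1)"
  have k0: "k > 0" using t[of j] step by (simp add: k_def)
  have mono: "t (Suc j) \<le> t m"
    using Suc_leI[OF \<open>j < m\<close>]
  proof (induction rule: dec_induct)
    case (step n)
    then show ?case using t[of "Suc n"] by simp
  qed simp
  have "t j < t (Suc j)" using t[of "Suc j"] step by simp
  have s0: "s > 0" using mono \<open>t j < t (Suc j)\<close> by (simp add: s_def)
  have q0: "q \<ge> 0" using nonneg_expansion_nonneg[OF q] by simp
  have sk: "k \<le> \<kappa> * s"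
  proof -
    have "k \<le> \<kappa> * (t (Suc j) - t j)" using ratio(1)[of j] step by (simp add: k_def)
    also have "\<dots> \<le> \<kappa> * s" using mono \<kappa> by (simp add: s_def)
    finally show ?thesis .
  qed
  have exp: "nonneg_expansion (y j) (y (Suc m)) (s + k) (q + k * s)"
    using nonneg_expansion_step[OF q V, of k j] chain[of j] step k0 by (auto simp: s_def k_def)
  have "(s + k)\<^sup>2 \<le> (2 + \<kappa>)\<^sup>2 * (q + k * s)"
  proof (cases "Suc j < m")
    case True
    have "(s + k)\<^sup>2 = s\<^sup>2 + k * (2 * s + k)" by (simp add: power2_eq_square algebra_simps)
    also have "k * (2 * s + k) \<le> k * ((2 + \<kappa>) * s)"
      using sk k0 by (intro mult_left_mono) (auto simp: algebra_simps)
    also have "\<dots> \<le> k * ((2 + \<kappa>)\<^sup>2 * s)"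
      using s0 k0 \<kappa> by (intro mult_left_mono mult_right_mono self_le_power) auto
    also have "s\<^sup>2 \<le> (2 + \<kappa>)\<^sup>2 * q" using qge True by (simp add: s_def)
    finally show ?thesis by (simp add: algebra_simps)
  next
    case False
    then have "Suc j = m" using step by simp
    then have "s \<le> \<kappa> * k" using ratio(2)[of j] step by (simp add: s_def k_def)
    then have "s + k \<le> (2 + \<kappa>) * k" using k0 by (simp add: algebra_simps)
    moreover have "s + k \<le> (2 + \<kappa>) * s" using sk s0 by (simp add: algebra_simps)
    ultimately have "(s + k) * (s + k) \<le> ((2 + \<kappa>) * k) * ((2 + \<kappa>) * s)"
      using s0 k0 \<kappa> by (intro mult_mono) auto
    also have "\<dots> = (2 + \<kappa>)\<^sup>2 * (k * s)" by (simp add: power2_eq_square)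
    also have "\<dots> \<le> (2 + \<kappa>)\<^sup>2 * (q + k * s)" using q0 by (intro mult_left_mono) auto
    finally show ?thesis by (simp add: power2_eq_square)
  qed
  then show ?case using exp by (intro exI[of _ "q + k * s"]) (auto simp: s_def k_def)
qed

end

section \<open>Weighted sums with an integrable kernel\<close>

text \<open>Convexity of the power function in the form used for Jensen's inequality. For \<open>r = x / y\<close> it says
  \<open>p r \<le> r\<^sup>p + (p - 1)\<close>, which is Young's inequality for the numbers \<open>r\<^sup>p\<close>
  and \<open>1\<close>.\<close>

lemma powr_above_tangent:
  fixes x y p :: real
  assumes "p \<ge> 1" "x \<ge> 0" "y > 0"
  shows "y powr p + p * y powr (p - 1) * (x - y) \<le> x powr p"
proof (cases "x = 0")
  case True
  have "y powr p = y powr (p - 1) * y" using assms by (simp add: powr_mult_base mult.commute)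
  then show ?thesis using True assms by (simp add: mult_right_mono)
next
  case False
  define r where "r = x / y"
  have r: "r > 0" using False assms by (simp add: r_def)
  have "(r powr p) powr (1 / p) * 1 powr (1 - 1 / p) \<le> 1 / p * r powr p + (1 - 1 / p) * 1"
    using assms r by (intro Youngs_inequality_0) (auto simp: field_simps)
  then have "r \<le> 1 / p * r powr p + (1 - 1 / p)" using assms r by (simp add: powr_powr)
  then have "p * r \<le> p * (1 / p * r powr p + (1 - 1 / p))"
    using assms by (intro mult_left_mono) auto
  also have "\<dots> = r powr p + (p - 1)" using assms by (simp add: distrib_left right_diff_distrib)
  finally have "p * r \<le> r powr p + (p - 1)" .
  then have "y powr p * (1 + p * (r - 1)) \<le> y powr p * r powr p"
    using assms by (intro mult_left_mono) (auto simp: algebra_simps)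
  moreover have "y powr p * r powr p = x powr p"
    using assms r False by (simp add: r_def flip: powr_mult)
  moreover have "y powr p = y powr (p - 1) * y" using assms by (simp add: powr_mult_base mult.commute)
  then have "y powr p * (1 + p * (r - 1)) = y powr p + p * y powr (p - 1) * (x - y)"
    using assms by (simp add: r_def field_simps)
  ultimately show ?thesis by simp
qed

text \<open>The tangent is taken at the mean with respect to the upper bound \<open>R\<close> of the total weight instead of the
  total weight itself; the missing mass only helps since \<open>p \<ge> 1\<close>.\<close>

lemma Jensen_powr_sum:
  fixes w x :: "'a \<Rightarrow> real"
  assumes "p \<ge> 1" "\<And>j. j \<in> J \<Longrightarrow> 0 \<le> w j" "\<And>j. j \<in> J \<Longrightarrow> 0 \<le> x j"
    and R: "(\<Sum>j\<in>J. w j) \<le> R" "R > 0"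
  shows "(\<Sum>j\<in>J. w j * x j) powr p \<le> R powr (p - 1) * (\<Sum>j\<in>J. w j * x j powr p)"
proof -
  define S where "S = (\<Sum>j\<in>J. w j)"
  define m where "m = (\<Sum>j\<in>J. w j * x j) / R"
  have m0: "m \<ge> 0" using assms by (auto simp: m_def intro!: divide_nonneg_pos sum_nonneg)
  show ?thesis
  proof (cases "m = 0")
    case True
    then have "(\<Sum>j\<in>J. w j * x j) = 0" using R by (simp add: m_def)
    moreover have "0 \<le> R powr (p - 1) * (\<Sum>j\<in>J. w j * x j powr p)"
      using assms by (intro mult_nonneg_nonneg sum_nonneg) auto
    ultimately show ?thesis by simp
  next
    case False
    then have m: "m > 0" using m0 by simp
    have mp: "m powr p = m powr (p - 1) * m" using m by (simp add: powr_mult_base mult.commute)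
    have "R * m powr p \<le> m powr p * (S + p * (R - S))"
    proof -
      have "0 \<le> (p - 1) * (R - S)" using assms R by (simp add: S_def)
      then have "R \<le> S + p * (R - S)" by (simp add: algebra_simps)
      then show ?thesis using m by (simp add: mult.commute mult_left_mono)
    qed
    also have "\<dots> = S * m powr p + p * m powr (p - 1) * (R * m - S * m)"
      by (simp add: mp algebra_simps)
    also have "\<dots> = (\<Sum>j\<in>J. w j * (m powr p + p * m powr (p - 1) * (x j - m)))"
    proof -
      have "R * m = (\<Sum>j\<in>J. w j * x j)" using R by (simp add: m_def)
      then have "p * m powr (p - 1) * (R * m - S * m) = p * m powr (p - 1) * (\<Sum>j\<in>J. w j * (x j - m))"
        by (simp add: S_def sum_subtractf sum_distrib_right right_diff_distrib)
      then show ?thesis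
        by (simp add: S_def distrib_left sum.distrib sum_distrib_right sum_distrib_left mult.left_commute)
    qed
    also have "\<dots> \<le> (\<Sum>j\<in>J. w j * x j powr p)"
      using assms m by (intro sum_mono mult_left_mono powr_above_tangent) auto
    finally have *: "R * m powr p \<le> (\<Sum>j\<in>J. w j * x j powr p)" .
    have "(\<Sum>j\<in>J. w j * x j) powr p = (R * m) powr p" using R by (simp add: m_def)
    also have "\<dots> = R powr (p - 1) * (R * m powr p)"
      using R m by (simp add: powr_mult powr_diff)
    also have "\<dots> \<le> R powr (p - 1) * (\<Sum>j\<in>J. w j * x j powr p)"
      using * by (intro mult_left_mono) auto
    finally show ?thesis .
  qed
qed

text \<open>Schur's test: Jensen's inequality with the row sums, then an interchange of summation and the column sums. The
  constant is \<open>R\<close> for every \<open>p\<close>, which makes the final bound uniform in \<open>p\<close>.\<close>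

lemma Schur_powr:
  fixes K :: "nat \<Rightarrow> nat \<Rightarrow> real"
  assumes p: "p \<ge> 1" and k: "\<And>j. j \<in> I \<Longrightarrow> 0 \<le> k j"
    and K: "\<And>m j. m \<in> I \<Longrightarrow> j \<in> I \<Longrightarrow> 0 \<le> K m j"
    and rows: "\<And>m. m \<in> I \<Longrightarrow> (\<Sum>j\<in>I. k j * K m j) \<le> R"
    and cols: "\<And>j. j \<in> I \<Longrightarrow> (\<Sum>m\<in>I. k m * K m j) \<le> R"
    and R: "R > 0" and x: "\<And>j. j \<in> I \<Longrightarrow> 0 \<le> x j"
  shows "(\<Sum>m\<in>I. k m * (\<Sum>j\<in>I. k j * K m j * x j) powr p) \<le> R powr p * (\<Sum>j\<in>I. k j * x j powr p)"
proof -
  have "(\<Sum>m\<in>I. k m * (\<Sum>j\<in>I. k j * K m j * x j) powr p)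
      \<le> (\<Sum>m\<in>I. k m * (R powr (p - 1) * (\<Sum>j\<in>I. k j * K m j * x j powr p)))"
    using assms by (intro sum_mono mult_left_mono Jensen_powr_sum) auto
  also have "\<dots> = R powr (p - 1) * (\<Sum>m\<in>I. \<Sum>j\<in>I. k m * (k j * K m j * x j powr p))"
    by (simp add: sum_distrib_left mult.left_commute)
  also have "\<dots> = R powr (p - 1) * (\<Sum>j\<in>I. \<Sum>m\<in>I. k m * (k j * K m j * x j powr p))"
    by (subst sum.swap) simp
  also have "\<dots> = R powr (p - 1) * (\<Sum>j\<in>I. (k j * x j powr p) * (\<Sum>m\<in>I. k m * K m j))"
    by (simp add: sum_distrib_left mult_ac)
  also have "\<dots> \<le> R powr (p - 1) * (\<Sum>j\<in>I. (k j * x j powr p) * R)"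
    using assms by (intro mult_left_mono sum_mono) auto
  also have "\<dots> = R powr p * (\<Sum>j\<in>I. k j * x j powr p)"
    using R by (simp add: sum_distrib_right[symmetric] powr_diff)
  finally show ?thesis .
qed

lemma powr_add_le:
  fixes a b p :: real
  assumes "a \<ge> 0" "b \<ge> 0" "p \<ge> 1"
  shows "(a + b) powr p \<le> 2 powr p * (a powr p + b powr p)"
proof -
  have "(a + b) powr p \<le> (2 * max a b) powr p" using assms by (intro powr_mono2) auto
  also have "\<dots> = 2 powr p * max a b powr p" using assms by (simp add: powr_mult)
  also have "max a b powr p \<le> a powr p + b powr p" by (auto simp: max_def)
  finally show ?thesis by simp
qed

lemma powr_superadditive:
  fixes a b p :: real
  assumes "a \<ge> 0" "b \<ge> 0" "p \<ge> 1"
  shows "a powr p + b powr p \<le> (a + b) powr p"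
proof (cases "a + b = 0")
  case True
  then show ?thesis using assms by (simp add: add_nonneg_eq_0_iff)
next
  case False
  have "c powr p \<le> c * (a + b) powr (p - 1)" if "0 \<le> c" "c \<le> a + b" for c
  proof (cases "c = 0")
    case False
    then have "c powr p = c * c powr (p - 1)" using that by (simp add: powr_mult_base)
    also have "\<dots> \<le> c * (a + b) powr (p - 1)" using that assms by (intro mult_left_mono powr_mono2) auto
    finally show ?thesis .
  qed simp
  from this[of a] this[of b] have "a powr p + b powr p \<le> (a + b) * (a + b) powr (p - 1)"
    using assms by (simp add: algebra_simps)
  then show ?thesis using assms False by (simp add: powr_mult_base)
qed

text \<open>Both sums are Riemann sums of \<open>\<phi>\<close> whose sample points lie at the far ends of the cells, so that they are
  bounded term by term by increments of \<open>G\<close> and telescope.\<close>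

lemma kernel_sums:
  fixes t :: "nat \<Rightarrow> real" and \<phi> G :: "real \<Rightarrow> real"
  assumes t: "\<And>j. 1 \<le> j \<Longrightarrow> j \<le> M \<Longrightarrow> t (j - 1) < t j" and ends: "t 0 = 0" "t M = T"
    and \<phi>: "\<And>s. 0 < s \<Longrightarrow> s \<le> T \<Longrightarrow> 0 \<le> \<phi> s"
    and G: "\<And>a b. 0 \<le> b \<Longrightarrow> b < a \<Longrightarrow> a \<le> T \<Longrightarrow> (a - b) * \<phi> a \<le> G a - G b"
  shows "m \<in> {1..M} \<Longrightarrow> (\<Sum>j=1..M. (t j - t (j - 1)) * (if j \<le> m then \<phi> (t m - t (j - 1)) else 0)) \<le> G T - G 0"
    and "j \<in> {1..M} \<Longrightarrow> (\<Sum>m=1..M. (t m - t (m - 1)) * (if j \<le> m then \<phi> (t m - t (j - 1)) else 0)) \<le> G T - G 0"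
proof -
  have mono: "t i < t j" if "i < j" "j \<le> M" for i j
    using that
  proof (induction j)
    case (Suc j)
    then show ?case using t[of "Suc j"] by (cases "i = j") auto
  qed simp
  have mono': "t i \<le> t j" if "i \<le> j" "j \<le> M" for i j
    using mono[of i j] that by (cases "i = j") auto
  have Gmono: "G b \<le> G a" if "0 \<le> b" "b \<le> a" "a \<le> T" for a b
  proof (cases "a = b")
    case False
    then have "0 \<le> (a - b) * \<phi> a" using that \<phi>[of a] by auto
    also have "\<dots> \<le> G a - G b" using that False by (intro G) auto
    finally show ?thesis by simp
  qed simp
  have tT: "0 \<le> t i" "t i \<le> T" if "i \<le> M" for i
    using mono'[of 0 i] mono'[of i M] ends that by auto
  {
    assume m: "m \<in> {1..M}"
    have "(\<Sum>j=1..M. (t j - t (j - 1)) * (if j \<le> m then \<phi> (t m - t (j - 1)) else 0))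
        = (\<Sum>j=1..m. (t j - t (j - 1)) * \<phi> (t m - t (j - 1)))"
      using m by (intro sum.mono_neutral_cong_right) auto
    also have "\<dots> \<le> (\<Sum>j=1..m. G (t m - t (j - 1)) - G (t m - t j))"
    proof (intro sum_mono)
      fix j assume j: "j \<in> {1..m}"
      have "t (j - 1) < t j" "t j \<le> t m" "0 \<le> t (j - 1)" "t m \<le> T"
        using j m mono[of "j - 1" j] mono'[of j m] tT[of "j - 1"] tT[of m] by auto
      then show "(t j - t (j - 1)) * \<phi> (t m - t (j - 1)) \<le> G (t m - t (j - 1)) - G (t m - t j)"
        using G[of "t m - t j" "t m - t (j - 1)"] by simp
    qed
    also have "\<dots> = (\<Sum>j<m. G (t m - t j) - G (t m - t (Suc j)))"
      by (rule sum.reindex_bij_witness[of _ Suc "\<lambda>j. j - 1"]) auto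
    also have "\<dots> = G (t m) - G 0" using ends sum_lessThan_telescope'[of "\<lambda>j. G (t m - t j)" m] by simp
    also have "\<dots> \<le> G T - G 0" using Gmono[of "t m" T] tT[of m] m by simp
    finally show "(\<Sum>j=1..M. (t j - t (j - 1)) * (if j \<le> m then \<phi> (t m - t (j - 1)) else 0)) \<le> G T - G 0" .
  }
  {
    assume j: "j \<in> {1..M}"
    have "(\<Sum>m=1..M. (t m - t (m - 1)) * (if j \<le> m then \<phi> (t m - t (j - 1)) else 0))
        = (\<Sum>m=j..M. (t m - t (m - 1)) * \<phi> (t m - t (j - 1)))"
      using j by (intro sum.mono_neutral_cong_right) auto
    also have "\<dots> \<le> (\<Sum>m=j..M. G (t m - t (j - 1)) - G (t (m - 1) - t (j - 1)))"
    proof (intro sum_mono)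
      fix m assume m: "m \<in> {j..M}"
      have "t (m - 1) < t m" "t (j - 1) \<le> t (m - 1)" "0 \<le> t (j - 1)" "t m \<le> T"
        using j m mono[of "m - 1" m] mono'[of "j - 1" "m - 1"] tT[of "j - 1"] tT[of m] by auto
      then show "(t m - t (m - 1)) * \<phi> (t m - t (j - 1)) \<le> G (t m - t (j - 1)) - G (t (m - 1) - t (j - 1))"
        using G[of "t (m - 1) - t (j - 1)" "t m - t (j - 1)"] by simp
    qed
    also have "\<dots> = (\<Sum>m=j-1..<M. G (t (Suc m) - t (j - 1)) - G (t m - t (j - 1)))"
      using j by (intro sum.reindex_bij_witness[of _ Suc "\<lambda>j. j - 1"]) auto
    also have "\<dots> = G (t M - t (j - 1)) - G 0"
      using j sum_Suc_diff'[of "j - 1" M "\<lambda>m. G (t m - t (j - 1))"] by auto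
    also have "\<dots> \<le> G T - G 0" using Gmono[of "t M - t (j - 1)" T] tT[of "j - 1"] ends j by auto
    finally show "(\<Sum>m=1..M. (t m - t (m - 1)) * (if j \<le> m then \<phi> (t m - t (j - 1)) else 0)) \<le> G T - G 0" .
  }
qed

text \<open>The kernel \<open>1 / s\<close> is cut off at the smallest step \<open>k\<close>, which lags never undercut, to obtain
  a finite primitive at zero. Its total increment is \<open>1 + ln (T / k)\<close>.\<close>

lemma log_kernel_primitive:
  fixes a b k :: real
  assumes "k > 0" "0 \<le> b" "b < a"
  defines "G \<equiv> \<lambda>s. if s \<le> k then s / k else 1 + ln (s / k)"
  shows "(a - b) * (1 / max a k) \<le> G a - G b"
proof -
  consider "a \<le> k" | "b \<le> k" "k < a" | "k < b" using assms by linarith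
  then show ?thesis
  proof cases
    case 1
    then show ?thesis using assms by (simp add: G_def field_simps)
  next
    case 2
    have "ln (k / a) \<le> k / a - 1" using 2 assms by (intro ln_le_minus_one) auto
    moreover have "ln (k / a) = - ln (a / k)" using 2 assms by (simp add: ln_div)
    moreover have "(k - b) / a \<le> (k - b) / k" using 2 assms by (intro divide_left_mono) auto
    ultimately have "(a - b) / a \<le> 1 + ln (a / k) - b / k"
      using 2 assms by (simp add: diff_divide_distrib)
    then show ?thesis using 2 assms by (simp add: G_def)
  next
    case 3
    have "ln (b / a) \<le> b / a - 1" using 3 assms by (intro ln_le_minus_one) auto
    moreover have "ln (b / a) = ln (b / k) - ln (a / k)" using 3 assms by (simp add: ln_div)
    ultimately have "(a - b) / a \<le> ln (a / k) - ln (b / k)"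
      using 3 assms by (simp add: diff_divide_distrib)
    then show ?thesis using 3 assms by (simp add: G_def)
  qed
qed

lemma sqrt_kernel_primitive:
  fixes a b :: real
  assumes "0 \<le> b" "b < a"
  shows "(a - b) * (1 / sqrt a) \<le> 2 * sqrt a - 2 * sqrt b"
proof -
  have "0 \<le> (sqrt a - sqrt b) * (sqrt a - sqrt b)" by simp
  moreover have "(2 * sqrt a - 2 * sqrt b) * sqrt a - (sqrt a - sqrt b) * (sqrt a - sqrt b)
      = sqrt a * sqrt a - sqrt b * sqrt b"
    by (simp only: algebra_simps)
  moreover have "sqrt a * sqrt a = a" "sqrt b * sqrt b = b" using assms by auto
  ultimately have "a - b \<le> (2 * sqrt a - 2 * sqrt b) * sqrt a" by linarith
  then show ?thesis using assms by (simp add: field_simps)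
qed

lemma sqrt_exp_le:
  fixes \<nu> s :: real
  assumes "\<nu> > 0" "s \<ge> 0"
  shows "sqrt s * exp (- (\<nu> * s)) \<le> 1 / sqrt \<nu>"
proof -
  have "sqrt (\<nu> * s) \<le> exp (\<nu> * s)"
  proof -
    have "sqrt (\<nu> * s) \<le> 1 + \<nu> * s"
      using assms by (intro real_le_lsqrt) (auto simp: power2_sum)
    also have "\<dots> \<le> exp (\<nu> * s)" by (rule exp_ge_add_one_self)
    finally show ?thesis .
  qed
  then have "sqrt \<nu> * sqrt s * exp (- (\<nu> * s)) \<le> exp (\<nu> * s) * exp (- (\<nu> * s))"
    by (intro mult_right_mono) (auto simp: real_sqrt_mult)
  also have "\<dots> = 1" by (simp flip: exp_add)
  finally show ?thesis using assms by (simp add: field_simps)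
qed

section \<open>The implicit Euler scheme with time-dependent forms\<close>

text \<open>One run of the scheme with abstract data: \<open>a m\<close> is the form on the \<open>m\<close>-th step, \<open>l
  m\<close> the load on that step, bounded in terms of the mean size \<open>F m\<close> of the data. The modulus of
  continuity of the forms is relative to their energy norms, and it is evaluated at the distance between the far ends
  of the two steps.\<close>

locale euler_scheme = finite_inner_product V B
  for V :: "'v::real_vector set" and B +
  fixes a :: "nat \<Rightarrow> 'v \<Rightarrow> 'v \<Rightarrow> real" and t :: "nat \<Rightarrow> real" and M :: nat
    and \<kappa> L :: real and \<omega> :: "real \<Rightarrow> real"
    and u :: "nat \<Rightarrow> 'v" and l :: "nat \<Rightarrow> 'v \<Rightarrow> real" and F :: "nat \<Rightarrow> real"
  assumes form: "m \<in> {1..M} \<Longrightarrow> symmetric_form V (a m)"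
    and mesh: "m \<in> {1..M} \<Longrightarrow> t (m - 1) < t m"
    and \<kappa>: "\<kappa> > 0"
    and ratio: "1 \<le> j \<Longrightarrow> j < M \<Longrightarrow> t j - t (j - 1) \<le> \<kappa> * (t (Suc j) - t j)"
      "1 \<le> j \<Longrightarrow> j < M \<Longrightarrow> t (Suc j) - t j \<le> \<kappa> * (t j - t (j - 1))"
    and L: "L \<ge> 0"
    and \<omega>: "1 \<le> j \<Longrightarrow> j < m \<Longrightarrow> m \<le> M \<Longrightarrow> 0 \<le> \<omega> (t m - t (j - 1))"
    and modulus: "1 \<le> j \<Longrightarrow> j < m \<Longrightarrow> m \<le> M \<Longrightarrow> v \<in> V \<Longrightarrow> w \<in> V \<Longrightarrow>
      \<bar>a m v w - a j v w\<bar> \<le> L * \<omega> (t m - t (j - 1)) * sqrt (a j v v) * sqrt (a m w w)"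
    and u_in: "m \<le> M \<Longrightarrow> u m \<in> V" and u0: "u 0 = 0"
    and scheme: "m \<in> {1..M} \<Longrightarrow> \<psi> \<in> V \<Longrightarrow>
      B (u m - u (m - 1)) \<psi> + (t m - t (m - 1)) * a m (u m) \<psi> = l m \<psi>"
    and l_bound: "m \<in> {1..M} \<Longrightarrow> \<psi> \<in> V \<Longrightarrow> \<bar>l m \<psi>\<bar> \<le> (t m - t (m - 1)) * F m * sqrt (B \<psi> \<psi>)"
    and F: "m \<in> {1..M} \<Longrightarrow> 0 \<le> F m"
begin

abbreviation k :: "nat \<Rightarrow> real" where
  "k j \<equiv> t j - t (j - 1)"

abbreviation lag :: "nat \<Rightarrow> nat \<Rightarrow> real" where
  "lag m j \<equiv> t m - t (j - 1)"

abbreviation Aop :: "nat \<Rightarrow> 'v \<Rightarrow> 'v" where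
  "Aop m \<equiv> form_operator V B (a m)"

definition X :: "nat \<Rightarrow> real" where "X m = nrm (Aop m (u m))"

definition Y :: "nat \<Rightarrow> real" where "Y m = sqrt (a m (u m) (u m))"

lemma t_mono: "i < j \<Longrightarrow> j \<le> M \<Longrightarrow> t i < t j"
proof (induction j)
  case (Suc j)
  then show ?case using mesh[of "Suc j"] by (cases "i = j") auto
qed simp

lemma t_mono_le: "i \<le> j \<Longrightarrow> j \<le> M \<Longrightarrow> t i \<le> t j"
  using t_mono[of i j] by (cases "i = j") auto

lemma Y_nonneg: "m \<in> {1..M} \<Longrightarrow> 0 \<le> Y m"
  unfolding Y_def using symmetric_form.nonneg[OF form, of m "u m"] u_in[of m] by simp

lemma X_nonneg: "m \<in> {1..M} \<Longrightarrow> 0 \<le> X m"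
proof -
  assume m: "m \<in> {1..M}"
  interpret form_pair V B "a m"
    using finite_inner_product_axioms form[OF m] by (simp add: form_pair_def)
  show ?thesis using u_in[of m] m by (simp add: X_def)
qed

text \<open>Summation by parts against the backward chain of the form on the last step. All terms with that form cancel, except
  for the consistency error of using it on earlier steps.\<close>

lemma duality:
  assumes m: "m \<in> {1..M}" and w: "\<And>j. w j \<in> V"
    and chain: "\<And>j. 1 \<le> j \<Longrightarrow> j \<le> m \<Longrightarrow> w j + k j *\<^sub>R Aop m (w j) = w (Suc j)"
  shows "B (u m) (w (Suc m))
    = (\<Sum>j=1..m. l j (w j) + k j * (a m (u j) (w j) - a j (u j) (w j)))"
proof -
  interpret form_pair V B "a m"
    using finite_inner_product_axioms form[OF m] by (simp add: form_pair_def)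
  have "n \<le> m \<Longrightarrow> B (u n) (w (Suc n))
    = (\<Sum>j=1..n. l j (w j) + k j * (a m (u j) (w j) - a j (u j) (w j)))" for n
  proof (induction n)
    case 0
    then show ?case using w by (simp add: u0 zero_left)
  next
    case (Suc n)
    let ?j = "Suc n"
    have V: "u ?j \<in> V" "u n \<in> V" using u_in Suc.prems m by auto
    have "B (u ?j) (w (Suc ?j)) = B (u ?j) (w ?j + k ?j *\<^sub>R Aop m (w ?j))"
      using chain[of ?j] Suc.prems by simp
    also have "\<dots> = B (u ?j) (w ?j) + k ?j * a m (u ?j) (w ?j)"
      using V w by (simp add: add_right scale_right A_form_right a.sym[of "w ?j" "u ?j"])
    also have "B (u ?j) (w ?j) = B (u ?j - u (?j - 1)) (w ?j) + B (u n) (w ?j)"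
      using V w by (simp add: diff_left)
    also have "B (u ?j - u (?j - 1)) (w ?j) = l ?j (w ?j) - k ?j * a ?j (u ?j) (w ?j)"
      using scheme[of ?j "w ?j"] w Suc.prems m by simp
    finally show ?case using Suc by (simp add: algebra_simps)
  qed
  then show ?thesis by simp
qed

text \<open>Both weighted estimates test the identity \<open>duality\<close> with \<open>w = A y\<close>, where \<open>y\<close>
  is the chain that ends in \<open>v\<close>; here \<open>E\<close> is the norm to be estimated and \<open>N\<close>,
  \<open>N'\<close> are the smoothing rates. One factor \<open>E\<close> is divided out at the end.\<close>

lemma duality_bound:
  assumes m: "m \<in> {1..M}" and v: "v \<in> V"
    and N: "\<And>j w q. 1 \<le> j \<Longrightarrow> j \<le> m \<Longrightarrow> w \<in> V \<Longrightarrow>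
       form_pair.nonneg_expansion V B (a m) w v (lag m j) q \<Longrightarrow>
       nrm (Aop m w) \<le> N (lag m j) * E"
    and N': "\<And>j w q. 1 \<le> j \<Longrightarrow> j < m \<Longrightarrow> w \<in> V \<Longrightarrow>
       form_pair.nonneg_expansion V B (a m) w v (lag m j) q \<Longrightarrow>
       (lag m j)\<^sup>2 \<le> (2 + \<kappa>)\<^sup>2 * q \<Longrightarrow>
       sqrt (a m (Aop m w) (Aop m w)) \<le> N' (lag m j) * E"
    and E: "B (u m) (Aop m v) = E * E" "E \<ge> 0"
    and nonneg: "\<And>s. s > 0 \<Longrightarrow> 0 \<le> N s" "\<And>s. s > 0 \<Longrightarrow> 0 \<le> N' s"
  shows "E \<le> (\<Sum>j=1..m. k j * N (lag m j) * F j)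
     + (\<Sum>j=1..<m. k j * (L * \<omega> (lag m j) * N' (lag m j)) * Y j)"
    (is "E \<le> ?S1 + ?S2")
proof -
  interpret form_pair V B "a m"
    using finite_inner_product_axioms form[OF m] by (simp add: form_pair_def)
  have k: "0 < t j - t (j - 1)" if "1 \<le> j" "j \<le> m" for j
    using mesh[of j] that m by auto
  obtain y where yV: "\<And>j. y j \<in> V" and ym: "y (Suc m) = v"
    and y: "\<And>j. 1 \<le> j \<Longrightarrow> j \<le> m \<Longrightarrow> y j + k j *\<^sub>R A (y j) = y (Suc j)"
    using backward_chain[of m "\<lambda>j. t j - t (j - 1)" v] k v by (metis less_imp_le)
  define w where "w j = A (y j)" for j
  have wV: "w j \<in> V" for j by (simp add: w_def yV)
  have "w j + k j *\<^sub>R A (w j) = w (Suc j)" if "1 \<le> j" "j \<le> m" for j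
    using yV by (simp add: w_def y[OF that, symmetric] A_add A_scale)
  from duality[OF m wV this]
  have "E * E = (\<Sum>j=1..m. l j (w j) + k j * (a m (u j) (w j) - a j (u j) (w j)))"
    by (simp add: E w_def ym)
  also have "\<dots> = (\<Sum>j=1..m. l j (w j)) + (\<Sum>j=1..m. k j * (a m (u j) (w j) - a j (u j) (w j)))"
    by (rule sum.distrib)
  also have "(\<Sum>j=1..m. k j * (a m (u j) (w j) - a j (u j) (w j)))
      = (\<Sum>j=1..<m. k j * (a m (u j) (w j) - a j (u j) (w j)))"
    using m by (intro sum.mono_neutral_right) auto
  finally have EE: "E * E = (\<Sum>j=1..m. l j (w j))
      + (\<Sum>j=1..<m. k j * (a m (u j) (w j) - a j (u j) (w j)))" .
  have exp: "\<exists>q. nonneg_expansion (y j) v (lag m j) q \<and>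
     (j < m \<longrightarrow> (lag m j)\<^sup>2 \<le> (2 + \<kappa>)\<^sup>2 * q)" if "1 \<le> j" "j \<le> m" for j
    using chain_expansion[where y = y and t = t and m = m and \<kappa> = \<kappa> and j = j] yV y mesh \<kappa> ratio m that
    by (simp add: ym)
  have pos: "0 < t m - t (j - 1)" if "1 \<le> j" "j \<le> m" for j
    using t_mono[of "j - 1" m] that m by auto
  have S1: "l j (w j) \<le> (k j * N (lag m j) * F j) * E" if j: "j \<in> {1..m}" for j
  proof -
    obtain q where "nonneg_expansion (y j) v (lag m j) q" using exp[of j] j by auto
    then have n: "nrm (w j) \<le> N (lag m j) * E" using N[of j "y j"] j yV by (auto simp: w_def)
    have "l j (w j) \<le> k j * F j * nrm (w j)"
      using l_bound[of j "w j"] wV j m by (simp add: nrm_def)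
    also have "\<dots> \<le> k j * F j * (N (lag m j) * E)"
      using n k[of j] F[of j] j m by (intro mult_left_mono mult_nonneg_nonneg) auto
    finally show ?thesis by (simp add: mult_ac)
  qed
  have S2: "k j * (a m (u j) (w j) - a j (u j) (w j))
      \<le> (k j * (L * \<omega> (lag m j) * N' (lag m j)) * Y j) * E"
    if j: "j \<in> {1..<m}" for j
  proof -
    obtain q where "nonneg_expansion (y j) v (lag m j) q"
      "(lag m j)\<^sup>2 \<le> (2 + \<kappa>)\<^sup>2 * q" using exp[of j] j by auto
    then have n: "sqrt (a m (w j) (w j)) \<le> N' (lag m j) * E"
      using N'[of j "y j"] j yV by (auto simp: w_def)
    have "a m (u j) (w j) - a j (u j) (w j) \<le> L * \<omega> (lag m j) * Y j * sqrt (a m (w j) (w j))"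
      using modulus[of j m "u j" "w j"] wV u_in[of j] j m by (simp add: Y_def)
    also have "\<dots> \<le> L * \<omega> (lag m j) * Y j * (N' (lag m j) * E)"
      using n L \<omega>[of j m] Y_nonneg[of j] j m by (intro mult_left_mono mult_nonneg_nonneg) auto
    finally have "k j * (a m (u j) (w j) - a j (u j) (w j))
      \<le> k j * (L * \<omega> (lag m j) * Y j * (N' (lag m j) * E))"
      using k[of j] j by (intro mult_left_mono) auto
    then show ?thesis by (simp add: mult_ac)
  qed
  have "E * E \<le> (?S1 + ?S2) * E"
    unfolding EE distrib_right sum_distrib_right using S1 S2 by (intro add_mono sum_mono) auto
  moreover have "0 \<le> ?S1 + ?S2"
    using k pos nonneg F L \<omega> Y_nonneg m
    by (intro add_nonneg_nonneg sum_nonneg mult_nonneg_nonneg) (auto simp: less_imp_le)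
  ultimately show ?thesis using E(2) by (cases "E = 0") auto
qed

text \<open>The chain ends in \<open>u m\<close> itself, so \<open>E\<close> is the energy norm.\<close>

lemma energy_bound:
  assumes m: "m \<in> {1..M}"
  shows "Y m \<le> (\<Sum>j=1..m. k j * (1 / sqrt (lag m j)) * F j)
     + (\<Sum>j=1..<m. k j * (L * \<omega> (lag m j) * (1 / (lag m j))) * Y j)"
proof -
  interpret form_pair V B "a m"
    using finite_inner_product_axioms form[OF m] by (simp add: form_pair_def)
  have um: "u m \<in> V" using u_in m by auto
  have YY: "a m (u m) (u m) = Y m * Y m" using um by (simp add: Y_def a.nonneg)
  show ?thesis
  proof (rule duality_bound[OF m um, where N = "\<lambda>s. 1 / sqrt s" and N' = "\<lambda>s. 1 / s"])
    fix j w q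
    assume j: "1 \<le> j" "j \<le> m" and w: "w \<in> V" and ex: "nonneg_expansion w (u m) (lag m j) q"
    define s where "s = t m - t (j - 1)"
    have s: "s > 0" using t_mono[of "j - 1" m] j m by (auto simp: s_def)
    have "sqrt (s * B (A w) (A w)) \<le> sqrt (a m (u m) (u m))"
      using smoothing(4)[OF ex w] by (simp add: s_def)
    then have "nrm (A w) \<le> 1 / sqrt s * Y m" using s
      by (simp add: real_sqrt_mult nrm_def Y_def field_simps)
    then show "nrm (A w) \<le> 1 / sqrt (lag m j) * Y m" by (simp add: s_def)
  next
    fix j w q
    assume j: "1 \<le> j" "j < m" and w: "w \<in> V" and ex: "nonneg_expansion w (u m) (lag m j) q"
    define s where "s = t m - t (j - 1)"
    have s: "s > 0" using t_mono[of "j - 1" m] j m by (auto simp: s_def)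
    have "sqrt (s\<^sup>2 * a m (A w) (A w)) \<le> sqrt (a m (u m) (u m))"
      using smoothing(5)[OF ex w] by (simp add: s_def)
    then have "sqrt (a m (A w) (A w)) \<le> 1 / s * Y m" using s
      by (simp add: real_sqrt_mult Y_def field_simps)
    then show "sqrt (a m (A w) (A w)) \<le> 1 / (lag m j) * Y m" by (simp add: s_def)
  qed (use um YY Y_nonneg[OF m] in \<open>auto simp: A_form_right\<close>)
qed

text \<open>The chain ends in \<open>A u m\<close>. The consistency error gains three half powers, which needs the bound on
  \<open>q\<close> from \<open>chain_expansion\<close>.\<close>

lemma operator_bound:
  assumes m: "m \<in> {1..M}"
  shows "X m \<le> (\<Sum>j=1..m. k j * (1 / (lag m j)) * F j)
     + (\<Sum>j=1..<m. k j
          * (L * \<omega> (lag m j) * ((2 + \<kappa>) * (lag m j) powr (- 3 / 2))) * Y j)"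
proof -
  interpret form_pair V B "a m"
    using finite_inner_product_axioms form[OF m] by (simp add: form_pair_def)
  have um: "u m \<in> V" using u_in m by auto
  let ?v = "A (u m)"
  have v: "?v \<in> V" using um by simp
  have XX: "B ?v ?v = X m * X m" using v by (simp add: X_def nrm_sq[symmetric] power2_eq_square)
  show ?thesis
  proof (rule duality_bound[OF m v, where N = "\<lambda>s. 1 / s" and N' = "\<lambda>s. (2 + \<kappa>) * s powr (- 3 / 2)"])
    fix j w q
    assume j: "1 \<le> j" "j \<le> m" and w: "w \<in> V" and ex: "nonneg_expansion w ?v (lag m j) q"
    have "0 < t m - t (j - 1)" using t_mono[of "j - 1" m] j m by auto
    then show "nrm (A w) \<le> 1 / (lag m j) * X m"
      using smoothing(2)[OF ex w] by (simp add: X_def field_simps)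
  next
    fix j w q
    assume j: "1 \<le> j" "j < m" and w: "w \<in> V" and ex: "nonneg_expansion w ?v (lag m j) q"
      and q: "(lag m j)\<^sup>2 \<le> (2 + \<kappa>)\<^sup>2 * q"
    define s where "s = t m - t (j - 1)"
    have s: "s > 0" using t_mono[of "j - 1" m] j m by (auto simp: s_def)
    have aw: "0 \<le> a m (A w) (A w)" using w by (intro a.nonneg) simp
    have "s ^ 3 * a m (A w) (A w) = s * s\<^sup>2 * a m (A w) (A w)" by (simp add: eval_nat_numeral)
    also have "\<dots> \<le> s * ((2 + \<kappa>)\<^sup>2 * q) * a m (A w) (A w)"
      using q s aw by (intro mult_left_mono mult_right_mono) (auto simp: s_def)
    also have "\<dots> = (2 + \<kappa>)\<^sup>2 * (s * q * a m (A w) (A w))" by (simp add: mult_ac)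
    also have "\<dots> \<le> (2 + \<kappa>)\<^sup>2 * B ?v ?v"
      using smoothing(3)[OF ex w] by (intro mult_left_mono) (auto simp: s_def)
    also have "\<dots> = ((2 + \<kappa>) * X m)\<^sup>2" by (simp add: XX power2_eq_square)
    finally have "sqrt (s ^ 3 * a m (A w) (A w)) \<le> sqrt (((2 + \<kappa>) * X m)\<^sup>2)"
      by (rule real_sqrt_le_mono)
    then have "sqrt (s ^ 3) * sqrt (a m (A w) (A w)) \<le> (2 + \<kappa>) * X m"
      using \<kappa> X_nonneg[OF m] by (simp add: real_sqrt_mult)
    moreover have "sqrt (s ^ 3) = s powr (3 / 2)"
      using s by (simp add: powr_half_sqrt[symmetric] powr_powr flip: powr_numeral)
    ultimately have le: "s powr (3 / 2) * sqrt (a m (A w) (A w)) \<le> (2 + \<kappa>) * X m" by simp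
    have "sqrt (a m (A w) (A w)) = (s powr (- 3 / 2) * s powr (3 / 2)) * sqrt (a m (A w) (A w))"
      using s by (simp flip: powr_add)
    also have "\<dots> \<le> s powr (- 3 / 2) * ((2 + \<kappa>) * X m)"
      unfolding mult.assoc by (intro mult_left_mono le) auto
    finally show "sqrt (a m (A w) (A w)) \<le> (2 + \<kappa>) * (lag m j) powr (- 3 / 2) * X m"
      by (simp add: s_def mult_ac)
  qed (use um v XX X_nonneg[OF m] \<kappa> a.sym[of "A (u m)" "u m"] in \<open>auto simp: A_form_right A_form\<close>)
qed

end

section \<open>Maximal regularity of the scheme in discrete $L^p$\<close>

context euler_scheme
begin

text \<open>The \<open>p\<close>-th power of the norm, in time, of a function that is constant on each step.\<close>

definition pnorm :: "real \<Rightarrow> (nat \<Rightarrow> real) \<Rightarrow> real" where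
  "pnorm p z = (\<Sum>m=1..M. k m * z m powr p)"

lemma pnorm_mono:
  assumes "p \<ge> 1" "\<And>m. m \<in> {1..M} \<Longrightarrow> 0 \<le> z m" "\<And>m. m \<in> {1..M} \<Longrightarrow> z m \<le> z' m"
  shows "pnorm p z \<le> pnorm p z'"
  unfolding pnorm_def using assms mesh
  by (intro sum_mono mult_left_mono powr_mono2) (auto simp: less_imp_le)

lemma pnorm_add:
  assumes "p \<ge> 1" "\<And>m. m \<in> {1..M} \<Longrightarrow> 0 \<le> z m" "\<And>m. m \<in> {1..M} \<Longrightarrow> 0 \<le> z' m"
  shows "pnorm p (\<lambda>m. z m + z' m) \<le> 2 powr p * (pnorm p z + pnorm p z')"
proof -
  have "pnorm p (\<lambda>m. z m + z' m)
      \<le> (\<Sum>m=1..M. k m * (2 powr p * (z m powr p + z' m powr p)))"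
    unfolding pnorm_def using assms mesh
    by (intro sum_mono mult_left_mono powr_add_le) (auto simp: less_imp_le)
  also have "\<dots> = 2 powr p * (pnorm p z + pnorm p z')"
    by (simp add: pnorm_def sum_distrib_left sum.distrib[symmetric] algebra_simps)
  finally show ?thesis .
qed

lemma pnorm_nonneg: "0 \<le> pnorm p z"
  unfolding pnorm_def using mesh by (intro sum_nonneg mult_nonneg_nonneg) (auto simp: less_imp_le)

lemma lag_bounds:
  assumes "t 0 = 0" "t M = T" "1 \<le> j" "j \<le> m" "m \<le> M"
  shows "0 < t m - t (j - 1)" "t m - t (j - 1) \<le> T" "0 < t j - t (j - 1)"
proof -
  have "t 0 \<le> t (j - 1)" by (rule t_mono_le) (use assms in auto)
  moreover have "t m \<le> t M" by (rule t_mono_le) (use assms in auto)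
  ultimately show "t m - t (j - 1) \<le> T" using assms by linarith
  show "0 < t m - t (j - 1)" "0 < t j - t (j - 1)"
    using t_mono[of "j - 1" m] t_mono[of "j - 1" j] assms by auto
qed

text \<open>Schur's test for discrete convolution kernels whose row and column sums are controlled by a primitive of the kernel.\<close>

lemma pnorm_convolution:
  assumes p: "p \<ge> 1" and ends: "t 0 = 0" "t M = T"
    and \<phi>: "\<And>s. 0 < s \<Longrightarrow> s \<le> T \<Longrightarrow> 0 \<le> \<phi> s"
    and G: "\<And>a b. 0 \<le> b \<Longrightarrow> b < a \<Longrightarrow> a \<le> T \<Longrightarrow> (a - b) * \<phi> a \<le> G a - G b"
    and c: "c \<ge> 0" "c * (G T - G 0) \<le> R" "R > 0"
    and z: "\<And>m. m \<in> {1..M} \<Longrightarrow> 0 \<le> z m"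
  shows "pnorm p (\<lambda>m. \<Sum>j=1..m. k j * (c * \<phi> (lag m j)) * z j)
    \<le> R powr p * pnorm p z"
proof -
  let ?K = "\<lambda>m j. c * (if j \<le> m then \<phi> (lag m j) else 0)"
  have mesh': "\<And>j. 1 \<le> j \<Longrightarrow> j \<le> M \<Longrightarrow> t (j - 1) < t j" using mesh by simp
  note sums = kernel_sums[of M t T \<phi> G, OF mesh' ends \<phi> G]
  have K0: "0 \<le> ?K m j" if "m \<in> {1..M}" "j \<in> {1..M}" for m j
    using that c(1) lag_bounds[OF ends, of j m] \<phi> by auto
  have "pnorm p (\<lambda>m. \<Sum>j=1..m. k j * (c * \<phi> (lag m j)) * z j)
      = (\<Sum>m=1..M. k m * (\<Sum>j=1..M. k j * ?K m j * z j) powr p)"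
    unfolding pnorm_def
    by (intro sum.cong refl arg_cong2[where f = "(*)"] arg_cong2[where f = "(powr)"]
        sum.mono_neutral_cong_left) auto
  also have "\<dots> \<le> R powr p * (\<Sum>j=1..M. k j * z j powr p)"
  proof (rule Schur_powr[OF p _ _ _ _ c(3) z])
    show "(\<Sum>j=1..M. k j * ?K m j) \<le> R" if m: "m \<in> {1..M}" for m
    proof -
      have "(\<Sum>j=1..M. k j * ?K m j)
          = c * (\<Sum>j=1..M. k j * (if j \<le> m then \<phi> (lag m j) else 0))"
        unfolding sum_distrib_left by (simp only: mult.left_commute)
      also have "\<dots> \<le> c * (G T - G 0)" using sums(1)[of m] m c by (intro mult_left_mono) auto
      finally show ?thesis using c by linarith
    qed
    show "(\<Sum>m=1..M. k m * ?K m j) \<le> R" if j: "j \<in> {1..M}" for j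
    proof -
      have "(\<Sum>m=1..M. k m * ?K m j)
          = c * (\<Sum>m=1..M. k m * (if j \<le> m then \<phi> (lag m j) else 0))"
        unfolding sum_distrib_left by (simp only: mult.left_commute)
      also have "\<dots> \<le> c * (G T - G 0)" using sums(2)[of j] j c by (intro mult_left_mono) auto
      finally show ?thesis using c by linarith
    qed
  qed (use K0 mesh in \<open>auto simp: less_imp_le\<close>)
  finally show ?thesis by (simp add: pnorm_def)
qed

context
  fixes p T kk J \<mu> :: real and G :: "real \<Rightarrow> real"
  assumes p: "p \<ge> 1" and ends: "t 0 = 0" "t M = T" and M0: "M \<ge> 1"
    and kk: "0 < kk" "\<And>m. m \<in> {1..M} \<Longrightarrow> kk \<le> t m - t (m - 1)"
    and \<omega>_nonneg: "\<And>s. 0 < s \<Longrightarrow> s \<le> T \<Longrightarrow> 0 \<le> \<omega> s"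
    and G: "\<And>a b. 0 \<le> b \<Longrightarrow> b < a \<Longrightarrow> a \<le> T \<Longrightarrow> (a - b) * (\<omega> a * a powr (- 3 / 2)) \<le> G a - G b"
    and J: "G T - G 0 \<le> J" "J > 0"
    and \<mu>: "\<mu> > 0" "L * sqrt ((1 + \<kappa>) / \<mu>) * J \<le> 1 / 4"
    and L0: "L > 0"
begin

lemma t_bounds: "m \<le> M \<Longrightarrow> 0 \<le> t m \<and> t m \<le> T"
  using t_mono[of 0 m] t_mono[of m M] ends by (cases "m = 0"; cases "m = M") auto

lemma T_pos: "T > 0"
  using t_mono[of 0 M] M0 ends by simp

text \<open>The exponential weight that makes the kernel of \<open>energy_bound\<close> a contraction.\<close>

definition Yw :: "nat \<Rightarrow> real" where "Yw m = exp (- (\<mu> * t m)) * Y m"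

text \<open>Passing the weight under the sum leaves \<open>exp (- \<mu> (t m - t j))\<close>, where \<open>t m - t j\<close> is at
  least the lag divided by \<open>1 + \<kappa>\<close>. Against this exponential the missing half power
  \<open>s\<^sup>1\<^sup>/\<^sup>2\<close> becomes the small factor \<open>((1 + \<kappa>) /
  \<mu>)\<^sup>1\<^sup>/\<^sup>2\<close>, and the summable kernel \<open>\<omega>(s)
  s\<^sup>-\<^sup>3\<^sup>/\<^sup>2\<close> is left.\<close>

lemma Yw_bound:
  assumes m: "m \<in> {1..M}"
  shows "Yw m \<le> (\<Sum>j=1..m. k j * (1 * (1 / sqrt (lag m j))) * F j)
    + (\<Sum>j=1..m. k j
        * (L * sqrt ((1 + \<kappa>) / \<mu>) * (\<omega> (lag m j) * (lag m j) powr (- 3 / 2))) * Yw j)"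
    (is "_ \<le> ?S1 + ?S2")
proof -
  let ?T1 = "\<Sum>j=1..m. k j * (1 / sqrt (lag m j)) * F j"
  have pos: "0 < t m - t (j - 1)" "t m - t (j - 1) \<le> T" "0 < t j - t (j - 1)" if "1 \<le> j" "j \<le> m" for j
    using lag_bounds[OF ends that] m by auto
  have term0: "0 \<le> k j
      * (L * sqrt ((1 + \<kappa>) / \<mu>) * (\<omega> (lag m j) * (lag m j) powr (- 3 / 2))) * Yw j"
    if "1 \<le> j" "j \<le> m" for j
    using that pos[OF that] L \<kappa> \<mu>(1) \<omega>_nonneg[of "t m - t (j - 1)"] Y_nonneg[of j] m
    by (auto simp: Yw_def intro!: mult_nonneg_nonneg)
  have "Yw m \<le> exp (- (\<mu> * t m)) * (?T1
     + (\<Sum>j=1..<m. k j * (L * \<omega> (lag m j) * (1 / (lag m j))) * Y j))"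
    unfolding Yw_def using energy_bound[OF m] by (intro mult_left_mono) auto
  also have "\<dots> = exp (- (\<mu> * t m)) * ?T1 + (\<Sum>j=1..<m. exp (- (\<mu> * t m)) *
      (k j * (L * \<omega> (lag m j) * (1 / (lag m j))) * Y j))"
    by (simp add: distrib_left sum_distrib_left)
  also have "exp (- (\<mu> * t m)) * ?T1 \<le> 1 * ?T1"
    using pos F m \<mu>(1) t_bounds[of m]
    by (intro mult_right_mono sum_nonneg mult_nonneg_nonneg) (auto simp: less_imp_le)
  also have "(\<Sum>j=1..<m. exp (- (\<mu> * t m)) *
      (k j * (L * \<omega> (lag m j) * (1 / (lag m j))) * Y j))
      \<le> (\<Sum>j=1..<m. k j
        * (L * sqrt ((1 + \<kappa>) / \<mu>) * (\<omega> (lag m j) * (lag m j) powr (- 3 / 2))) * Yw j)"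
  proof (intro sum_mono)
    fix j assume j: "j \<in> {1..<m}"
    define s where "s = t m - t (j - 1)"
    have s: "s > 0" "s \<le> T" and k: "0 < t j - t (j - 1)" using pos[of j] j by (auto simp: s_def)
    have "t (Suc j) \<le> t m" using t_mono[of "Suc j" m] j m by (cases "Suc j = m") auto
    then have "t j - t (j - 1) \<le> \<kappa> * (t m - t j)"
      using ratio(1)[of j] \<kappa> j m by (smt (verit) atLeastLessThan_iff atLeastAtMost_iff
          le_trans less_le_trans mult_left_mono)
    then have s_le: "s \<le> (1 + \<kappa>) * (t m - t j)" by (simp add: s_def algebra_simps)
    define \<nu> where "\<nu> = \<mu> / (1 + \<kappa>)"
    have \<nu>: "\<nu> > 0" using \<mu> \<kappa> by (simp add: \<nu>_def)
    have "\<nu> * s \<le> \<nu> * ((1 + \<kappa>) * (t m - t j))"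
      using s_le \<nu> by (intro mult_left_mono) auto
    also have "\<dots> = \<mu> * (t m - t j)" using \<kappa> by (simp add: \<nu>_def)
    finally have "\<nu> * s \<le> \<mu> * (t m - t j)" .
    then have "sqrt s * exp (- (\<mu> * (t m - t j))) \<le> sqrt s * exp (- (\<nu> * s))"
      using s by (intro mult_left_mono) auto
    also have "\<dots> \<le> 1 / sqrt \<nu>" using \<nu> s by (intro sqrt_exp_le) auto
    also have "\<dots> = sqrt ((1 + \<kappa>) / \<mu>)" by (simp add: \<nu>_def real_sqrt_divide)
    finally have key: "sqrt s * exp (- (\<mu> * (t m - t j))) \<le> sqrt ((1 + \<kappa>) / \<mu>)" .
    \<comment> \<open>the half power that is traded for smallness\<close>
    have split: "1 / s = sqrt s * s powr (- 3 / 2)"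
      using s by (simp add: powr_half_sqrt[symmetric] powr_minus_divide[symmetric] flip: powr_add)
    have expo: "exp (- (\<mu> * t m)) * Y j = exp (- (\<mu> * (t m - t j))) * Yw j"
      by (simp add: Yw_def right_diff_distrib flip: exp_add mult.assoc)
    have Yw0: "0 \<le> Yw j" using Y_nonneg[of j] j m by (simp add: Yw_def)
    have "exp (- (\<mu> * t m)) * (k j * (L * \<omega> s * (1 / s)) * Y j)
       = k j * (L * \<omega> s * (1 / s)) * (exp (- (\<mu> * t m)) * Y j)"
      by (simp only: mult_ac)
    also have "\<dots> = k j * L * \<omega> s * s powr (- 3 / 2) * Yw j
         * (sqrt s * exp (- (\<mu> * (t m - t j))))"
      unfolding split expo by (simp only: mult_ac)
    also have "\<dots> \<le> k j * L * \<omega> s * s powr (- 3 / 2) * Yw j * sqrt ((1 + \<kappa>) / \<mu>)"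
      using key k L \<omega>_nonneg[of s] s Yw0 by (intro mult_left_mono mult_nonneg_nonneg) auto
    finally show "exp (- (\<mu> * t m)) *
      (k j * (L * \<omega> (lag m j) * (1 / (lag m j))) * Y j)
      \<le> k j
        * (L * sqrt ((1 + \<kappa>) / \<mu>) * (\<omega> (lag m j) * (lag m j) powr (- 3 / 2))) * Yw j"
      by (simp add: s_def mult_ac)
  qed
  also have "\<dots> \<le> ?S2" using term0 by (intro sum_mono2) auto
  finally show ?thesis by simp
qed

text \<open>In discrete \<open>L\<^sup>p\<close> the second sum in \<open>Yw_bound\<close> is at most a quarter of
  \<open>Yw\<close>. Splitting the power of the sum costs a factor \<open>2\<^sup>p\<close>, after which it is at most
  half of the left-hand side and can be absorbed.\<close>

lemma energy_estimate: "pnorm p Y \<le> (8 * sqrt T * exp (\<mu> * T)) powr p * pnorm p F"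
proof -
  let ?P = "\<lambda>m. \<Sum>j=1..m. k j * (1 * (1 / sqrt (lag m j))) * F j"
  let ?Q = "\<lambda>m. \<Sum>j=1..m. k j
    * (L * sqrt ((1 + \<kappa>) / \<mu>) * (\<omega> (lag m j) * (lag m j) powr (- 3 / 2))) * Yw j"
  have Yw0: "0 \<le> Yw m" if "m \<in> {1..M}" for m using Y_nonneg[OF that] by (simp add: Yw_def)
  have pos: "0 < t m - t (j - 1)" "t m - t (j - 1) \<le> T" "0 < t j - t (j - 1)"
    if "1 \<le> j" "j \<le> m" "m \<le> M" for j m
    using lag_bounds[OF ends that] by auto
  have P: "pnorm p ?P \<le> (2 * sqrt T) powr p * pnorm p F"
    using p ends T_pos F
    by (intro pnorm_convolution[where G = "\<lambda>s. 2 * sqrt s" and T = T] sqrt_kernel_primitive) auto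
  have c0: "0 \<le> L * sqrt ((1 + \<kappa>) / \<mu>)" using L \<kappa> \<mu>(1) by simp
  have "L * sqrt ((1 + \<kappa>) / \<mu>) * (G T - G 0) \<le> L * sqrt ((1 + \<kappa>) / \<mu>) * J"
    using J c0 by (intro mult_left_mono) auto
  then have c1: "L * sqrt ((1 + \<kappa>) / \<mu>) * (G T - G 0) \<le> 1 / 4" using \<mu>(2) by linarith
  have Q: "pnorm p ?Q \<le> (1 / 4) powr p * pnorm p Yw"
    using p ends c0 c1 Yw0 G \<omega>_nonneg
    by (intro pnorm_convolution[where G = G and T = T]) auto
  have P0: "0 \<le> ?P m" if "m \<in> {1..M}" for m
    using that pos F by (intro sum_nonneg mult_nonneg_nonneg) (auto simp: less_imp_le)
  have Q0: "0 \<le> ?Q m" if "m \<in> {1..M}" for m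
    using that pos Yw0 L \<kappa> \<mu>(1) \<omega>_nonneg by (intro sum_nonneg mult_nonneg_nonneg) (auto simp: less_imp_le)
  have "pnorm p Yw \<le> pnorm p (\<lambda>m. ?P m + ?Q m)"
    using p Yw0 Yw_bound by (intro pnorm_mono)
  also have "\<dots> \<le> 2 powr p * (pnorm p ?P + pnorm p ?Q)"
    using p P0 Q0 by (intro pnorm_add)
  also have "\<dots> \<le> 2 powr p * ((2 * sqrt T) powr p * pnorm p F + (1 / 4) powr p * pnorm p Yw)"
    using P Q by (intro mult_left_mono add_mono) auto
  also have "\<dots> = (4 * sqrt T) powr p * pnorm p F + (1 / 2) powr p * pnorm p Yw"
    using T_pos by (simp add: distrib_left flip: mult.assoc powr_mult)
  finally have "pnorm p Yw \<le> (4 * sqrt T) powr p * pnorm p F + (1 / 2) powr p * pnorm p Yw" .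
  moreover have "(1 / 2) powr p * pnorm p Yw \<le> 1 / 2 * pnorm p Yw"
    using powr_mono'[of 1 p "1 / 2::real"] p pnorm_nonneg[of p Yw] by (intro mult_right_mono) auto
  ultimately have "pnorm p Yw \<le> 2 * ((4 * sqrt T) powr p * pnorm p F)" by linarith
  also have "\<dots> \<le> 2 powr p * ((4 * sqrt T) powr p * pnorm p F)"
    using p powr_mono[of 1 p "2::real"] pnorm_nonneg[of p F] by (intro mult_right_mono) auto
  also have "\<dots> = (8 * sqrt T) powr p * pnorm p F"
    using T_pos by (simp flip: mult.assoc powr_mult)
  finally have Yw: "pnorm p Yw \<le> (8 * sqrt T) powr p * pnorm p F" .
  have "pnorm p Y \<le> pnorm p (\<lambda>m. exp (\<mu> * T) * Yw m)"
  proof (intro pnorm_mono p Y_nonneg)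
    fix m assume m: "m \<in> {1..M}"
    have "Y m = exp (\<mu> * t m) * Yw m" by (simp add: Yw_def flip: exp_add mult.assoc)
    also have "\<dots> \<le> exp (\<mu> * T) * Yw m"
      using Yw0[OF m] t_bounds[of m] m \<mu>(1) by (intro mult_right_mono) auto
    finally show "Y m \<le> exp (\<mu> * T) * Yw m" .
  qed
  also have "\<dots> = exp (\<mu> * T) powr p * pnorm p Yw"
    unfolding pnorm_def sum_distrib_left using Yw0
    by (intro sum.cong refl) (simp add: powr_mult mult.left_commute)
  also have "\<dots> \<le> exp (\<mu> * T) powr p * ((8 * sqrt T) powr p * pnorm p F)"
    using Yw by (intro mult_left_mono) auto
  also have "\<dots> = (8 * sqrt T * exp (\<mu> * T)) powr p * pnorm p F"
    using T_pos by (simp add: powr_mult mult_ac)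
  finally show ?thesis .
qed

lemma maximal_regularity:
  "pnorm p X \<le> (2 * (1 + ln (T / kk) + L * (2 + \<kappa>) * J * (8 * sqrt T * exp (\<mu> * T)))) powr p * pnorm p F"
proof -
  let ?P = "\<lambda>m. \<Sum>j=1..m. k j * (1 * (1 / max (lag m j) kk)) * F j"
  let ?Q = "\<lambda>m. \<Sum>j=1..m. k j
    * (L * (2 + \<kappa>) * (\<omega> (lag m j) * (lag m j) powr (- 3 / 2))) * Y j"
  define G1 where "G1 s = (if s \<le> kk then s / kk else 1 + ln (s / kk))" for s
  have pos: "0 < t m - t (j - 1)" "t m - t (j - 1) \<le> T" "0 < t j - t (j - 1)" "kk \<le> t m - t (j - 1)"
    if "1 \<le> j" "j \<le> m" "m \<le> M" for j m
  proof -
    show "0 < t m - t (j - 1)" "t m - t (j - 1) \<le> T" "0 < t j - t (j - 1)"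
      using lag_bounds[OF ends that] by auto
    have "t (j - 1) \<le> t (m - 1)" by (rule t_mono_le) (use that in auto)
    then show "kk \<le> t m - t (j - 1)" using kk(2)[of m] that by auto
  qed
  have kT: "kk \<le> T" using pos[of 1 M] M0 ends by simp
  have lnT: "0 \<le> ln (T / kk)" using kT kk by simp
  have G1T: "G1 T - G1 0 \<le> 1 + ln (T / kk)" using kT kk by (auto simp: G1_def)
  have P: "pnorm p ?P \<le> (1 + ln (T / kk)) powr p * pnorm p F"
    using p ends F G1T lnT log_kernel_primitive[OF kk(1), folded G1_def]
    by (intro pnorm_convolution[where G = G1 and T = T]) auto
  have c0: "0 < L * (2 + \<kappa>)" using L0 \<kappa> by simp
  have "L * (2 + \<kappa>) * (G T - G 0) \<le> L * (2 + \<kappa>) * J"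
    using J c0 by (intro mult_left_mono) auto
  then have Q: "pnorm p ?Q \<le> (L * (2 + \<kappa>) * J) powr p * pnorm p Y"
    using p ends c0 Y_nonneg G \<omega>_nonneg J
    by (intro pnorm_convolution[where G = G and T = T]) auto
  have P0: "0 \<le> ?P m" if "m \<in> {1..M}" for m
    using that pos F kk by (intro sum_nonneg mult_nonneg_nonneg) (auto simp: less_imp_le)
  have Q0: "0 \<le> ?Q m" if "m \<in> {1..M}" for m
    using that pos Y_nonneg L \<kappa> \<omega>_nonneg by (intro sum_nonneg mult_nonneg_nonneg) (auto simp: less_imp_le)
  have X_le: "X m \<le> ?P m + ?Q m" if m: "m \<in> {1..M}" for m
  proof -
    have "(\<Sum>j=1..m. k j * (1 / (lag m j)) * F j) = ?P m"
      using pos m by (intro sum.cong refl) (auto simp: max_absorb1)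
    moreover have "(\<Sum>j=1..<m. k j
          * (L * \<omega> (lag m j) * ((2 + \<kappa>) * (lag m j) powr (- 3 / 2))) * Y j)
        = (\<Sum>j=1..<m. k j
          * (L * (2 + \<kappa>) * (\<omega> (lag m j) * (lag m j) powr (- 3 / 2))) * Y j)"
      by (simp only: mult_ac)
    moreover have "\<dots> \<le> ?Q m"
      using pos m L \<kappa> Y_nonneg \<omega>_nonneg
      by (intro sum_mono2 mult_nonneg_nonneg) (auto simp: less_imp_le)
    ultimately show ?thesis using operator_bound[OF m] by linarith
  qed
  have expand: "e * (r * z + x * (y * z)) = e * (r + x * y) * z" for e r x y z :: real
    by (simp add: algebra_simps)
  have split: "(L * (2 + \<kappa>) * J * (8 * sqrt T * exp (\<mu> * T))) powr p
      = (L * (2 + \<kappa>) * J) powr p * (8 * sqrt T * exp (\<mu> * T)) powr p"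
    by (rule powr_mult)
  have "pnorm p X \<le> pnorm p (\<lambda>m. ?P m + ?Q m)"
    using p X_nonneg X_le by (intro pnorm_mono)
  also have "\<dots> \<le> 2 powr p * (pnorm p ?P + pnorm p ?Q)"
    using p P0 Q0 by (intro pnorm_add)
  also have "\<dots> \<le> 2 powr p * ((1 + ln (T / kk)) powr p * pnorm p F
      + (L * (2 + \<kappa>) * J) powr p * ((8 * sqrt T * exp (\<mu> * T)) powr p * pnorm p F))"
    using P order_trans[OF Q mult_left_mono[OF energy_estimate]]
    by (intro mult_left_mono add_mono) auto
  also have "\<dots> = 2 powr p * ((1 + ln (T / kk)) powr p
      + (L * (2 + \<kappa>) * J * (8 * sqrt T * exp (\<mu> * T))) powr p) * pnorm p F"
    unfolding split by (rule expand)
  also have "\<dots> \<le> 2 powr p * (1 + ln (T / kk) + L * (2 + \<kappa>) * J * (8 * sqrt T * exp (\<mu> * T))) powr p * pnorm p F"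
    using lnT c0 J T_pos p pnorm_nonneg[of p F]
    by (intro mult_left_mono mult_right_mono powr_superadditive) auto
  also have "\<dots> = (2 * (1 + ln (T / kk) + L * (2 + \<kappa>) * J * (8 * sqrt T * exp (\<mu> * T)))) powr p * pnorm p F"
    by (simp only: powr_mult)
  finally show ?thesis .
qed

end

end

section \<open>Smooth cut-off functions of boxes\<close>

text \<open>Coinduction expresses the existence of derivatives of all orders without naming them.\<close>

coinductive smooth_real :: "(real \<Rightarrow> real) \<Rightarrow> bool" where
  "(\<And>x. (f has_real_derivative f' x) (at x)) \<Longrightarrow> smooth_real f' \<Longrightarrow> smooth_real f"

text \<open>The classical smooth function \<open>exp (- 1 / x)\<close>, extended by zero, times a polynomial in \<open>1 /
  x\<close>. The polynomial makes the family closed under differentiation.\<close>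

definition exp_cutoff :: "real poly \<Rightarrow> real \<Rightarrow> real" where
  "exp_cutoff p x = (if x > 0 then poly p (1 / x) * exp (- (1 / x)) else 0)"

lemma poly_times_exp_tendsto_0: "((\<lambda>y. poly p y * exp (- y)) \<longlongrightarrow> (0::real)) at_top"
proof -
  have "((\<lambda>y. \<Sum>i\<le>degree p. coeff p i * (y ^ i / exp y)) \<longlongrightarrow> 0) at_top"
    by (intro tendsto_null_sum tendsto_mult_right_zero tendsto_power_div_exp_0)
  then show ?thesis
    by (simp add: poly_altdef sum_distrib_right exp_minus divide_inverse mult.assoc)
qed

lemma exp_cutoff_deriv:
  "(exp_cutoff p has_real_derivative exp_cutoff ([:0, 0, 1:] * (p - pderiv p)) x) (at x)"
proof -
  consider "x > 0" | "x < 0" | "x = 0" by linarith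
  then show ?thesis
  proof cases
    case 1
    have "((\<lambda>x. poly p (1 / x) * exp (- (1 / x))) has_real_derivative
        exp_cutoff ([:0, 0, 1:] * (p - pderiv p)) x) (at x)"
      using 1 by (auto intro!: derivative_eq_intros simp: exp_cutoff_def)
        (simp add: field_simps power2_eq_square)
    then show ?thesis
      by (rule has_field_derivative_transform_within_open[of _ _ _ "{0<..}"])
        (use 1 in \<open>auto simp: exp_cutoff_def\<close>)
  next
    case 2
    have "((\<lambda>x. 0) has_real_derivative exp_cutoff ([:0, 0, 1:] * (p - pderiv p)) x) (at x)"
      using 2 by (simp add: exp_cutoff_def)
    then show ?thesis
      by (rule has_field_derivative_transform_within_open[of _ _ _ "{..<0}"])
        (use 2 in \<open>auto simp: exp_cutoff_def\<close>)
  next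
    case 3
    \<comment> \<open>at zero the difference quotient is a polynomial in \<open>y = 1 / h\<close> times \<open>exp (- y)\<close>, where \<open>y\<close> tends to infinity\<close>
    have right: "((\<lambda>h. exp_cutoff p h / h) \<longlongrightarrow> 0) (at_right 0)"
    proof -
      have "((\<lambda>y. poly (pCons 0 p) y * exp (- y)) \<longlongrightarrow> 0) at_top"
        by (rule poly_times_exp_tendsto_0)
      then have "((\<lambda>h. poly (pCons 0 p) (inverse h) * exp (- inverse h)) \<longlongrightarrow> 0) (at_right (0::real))"
        by (rule filterlim_compose) (rule filterlim_inverse_at_top_right)
      then show ?thesis
      proof (rule Lim_transform_eventually)
        show "\<forall>\<^sub>F h in at_right 0. poly (pCons 0 p) (inverse h) * exp (- inverse h) = exp_cutoff p h / h"
          using eventually_at_right_less[of "0::real"]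
          by eventually_elim (simp add: exp_cutoff_def field_simps)
      qed
    qed
    have left: "((\<lambda>h. exp_cutoff p h / h) \<longlongrightarrow> 0) (at_left 0)"
    proof (rule Lim_transform_eventually[OF tendsto_const])
      show "\<forall>\<^sub>F h in at_left 0. 0 = exp_cutoff p h / h"
        by (rule eventually_at_leftI[of "-1"]) (auto simp: exp_cutoff_def)
    qed
    have "((\<lambda>h. exp_cutoff p h / h) \<longlongrightarrow> 0) (at 0)"
      using left right by (simp add: filterlim_split_at)
    then show ?thesis using 3 by (simp add: DERIV_def exp_cutoff_def)
  qed
qed

lemma smooth_real_exp_cutoff: "smooth_real (\<lambda>x. exp_cutoff p (c * x + d))"
proof -
  have "smooth_real f" if "\<exists>p. f = (\<lambda>x. exp_cutoff p (c * x + d))" for f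
    using that
  proof (coinduction arbitrary: f)
    case smooth_real
    then obtain p where f: "f = (\<lambda>x. exp_cutoff p (c * x + d))" by blast
    define q where "q = smult c ([:0, 0, 1:] * (p - pderiv p))"
    have "(f has_real_derivative exp_cutoff q (c * x + d)) (at x)" for x
    proof -
      have "((\<lambda>x. exp_cutoff p (c * x + d)) has_real_derivative
          exp_cutoff ([:0, 0, 1:] * (p - pderiv p)) (c * x + d) * c) (at x)"
        by (rule DERIV_chain2[OF exp_cutoff_deriv]) (auto intro!: derivative_eq_intros)
      moreover have "exp_cutoff ([:0, 0, 1:] * (p - pderiv p)) (c * x + d) * c
          = exp_cutoff q (c * x + d)"
        by (simp add: exp_cutoff_def q_def)
      ultimately show ?thesis by (simp add: f)
    qed
    then show ?case
      by (intro exI[of _ f] exI[of _ "\<lambda>x. exp_cutoff q (c * x + d)"]) auto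
  qed
  then show ?thesis by blast
qed

text \<open>By the Leibniz rule, sums of products of smooth functions are closed under differentiation; products alone are not.
  This is the invariant for coinduction in \<open>smooth_real_mult\<close>.\<close>

inductive product_sum :: "(real \<Rightarrow> real) \<Rightarrow> bool" where
  product: "smooth_real f \<Longrightarrow> smooth_real g \<Longrightarrow> product_sum (\<lambda>x. f x * g x)"
| sum: "product_sum f \<Longrightarrow> product_sum g \<Longrightarrow> product_sum (\<lambda>x. f x + g x)"

lemma product_sum_deriv:
  "product_sum h \<Longrightarrow> \<exists>h'. (\<forall>x. (h has_real_derivative h' x) (at x)) \<and> product_sum h'"
proof (induction rule: product_sum.induct)
  case (product f g)
  from product(1) obtain f' where f': "\<And>x. (f has_real_derivative f' x) (at x)" "smooth_real f'"
    by (cases rule: smooth_real.cases) auto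
  from product(2) obtain g' where g': "\<And>x. (g has_real_derivative g' x) (at x)" "smooth_real g'"
    by (cases rule: smooth_real.cases) auto
  have "((\<lambda>x. f x * g x) has_real_derivative f' x * g x + f x * g' x) (at x)" for x
    by (auto intro!: derivative_eq_intros f' g')
  moreover have "product_sum (\<lambda>x. f' x * g x + f x * g' x)"
    using product f' g' by (intro product_sum.intros)
  ultimately show ?case
    by (intro exI[of _ "\<lambda>x. f' x * g x + f x * g' x"]) simp
next
  case (sum f g)
  then obtain f' g' where "\<And>x. (f has_real_derivative f' x) (at x)" "product_sum f'"
    "\<And>x. (g has_real_derivative g' x) (at x)" "product_sum g'" by blast
  then show ?case
    by (intro exI[of _ "\<lambda>x. f' x + g' x"]) (auto intro!: derivative_eq_intros product_sum.intros)
qed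

lemma smooth_real_mult: "smooth_real f \<Longrightarrow> smooth_real g \<Longrightarrow> smooth_real (\<lambda>x. f x * g x)"
proof -
  have "product_sum h \<Longrightarrow> smooth_real h" for h
  proof (coinduction arbitrary: h)
    case smooth_real
    then show ?case using product_sum_deriv by blast
  qed
  then show "smooth_real f \<Longrightarrow> smooth_real g \<Longrightarrow> smooth_real (\<lambda>x. f x * g x)"
    by (blast intro: product_sum.product)
qed

lemma coordinate_product_has_derivative:
  fixes f f' :: "'d::finite \<Rightarrow> real \<Rightarrow> real"
  assumes "\<And>i x. (f i has_real_derivative f' i x) (at x)"
  shows "((\<lambda>x::real^'d. \<Prod>i\<in>UNIV. f i (x $ i)) has_derivative
     (\<lambda>y. \<Sum>i\<in>UNIV. (f' i (x $ i) * y $ i) * (\<Prod>j\<in>UNIV - {i}. f j (x $ j)))) (at x)"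
proof (rule has_derivative_prod)
  fix i
  have "(f i has_derivative (*) (f' i (x $ i))) (at (x $ i))"
    using assms by (simp add: has_field_derivative_def)
  from has_derivative_compose[OF bounded_linear.has_derivative[OF bounded_linear_vec_nth has_derivative_ident] this]
  show "((\<lambda>x. f i (x $ i)) has_derivative (\<lambda>y. f' i (x $ i) * y $ i)) (at x)" by simp
qed

text \<open>A partial derivative of a product of functions of the single coordinates is again of this form.\<close>

lemma Ck_coordinate_product:
  fixes f :: "'d::finite \<Rightarrow> real \<Rightarrow> real"
  assumes "\<And>i. smooth_real (f i)"
  shows "Ck_fun n (\<lambda>x::real^'d. \<Prod>i\<in>UNIV. f i (x $ i))"
  using assms
proof (induction n arbitrary: f)
  case (0 f)
  from 0 have "\<exists>f'. (\<forall>x. (f i has_real_derivative f' x) (at x)) \<and> smooth_real f'" for i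
    by (metis smooth_real.cases)
  then obtain f' where f': "\<And>i x. (f i has_real_derivative f' i x) (at x)" by metis
  show ?case
    using coordinate_product_has_derivative[of f f', OF f'] has_derivative_continuous
    by (auto simp: continuous_on_eq_continuous_at) blast
next
  case (Suc n f)
  from Suc.prems have "\<exists>f'. (\<forall>x. (f i has_real_derivative f' x) (at x)) \<and> smooth_real f'" for i
    by (metis smooth_real.cases)
  then obtain f' where f': "\<And>i x. (f i has_real_derivative f' i x) (at x)" "\<And>i. smooth_real (f' i)"
    by metis
  let ?F = "\<lambda>x::real^'d. \<Prod>i\<in>UNIV. f i (x $ i)"
  note D = coordinate_product_has_derivative[of f f', OF f'(1)]
  have "pderiv_at j ?F = (\<lambda>x. \<Prod>i\<in>UNIV. (f(j := f' j)) i (x $ i))" for j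
  proof
    fix x
    have "pderiv_at j ?F x
        = (\<Sum>i\<in>UNIV. (f' i (x $ i) * axis j 1 $ i) * (\<Prod>j\<in>UNIV - {i}. f j (x $ j)))"
      unfolding pderiv_at_def frechet_derivative_at[OF D, symmetric] ..
    also have "\<dots> = (\<Sum>i\<in>UNIV. if i = j then f' i (x $ i) * (\<Prod>j\<in>UNIV - {i}. f j (x $ j)) else 0)"
      by (intro sum.cong) (auto simp: axis_def)
    also have "\<dots> = f' j (x $ j) * (\<Prod>i\<in>UNIV - {j}. f i (x $ i))" by simp
    also have "\<dots> = (\<Prod>i\<in>UNIV. (f(j := f' j)) i (x $ i))"
      by (subst prod.remove[of UNIV j]) (auto intro!: prod.cong)
    finally show "pderiv_at j ?F x = (\<Prod>i\<in>UNIV. (f(j := f' j)) i (x $ i))" .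
  qed
  moreover have "Ck_fun n (\<lambda>x::real^'d. \<Prod>i\<in>UNIV. (f(j := f' j)) i (x $ i))" for j
    using Suc.prems f'(2) by (intro Suc.IH) auto
  moreover have "?F differentiable_on UNIV"
    using D by (auto simp: differentiable_on_def differentiable_def)
  ultimately show ?case by simp
qed

text \<open>As \<open>n\<close> grows these functions increase to the indicator function of the open box.\<close>

definition box_bump :: "nat \<Rightarrow> real^'d \<Rightarrow> real^'d \<Rightarrow> real^'d::finite \<Rightarrow> real" where
  "box_bump n a b x = (\<Prod>i\<in>UNIV. exp_cutoff 1 (real (Suc n) * (x $ i - a $ i)) *
     exp_cutoff 1 (real (Suc n) * (b $ i - x $ i)))"

lemma exp_cutoff_1_bounds: "0 \<le> exp_cutoff 1 x" "exp_cutoff 1 x \<le> 1"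
  by (auto simp: exp_cutoff_def)

lemma box_bump_zero:
  assumes "x \<notin> box a b"
  shows "box_bump n a b x = 0"
proof -
  obtain i where "\<not> (a $ i < x $ i \<and> x $ i < b $ i)" using assms by (auto simp: mem_box_cart)
  then have "x $ i \<le> a $ i \<or> b $ i \<le> x $ i" by linarith
  then have "exp_cutoff 1 (real (Suc n) * (x $ i - a $ i)) *
     exp_cutoff 1 (real (Suc n) * (b $ i - x $ i)) = 0"
    by (auto simp: exp_cutoff_def zero_less_mult_iff)
  then show ?thesis unfolding box_bump_def by (intro prod_zero) auto
qed

lemma box_bump_bounds: "0 \<le> box_bump n a b x" "box_bump n a b x \<le> 1"
  unfolding box_bump_def
  by (auto intro!: prod_nonneg prod_le_1 mult_nonneg_nonneg mult_le_one exp_cutoff_1_bounds)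

lemma box_bump_tendsto: "(\<lambda>n. box_bump n a b x) \<longlonglongrightarrow> indicat_real (box a b) x"
proof (cases "x \<in> box a b")
  case False
  then show ?thesis by (simp add: box_bump_zero)
next
  case True
  have *: "(\<lambda>n. exp_cutoff 1 (real (Suc n) * c)) \<longlonglongrightarrow> 1" if "c > 0" for c :: real
  proof -
    have "(\<lambda>n. exp (- (1 / c * inverse (real (Suc n))))) \<longlonglongrightarrow> exp (- (1 / c * 0))"
      by (intro tendsto_intros LIMSEQ_inverse_real_of_nat)
    moreover have "exp_cutoff 1 (real (Suc n) * c) = exp (- (1 / c * inverse (real (Suc n))))" for n
      using that by (simp add: exp_cutoff_def divide_inverse mult.commute del: of_nat_Suc)
    ultimately show ?thesis by simp
  qed
  have "(\<lambda>n. box_bump n a b x) \<longlonglongrightarrow> (\<Prod>i\<in>(UNIV::'a set). 1 * 1)"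
    unfolding box_bump_def using True
    by (intro tendsto_prod tendsto_mult *) (auto simp: mem_box_cart)
  then show ?thesis using True by simp
qed

lemma test_fun_box_bump:
  assumes "cbox a b \<subseteq> \<Omega>"
  shows "test_fun \<Omega> (box_bump n a b)"
  unfolding test_fun_def
proof (intro conjI allI impI exI[of _ "cbox a b"])
  fix k
  have "smooth_real (\<lambda>x. exp_cutoff 1 (real (Suc n) * (x - a $ i)) * exp_cutoff 1 (real (Suc n) * (b $ i - x)))" for i
    using smooth_real_mult[OF smooth_real_exp_cutoff smooth_real_exp_cutoff,
        of 1 "real (Suc n)" "- (real (Suc n) * a $ i)" 1 "- real (Suc n)" "real (Suc n) * b $ i"]
    by (simp add: algebra_simps)
  from Ck_coordinate_product[OF this]
  show "Ck_fun k (box_bump n a b)" by (simp add: box_bump_def[abs_def])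
next
  fix x assume "x \<notin> cbox a b"
  then show "box_bump n a b x = 0" using box_bump_zero box_subset_cbox by blast
qed (use assms in auto)

section \<open>Uniqueness of weak derivatives\<close>

text \<open>Open boxes form an intersection-stable generator of the Borel sets, and a Lebesgue measurable set differs from a Borel
  set by a null set.\<close>

lemma set_integral_zero_if_boxes:
  fixes g :: "real^'d \<Rightarrow> real"
  assumes g: "integrable lebesgue g"
    and boxes: "\<And>c d. (LINT x:box c d|lebesgue. g x) = 0" and all: "(LINT x|lebesgue. g x) = 0"
    and A: "A \<in> sets lebesgue"
  shows "(LINT x:A|lebesgue. g x) = 0"
proof -
  have si: "set_integrable lebesgue A g" if "A \<in> sets lebesgue" for A
    unfolding set_integrable_def using that g by (rule integrable_mult_indicator)
  have borel: "(LINT x:A|lebesgue. g x) = 0" if "A \<in> sets borel" for A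
  proof -
    let ?G = "range (\<lambda>(a, b). box a b :: (real^'d) set)"
    have "Int_stable ?G" by (auto simp: Int_stable_def box_Int_box)
    moreover have "?G \<subseteq> Pow UNIV" by simp
    moreover have "A \<in> sigma_sets UNIV ?G"
      using that by (subst (asm) borel_eq_box) (auto simp: sets_measure_of_conv)
    ultimately show ?thesis
    proof (induction rule: sigma_sets_induct_disjoint)
      case (basic A)
      then show ?case using boxes by auto
    next
      case empty
      show ?case by (simp add: set_lebesgue_integral_def)
    next
      case (compl A)
      have "A \<in> sets borel" using compl(1) by (subst borel_eq_box) (auto simp: sets_measure_of_conv)
      then have AL: "A \<in> sets lebesgue" by simp
      have ALc: "UNIV - A \<in> sets lebesgue" using sets.compl_sets[OF AL] by simp
      have "(LINT x:UNIV|lebesgue. g x) = (LINT x:A|lebesgue. g x) + (LINT x:UNIV - A|lebesgue. g x)"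
        using set_integral_Un[of A "UNIV - A" lebesgue g] si[OF AL] si[OF ALc] by simp
      then show ?case
        using compl all by (simp add: set_lebesgue_integral_def)
    next
      case (union A)
      have "A i \<in> sets borel" for i
        using union(2) by (subst borel_eq_box) (auto simp: sets_measure_of_conv)
      then have AL: "A i \<in> sets lebesgue" for i by simp
      have "set_integrable lebesgue (\<Union>i. A i) g" by (intro si sets.countable_UN) (use AL in auto)
      then show ?case
        using lebesgue_integral_countable_add[of A lebesgue g] AL union
        by (auto simp: disjoint_family_on_def)
    qed
  qed
  obtain B N N' where BN: "A = B \<union> N" "N \<subseteq> N'" "N' \<in> null_sets lborel" "B \<in> sets lborel"
    using sets_completionE[OF A] by metis
  have "(LINT x:A|lebesgue. g x) = (LINT x:B|lebesgue. g x)"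
  proof (rule set_integral_cong_set)
    have "N' \<in> null_sets lebesgue" using BN by (simp add: null_sets_completionI)
    then have "AE x in lebesgue. x \<notin> N'" by (rule AE_not_in)
    then show "AE x in lebesgue. (x \<in> B) = (x \<in> A)"
      by eventually_elim (use BN in auto)
    have "B \<in> sets lebesgue" using BN(4) by simp
    then show "set_borel_measurable lebesgue A g" "set_borel_measurable lebesgue B g"
      unfolding set_borel_measurable_def
      by (intro borel_measurable_integrable si[unfolded set_integrable_def] A; assumption)+
  qed
  then show ?thesis using borel BN by simp
qed


lemma L1loc_integrable:
  assumes "L1loc_fun \<Omega> g" "compact K" "K \<subseteq> \<Omega>"
  shows "integrable lebesgue (\<lambda>x. indicat_real K x *\<^sub>R g x)"
proof -
  have "K \<in> sets lebesgue" using assms(2) by (simp add: borel_compact)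
  then show ?thesis
    using assms integrable_restrict_space[of K lebesgue g] by (simp add: L1loc_fun_def)
qed

text \<open>The fundamental lemma of the calculus of variations. Testing with the smooth functions \<open>box_bump\<close> shows
  that the integral over every box with closure in the domain vanishes, and boxes generate the measurable sets.\<close>

lemma AE_zero_on_open:
  fixes \<Omega> :: "(real^'d) set"
  assumes \<Omega>: "open \<Omega>" and g: "L1loc_fun \<Omega> g"
    and test: "\<And>\<phi>. test_fun \<Omega> \<phi> \<Longrightarrow> (LINT x|lebesgue_on \<Omega>. g x * \<phi> x) = 0"
  shows "AE x in lebesgue_on \<Omega>. g x = 0"
proof -
  have box0: "(LINT x:box a b|lebesgue. g x) = 0" if ab: "cbox a b \<subseteq> \<Omega>" for a b
  proof -
    have intC: "integrable lebesgue (\<lambda>x. indicat_real (cbox a b) x *\<^sub>R g x)"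
      using g ab by (intro L1loc_integrable) auto
    have lim: "(\<lambda>n. LINT x|lebesgue. (indicat_real (cbox a b) x *\<^sub>R g x) * box_bump n a b x)
        \<longlonglongrightarrow> (LINT x|lebesgue. (indicat_real (cbox a b) x *\<^sub>R g x) * indicat_real (box a b) x)"
    proof (rule integral_dominated_convergence[where w = "\<lambda>x. norm (indicat_real (cbox a b) x *\<^sub>R g x)"])
      have "continuous_on UNIV (box_bump n a b)" for n
        using test_fun_box_bump[OF ab, of n] unfolding test_fun_def by (metis Ck_fun.simps(1))
      then have "box_bump n a b \<in> borel_measurable lebesgue" for n
        by (intro measurable_completion) (simp add: borel_measurable_continuous_onI)
      then show "(\<lambda>x. (indicat_real (cbox a b) x *\<^sub>R g x) * box_bump n a b x) \<in> borel_measurable lebesgue" for n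
        by (rule borel_measurable_times[OF borel_measurable_integrable[OF intC]])
      show "(\<lambda>x. (indicat_real (cbox a b) x *\<^sub>R g x) * indicat_real (box a b) x) \<in> borel_measurable lebesgue"
        by (rule borel_measurable_times[OF borel_measurable_integrable[OF intC]])
          (simp add: borel_measurable_indicator)
      show "AE x in lebesgue. norm ((indicat_real (cbox a b) x *\<^sub>R g x) * box_bump n a b x)
          \<le> norm (indicat_real (cbox a b) x *\<^sub>R g x)" for n
        using box_bump_bounds[of n a b] by (intro AE_I2) (auto simp: abs_mult mult_left_le)
      show "AE x in lebesgue. (\<lambda>n. (indicat_real (cbox a b) x *\<^sub>R g x) * box_bump n a b x)
          \<longlonglongrightarrow> (indicat_real (cbox a b) x *\<^sub>R g x) * indicat_real (box a b) x"
        by (intro AE_I2 tendsto_intros box_bump_tendsto)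
    qed (use intC in auto)
    have zero: "(LINT x|lebesgue. (indicat_real (cbox a b) x *\<^sub>R g x) * box_bump n a b x) = 0" for n
    proof -
      have "(LINT x|lebesgue. (indicat_real (cbox a b) x *\<^sub>R g x) * box_bump n a b x)
          = (LINT x|lebesgue. indicat_real \<Omega> x *\<^sub>R (g x * box_bump n a b x))"
        using ab box_bump_zero[of _ a b n] box_subset_cbox[of a b]
        by (intro Bochner_Integration.integral_cong refl) (auto simp: indicator_def)
      also have "\<dots> = (LINT x|lebesgue_on \<Omega>. g x * box_bump n a b x)"
        using \<Omega> by (simp add: integral_restrict_space)
      also have "\<dots> = 0" by (rule test[OF test_fun_box_bump[OF ab]])
      finally show ?thesis .
    qed
    have "(LINT x|lebesgue. (indicat_real (cbox a b) x *\<^sub>R g x) * indicat_real (box a b) x) = 0"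
      using lim unfolding zero by (rule LIMSEQ_unique) (rule tendsto_const)
    moreover have "(LINT x|lebesgue. (indicat_real (cbox a b) x *\<^sub>R g x) * indicat_real (box a b) x)
        = (LINT x:box a b|lebesgue. g x)"
      unfolding set_lebesgue_integral_def using box_subset_cbox[of a b]
      by (intro Bochner_Integration.integral_cong refl) (auto simp: indicator_def)
    ultimately show ?thesis by simp
  qed
  have cbox0: "AE x in lebesgue. x \<in> cbox a b \<longrightarrow> g x = 0" if ab: "cbox a b \<subseteq> \<Omega>" for a b
  proof -
    let ?g = "\<lambda>x. indicat_real (box a b) x *\<^sub>R g x"
    have intC: "integrable lebesgue (\<lambda>x. indicat_real (cbox a b) x *\<^sub>R g x)"
      using g ab by (intro L1loc_integrable) auto
    have "integrable lebesgue (\<lambda>x. indicat_real (box a b) x *\<^sub>R (indicat_real (cbox a b) x *\<^sub>R g x))"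
      by (intro integrable_mult_indicator intC) simp
    moreover have "(\<lambda>x. indicat_real (box a b) x *\<^sub>R (indicat_real (cbox a b) x *\<^sub>R g x)) = ?g"
      using box_subset_cbox[of a b] by (auto simp: indicator_def fun_eq_iff)
    ultimately have intg: "integrable lebesgue ?g" by simp
    have sub: "(LINT x:box c d|lebesgue. ?g x) = 0" for c d
    proof -
      obtain c' d' where cd: "box c d \<inter> box a b = box c' d'" using box_Int_box by blast
      have "(LINT x:box c d|lebesgue. ?g x) = (LINT x:box c' d'|lebesgue. g x)"
        unfolding set_lebesgue_integral_def cd[symmetric]
        by (intro Bochner_Integration.integral_cong refl) (auto simp: indicator_def)
      also have "\<dots> = 0"
      proof (cases "box c' d' = {}")
        case False
        have "box c' d' \<subseteq> cbox a b" using cd box_subset_cbox by blast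
        then have "closure (box c' d') \<subseteq> cbox a b" by (rule closure_minimal) (rule closed_cbox)
        then have "cbox c' d' \<subseteq> \<Omega>" using False ab by simp
        then show ?thesis by (rule box0)
      qed (simp add: set_lebesgue_integral_def)
      finally show ?thesis .
    qed
    have all: "(LINT x|lebesgue. ?g x) = 0"
      using box0[OF ab] by (simp add: set_lebesgue_integral_def)
    have "AE x in lebesgue. ?g x = 0"
    proof (rule density_unique_real[OF intg])
      show "(LINT x:A|lebesgue. ?g x) = (LINT x:A|lebesgue. 0)" if "A \<in> sets lebesgue" for A
        using set_integral_zero_if_boxes[OF intg sub all that] by simp
    qed simp
    moreover have "AE x in lebesgue. x \<notin> cbox a b - box a b"
      using negligible_frontier_interval[of a b] by (intro AE_not_in) (simp add: negligible_iff_null_sets)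
    ultimately show ?thesis
      by eventually_elim (auto simp: indicator_def split: if_splits)
  qed
  obtain D where D: "countable D" "D \<subseteq> Pow \<Omega>" "\<And>X. X \<in> D \<Longrightarrow> \<exists>a b. X = cbox a b" "\<Union>D = \<Omega>"
    using open_countable_Union_open_cbox[OF \<Omega>] by metis
  have "AE x in lebesgue. \<forall>X\<in>D. x \<in> X \<longrightarrow> g x = 0"
    using D cbox0 by (subst AE_ball_countable) (auto, metis PowD subset_iff)
  then have "AE x in lebesgue. x \<in> \<Omega> \<longrightarrow> g x = 0"
    by eventually_elim (use D in auto)
  then show ?thesis using \<Omega> by (simp add: AE_restrict_space_iff)
qed

section \<open>Weak derivatives of test functions\<close>

lemma integrable_compact_support:
  fixes f :: "'a::euclidean_space \<Rightarrow> real"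
  assumes "compact K" "continuous_on UNIV f" "\<And>x. x \<notin> K \<Longrightarrow> f x = 0"
  shows "integrable lborel f" "integrable lebesgue f"
proof -
  have "integrable lborel (\<lambda>x. indicat_real K x *\<^sub>R f x)"
    using assms by (intro borel_integrable_compact) (auto intro: continuous_on_subset)
  also have "(\<lambda>x. indicat_real K x *\<^sub>R f x) = f"
    using assms(3) by (auto simp: indicator_def fun_eq_iff)
  finally show "integrable lborel f" .
  then show "integrable lebesgue f"
    using assms(2) by (simp add: integrable_completion borel_measurable_continuous_onI)
qed

lemma bounded_compact_support:
  fixes f :: "'a::euclidean_space \<Rightarrow> real"
  assumes "compact K" "continuous_on UNIV f" "\<And>x. x \<notin> K \<Longrightarrow> f x = 0"
  obtains B where "B \<ge> 0" "\<And>x. \<bar>f x\<bar> \<le> B"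
proof -
  have "bounded (f ` K)"
    using assms by (intro compact_imp_bounded compact_continuous_image) (auto intro: continuous_on_subset)
  then obtain B where B: "\<And>x. x \<in> K \<Longrightarrow> \<bar>f x\<bar> \<le> B" by (auto simp: bounded_iff)
  have "\<bar>f x\<bar> \<le> max B 0" for x using B[of x] assms(3)[of x] by (cases "x \<in> K") auto
  then show ?thesis using that[of "max B 0"] by simp
qed

lemma pderiv_at_line:
  assumes "F differentiable_on UNIV"
  shows "((\<lambda>s. F (x + s *\<^sub>R axis i 1)) has_real_derivative pderiv_at i F (x + s *\<^sub>R axis i 1)) (at s)"
proof -
  let ?y = "x + s *\<^sub>R axis i 1"
  have F: "(F has_derivative frechet_derivative F (at ?y)) (at ?y)"
    using assms by (metis UNIV_I differentiable_on_def frechet_derivative_works)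
  have "((\<lambda>s. F (x + s *\<^sub>R axis i 1)) has_derivative (\<lambda>h. frechet_derivative F (at ?y) (h *\<^sub>R axis i 1))) (at s)"
    by (rule has_derivative_compose[of "\<lambda>s. x + s *\<^sub>R axis i 1"])
      (auto intro!: derivative_eq_intros F)
  moreover have "(\<lambda>h. frechet_derivative F (at ?y) (h *\<^sub>R axis i 1)) = (*) (pderiv_at i F ?y)"
    using linear_scale[OF has_derivative_linear[OF F]]
    by (auto simp: pderiv_at_def fun_eq_iff mult.commute)
  ultimately show ?thesis by (simp add: has_field_derivative_def)
qed

lemma pderiv_at_zero_outside:
  assumes "closed K" "\<And>x. x \<notin> K \<Longrightarrow> F x = 0" "x \<notin> K"
  shows "pderiv_at i F x = 0"
proof -
  have "(F has_derivative (\<lambda>_. 0)) (at x)"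
    by (rule has_derivative_transform_within_open[of "\<lambda>_. 0" _ _ _ "- K"])
      (use assms in \<open>auto simp: open_Compl\<close>)
  then show ?thesis
    by (simp add: pderiv_at_def flip: frechet_derivative_at)
qed

text \<open>The integral of a difference quotient vanishes by translation invariance, and the difference quotients converge to the
  derivative boundedly on a fixed compact set.\<close>

lemma integral_pderiv_zero:
  fixes F :: "real^'d \<Rightarrow> real"
  assumes diff: "F differentiable_on UNIV" and cont: "continuous_on UNIV (pderiv_at i F)"
    and K: "compact K" and F0: "\<And>x. x \<notin> K \<Longrightarrow> F x = 0"
  shows "(LINT x|lebesgue. pderiv_at i F x) = 0"
proof -
  let ?e = "axis i 1 :: real^'d"
  let ?D = "pderiv_at i F"
  define h where "h n = inverse (real (Suc n))" for n
  have h: "0 < h n" "h n \<le> 1" for n by (auto simp: h_def field_simps)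
  define q where "q n x = (F (x + h n *\<^sub>R ?e) - F x) / h n" for n x
  have D0: "?D x = 0" if "x \<notin> K" for x
    using pderiv_at_zero_outside[of K F x i] K F0 that compact_imp_closed by blast
  obtain B where B: "B \<ge> 0" "\<And>x. \<bar>?D x\<bar> \<le> B"
    using bounded_compact_support[OF K cont D0] by blast
  obtain R where R: "\<And>x. x \<in> K \<Longrightarrow> norm x \<le> R"
    using compact_imp_bounded[OF K] by (auto simp: bounded_iff)
  let ?K = "cball 0 (R + 1) :: (real^'d) set"
  have contF: "continuous_on UNIV F" using diff by (rule differentiable_imp_continuous_on)
  have mF: "F \<in> borel_measurable borel" using contF by (rule borel_measurable_continuous_onI)
  have int_shift: "integrable lborel (\<lambda>x. F (x + h n *\<^sub>R ?e))"
    "(LINT x|lborel. F (x + h n *\<^sub>R ?e)) = (LINT x|lborel. F x)" for n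
  proof -
    have "integrable (distr lborel borel ((+) (h n *\<^sub>R ?e))) F"
      unfolding lborel_distr_plus using K contF F0 by (rule integrable_compact_support)
    then show "integrable lborel (\<lambda>x. F (x + h n *\<^sub>R ?e))"
      by (subst (asm) integrable_distr_eq) (auto simp: add.commute mF)
    have "(LINT x|distr lborel borel ((+) (h n *\<^sub>R ?e)). F x) = (LINT x|lborel. F (h n *\<^sub>R ?e + x))"
      by (rule integral_distr) (auto simp: mF)
    then show "(LINT x|lborel. F (x + h n *\<^sub>R ?e)) = (LINT x|lborel. F x)"
      by (simp add: lborel_distr_plus add.commute)
  qed
  have intF: "integrable lborel F" using K contF F0 by (rule integrable_compact_support)
  have q0: "(LINT x|lborel. q n x) = 0" for n
    using int_shift[of n] intF by (simp add: q_def[abs_def])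
  have bound: "\<bar>q n x\<bar> \<le> B * indicat_real ?K x" for n x
  proof (cases "x \<in> ?K")
    case True
    have "\<exists>z>0. z < h n \<and> F (x + h n *\<^sub>R ?e) - F (x + 0 *\<^sub>R ?e) = (h n - 0) * ?D (x + z *\<^sub>R ?e)"
      using h[of n] by (intro MVT2 pderiv_at_line diff)
    then obtain z where "F (x + h n *\<^sub>R ?e) - F x = h n * ?D (x + z *\<^sub>R ?e)" by auto
    then have "q n x = ?D (x + z *\<^sub>R ?e)" using h(1)[of n] by (simp add: q_def)
    then show ?thesis using B True by simp
  next
    case False
    then have n: "norm x > R + 1" by simp
    have "norm x \<le> norm (x + h n *\<^sub>R ?e) + norm (h n *\<^sub>R ?e)"
      using norm_triangle_ineq4[of "x + h n *\<^sub>R ?e" "h n *\<^sub>R ?e"] by simp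
    also have "norm (h n *\<^sub>R ?e) \<le> 1" using h[of n] by (simp add: norm_axis_1)
    finally have "norm (x + h n *\<^sub>R ?e) > R" using n by simp
    then have "x + h n *\<^sub>R ?e \<notin> K" "x \<notin> K" using R n by fastforce+
    then show ?thesis using F0 False by (simp add: q_def)
  qed
  have "(\<lambda>n. LINT x|lborel. q n x) \<longlonglongrightarrow> (LINT x|lborel. ?D x)"
  proof (rule integral_dominated_convergence[where w = "\<lambda>x. B * indicat_real ?K x"])
    show "?D \<in> borel_measurable lborel" using cont by (simp add: borel_measurable_continuous_onI)
    show "q n \<in> borel_measurable lborel" for n
      using int_shift(1)[of n] intF unfolding q_def[abs_def]
      by (intro borel_measurable_integrable) auto
    have "integrable lborel (indicat_real ?K)"
      using emeasure_bounded_finite[of ?K] by (intro integrable_real_indicator) auto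
    then show "integrable lborel (\<lambda>x. B * indicat_real ?K x)" by simp
    show "AE x in lborel. norm (q n x) \<le> B * indicat_real ?K x" for n
      using bound by (intro AE_I2) simp
    have "(\<lambda>n. q n x) \<longlonglongrightarrow> ?D x" for x
    proof -
      have "((\<lambda>s. F (x + s *\<^sub>R ?e)) has_real_derivative ?D x) (at 0)"
        using pderiv_at_line[OF diff, of x i 0] by simp
      then have "((\<lambda>s. (F (x + s *\<^sub>R ?e) - F x) / s) \<longlongrightarrow> ?D x) (at 0)"
        by (simp add: DERIV_def)
      moreover have "filterlim h (at 0) sequentially"
        unfolding filterlim_at h_def using LIMSEQ_inverse_real_of_nat by auto
      ultimately show ?thesis
        unfolding q_def by (rule filterlim_compose)
    qed
    then show "AE x in lborel. (\<lambda>n. q n x) \<longlonglongrightarrow> ?D x" by simp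
  qed
  then have "(\<lambda>n::nat. 0::real) \<longlonglongrightarrow> (LINT x|lborel. ?D x)" unfolding q0 .
  then have "(LINT x|lborel. ?D x) = 0" by (rule LIMSEQ_unique) (rule tendsto_const)
  then show ?thesis
    using cont by (simp add: integral_completion borel_measurable_continuous_onI)
qed

lemma integral_restrict_support:
  fixes f :: "real^'d \<Rightarrow> real"
  assumes "open \<Omega>" "\<And>x. x \<notin> \<Omega> \<Longrightarrow> f x = 0"
  shows "(LINT x|lebesgue_on \<Omega>. f x) = (LINT x|lebesgue. f x)"
    and "integrable (lebesgue_on \<Omega>) f \<longleftrightarrow> integrable lebesgue f"
proof -
  have "(\<lambda>x. indicat_real \<Omega> x *\<^sub>R f x) = f" using assms(2) by (auto simp: indicator_def fun_eq_iff)
  then show "(LINT x|lebesgue_on \<Omega>. f x) = (LINT x|lebesgue. f x)"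
    "integrable (lebesgue_on \<Omega>) f \<longleftrightarrow> integrable lebesgue f"
    using assms(1) by (simp_all add: integral_restrict_space integrable_restrict_space)
qed

lemma test_funE:
  assumes "test_fun \<Omega> \<phi>"
  obtains K where "compact K" "K \<subseteq> \<Omega>" "\<And>x. x \<notin> K \<Longrightarrow> \<phi> x = 0" "\<And>i x. x \<notin> K \<Longrightarrow> pderiv_at i \<phi> x = 0"
    "continuous_on UNIV \<phi>" "\<phi> differentiable_on UNIV" "\<And>i. continuous_on UNIV (pderiv_at i \<phi>)"
proof -
  obtain K where K: "compact K" "K \<subseteq> \<Omega>" "\<And>x. x \<notin> K \<Longrightarrow> \<phi> x = 0"
    using assms unfolding test_fun_def by blast
  have "Ck_fun 0 \<phi>" "Ck_fun (Suc 0) \<phi>" using assms unfolding test_fun_def by blast+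
  moreover have "pderiv_at i \<phi> x = 0" if "x \<notin> K" for i x
    using pderiv_at_zero_outside[of K \<phi> x i] K that compact_imp_closed by blast
  ultimately show ?thesis using that[of K] K by auto
qed

lemma L1loc_continuous: "continuous_on UNIV f \<Longrightarrow> L1loc_fun \<Omega> f"
  unfolding L1loc_fun_def
proof (intro allI impI)
  fix K assume f: "continuous_on UNIV f" and K: "compact K \<and> K \<subseteq> \<Omega>"
  then have "integrable lborel (\<lambda>x. indicat_real K x *\<^sub>R f x)"
    by (intro borel_integrable_compact) (auto intro: continuous_on_subset)
  then have "integrable lebesgue (\<lambda>x. indicat_real K x *\<^sub>R f x)"
    by (subst integrable_completion) auto
  then show "integrable (lebesgue_on K) f"
    using K by (simp add: integrable_restrict_space borel_compact)
qed

lemma L1loc_times_integrable: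
  assumes \<Omega>: "open \<Omega>" and g: "L1loc_fun \<Omega> g" and K: "compact K" "K \<subseteq> \<Omega>"
    and \<phi>: "continuous_on UNIV \<phi>" "\<And>x. x \<notin> K \<Longrightarrow> \<phi> x = 0"
  shows "integrable (lebesgue_on \<Omega>) (\<lambda>x. g x * \<phi> x)"
proof -
  obtain B where B: "B \<ge> 0" "\<And>x. \<bar>\<phi> x\<bar> \<le> B"
    using bounded_compact_support[OF K(1) \<phi>] by blast
  have intK: "integrable lebesgue (\<lambda>x. indicat_real K x *\<^sub>R g x)"
    using g K by (rule L1loc_integrable)
  have "integrable lebesgue (\<lambda>x. (indicat_real K x *\<^sub>R g x) * \<phi> x)"
  proof (rule Bochner_Integration.integrable_bound)
    show "integrable lebesgue (\<lambda>x. B * (indicat_real K x *\<^sub>R g x))"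
      using intK by (rule integrable_mult_right)
    have "\<phi> \<in> borel_measurable lebesgue"
      using \<phi>(1) by (intro measurable_completion) (simp add: borel_measurable_continuous_onI)
    then show "(\<lambda>x. (indicat_real K x *\<^sub>R g x) * \<phi> x) \<in> borel_measurable lebesgue"
      by (rule borel_measurable_times[OF borel_measurable_integrable[OF intK]])
    show "AE x in lebesgue. norm ((indicat_real K x *\<^sub>R g x) * \<phi> x) \<le> norm (B * (indicat_real K x *\<^sub>R g x))"
    proof (intro AE_I2)
      fix x
      have "\<bar>indicat_real K x * g x\<bar> * \<bar>\<phi> x\<bar> \<le> \<bar>indicat_real K x * g x\<bar> * B"
        using B by (intro mult_left_mono) auto
      then show "norm ((indicat_real K x *\<^sub>R g x) * \<phi> x) \<le> norm (B * (indicat_real K x *\<^sub>R g x))"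
        using B(1) by (simp add: abs_mult mult_ac)
    qed
  qed
  moreover have "(\<lambda>x. (indicat_real K x *\<^sub>R g x) * \<phi> x) = (\<lambda>x. g x * \<phi> x)"
    using \<phi>(2) by (auto simp: indicator_def fun_eq_iff)
  moreover have "g x * \<phi> x = 0" if "x \<notin> \<Omega>" for x using that K \<phi>(2)[of x] by auto
  ultimately show ?thesis using integral_restrict_support(2)[OF \<Omega>, of "\<lambda>x. g x * \<phi> x"] by simp
qed

text \<open>Integration by parts is \<open>integral_pderiv_zero\<close> for the product of two test functions.\<close>

lemma test_fun_has_weak_pderiv:
  assumes \<Omega>: "open \<Omega>" and \<phi>: "test_fun \<Omega> \<phi>"
  shows "has_weak_pderiv \<Omega> i \<phi> (pderiv_at i \<phi>)"
  unfolding has_weak_pderiv_def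
proof (intro conjI allI impI)
  obtain K where K: "compact K" "K \<subseteq> \<Omega>" "\<And>x. x \<notin> K \<Longrightarrow> \<phi> x = 0" "\<And>i x. x \<notin> K \<Longrightarrow> pderiv_at i \<phi> x = 0"
    "continuous_on UNIV \<phi>" "\<phi> differentiable_on UNIV" "\<And>i. continuous_on UNIV (pderiv_at i \<phi>)"
    using test_funE[OF \<phi>] by blast
  show "L1loc_fun \<Omega> \<phi>" "L1loc_fun \<Omega> (pderiv_at i \<phi>)" using K by (auto intro: L1loc_continuous)
  fix \<psi> assume "test_fun \<Omega> \<psi>"
  then obtain K' where K': "compact K'" "K' \<subseteq> \<Omega>" "\<And>x. x \<notin> K' \<Longrightarrow> \<psi> x = 0" "\<And>i x. x \<notin> K' \<Longrightarrow> pderiv_at i \<psi> x = 0"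
    "continuous_on UNIV \<psi>" "\<psi> differentiable_on UNIV" "\<And>i. continuous_on UNIV (pderiv_at i \<psi>)"
    using test_funE by blast
  let ?F = "\<lambda>x. \<phi> x * \<psi> x"
  have dF: "pderiv_at i ?F x = \<phi> x * pderiv_at i \<psi> x + pderiv_at i \<phi> x * \<psi> x" for x
  proof -
    have "(\<phi> has_derivative frechet_derivative \<phi> (at x)) (at x)"
      "(\<psi> has_derivative frechet_derivative \<psi> (at x)) (at x)"
      using K(6) K'(6) by (metis UNIV_I differentiable_on_def frechet_derivative_works)+
    from has_derivative_mult[OF this] show ?thesis
      by (simp add: pderiv_at_def flip: frechet_derivative_at)
  qed
  have "(LINT x|lebesgue. pderiv_at i ?F x) = 0"
  proof (rule integral_pderiv_zero[OF _ _ K(1)])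
    show "?F differentiable_on UNIV" using K(6) K'(6) by (rule differentiable_on_mult)
    show "continuous_on UNIV (pderiv_at i ?F)"
      unfolding dF[abs_def] using K(5,7) K'(5,7) by (intro continuous_intros)
  qed (use K in auto)
  moreover have "integrable lebesgue (\<lambda>x. \<phi> x * pderiv_at i \<psi> x)"
    by (rule integrable_compact_support[OF K(1)]) (use K K' in \<open>auto intro!: continuous_intros\<close>)
  moreover have "integrable lebesgue (\<lambda>x. pderiv_at i \<phi> x * \<psi> x)"
    by (rule integrable_compact_support[OF K(1)]) (use K K' in \<open>auto intro!: continuous_intros\<close>)
  ultimately have "(LINT x|lebesgue. \<phi> x * pderiv_at i \<psi> x) = - (LINT x|lebesgue. pderiv_at i \<phi> x * \<psi> x)"
    by (simp add: dF)
  moreover have "\<phi> x = 0" "pderiv_at i \<phi> x = 0" if "x \<notin> \<Omega>" for x using K that by blast+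
  ultimately show "(LINT x|lebesgue_on \<Omega>. \<phi> x * pderiv_at i \<psi> x) = - (LINT x|lebesgue_on \<Omega>. pderiv_at i \<phi> x * \<psi> x)"
    using \<Omega> by (simp add: integral_restrict_support)
qed

section \<open>Linearity of weak derivatives\<close>

lemma L1loc_add: "L1loc_fun \<Omega> f \<Longrightarrow> L1loc_fun \<Omega> g \<Longrightarrow> L1loc_fun \<Omega> (\<lambda>x. f x + g x)"
  unfolding L1loc_fun_def by auto

lemma L1loc_scale: "L1loc_fun \<Omega> f \<Longrightarrow> L1loc_fun \<Omega> (\<lambda>x. c * f x)"
  unfolding L1loc_fun_def by auto

text \<open>The difference of two weak derivatives is orthogonal to all test functions.\<close>

lemma has_weak_pderiv_unique:
  assumes \<Omega>: "open \<Omega>" and g: "has_weak_pderiv \<Omega> i u g" and g': "has_weak_pderiv \<Omega> i u g'"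
  shows "AE x in lebesgue_on \<Omega>. g x = g' x"
proof -
  have L: "L1loc_fun \<Omega> g" "L1loc_fun \<Omega> g'" using g g' by (auto simp: has_weak_pderiv_def)
  have "AE x in lebesgue_on \<Omega>. g x + (-1) * g' x = 0"
  proof (rule AE_zero_on_open[OF \<Omega> L1loc_add[OF L(1) L1loc_scale[OF L(2)]]])
    fix \<phi> assume \<phi>: "test_fun \<Omega> \<phi>"
    then obtain K where K: "compact K" "K \<subseteq> \<Omega>" "continuous_on UNIV \<phi>" "\<And>x. x \<notin> K \<Longrightarrow> \<phi> x = 0"
      using test_funE by metis
    have I: "integrable (lebesgue_on \<Omega>) (\<lambda>x. g x * \<phi> x)" "integrable (lebesgue_on \<Omega>) (\<lambda>x. g' x * \<phi> x)"
      using L1loc_times_integrable[OF \<Omega> _ K] L by auto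
    have "(LINT x|lebesgue_on \<Omega>. g x * \<phi> x) = (LINT x|lebesgue_on \<Omega>. g' x * \<phi> x)"
      using g g' \<phi> unfolding has_weak_pderiv_def by fastforce
    then show "(LINT x|lebesgue_on \<Omega>. (g x + (-1) * g' x) * \<phi> x) = 0"
      using I by (simp add: left_diff_distrib)
  qed
  then show ?thesis by eventually_elim simp
qed

lemma has_weak_pderiv_add:
  assumes \<Omega>: "open \<Omega>" and g: "has_weak_pderiv \<Omega> i u g" "has_weak_pderiv \<Omega> i v g'"
  shows "has_weak_pderiv \<Omega> i (\<lambda>x. u x + v x) (\<lambda>x. g x + g' x)"
  unfolding has_weak_pderiv_def
proof (intro conjI allI impI)
  have L: "L1loc_fun \<Omega> u" "L1loc_fun \<Omega> v" "L1loc_fun \<Omega> g" "L1loc_fun \<Omega> g'"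
    using g by (auto simp: has_weak_pderiv_def)
  then show "L1loc_fun \<Omega> (\<lambda>x. u x + v x)" "L1loc_fun \<Omega> (\<lambda>x. g x + g' x)" by (auto intro: L1loc_add)
  fix \<phi> assume \<phi>: "test_fun \<Omega> \<phi>"
  then obtain K where K: "compact K" "K \<subseteq> \<Omega>" "\<And>x. x \<notin> K \<Longrightarrow> \<phi> x = 0" "\<And>i x. x \<notin> K \<Longrightarrow> pderiv_at i \<phi> x = 0"
    "continuous_on UNIV \<phi>" "\<phi> differentiable_on UNIV" "\<And>i. continuous_on UNIV (pderiv_at i \<phi>)"
    using test_funE by blast
  note I = L1loc_times_integrable[OF \<Omega> _ K(1,2)]
  have "integrable (lebesgue_on \<Omega>) (\<lambda>x. w x * \<phi> x)" "integrable (lebesgue_on \<Omega>) (\<lambda>x. w x * pderiv_at i \<phi> x)"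
    if "L1loc_fun \<Omega> w" for w
    using I[OF that K(5)] I[OF that K(7)] K(3,4) by blast+
  then show "(LINT x|lebesgue_on \<Omega>. (u x + v x) * pderiv_at i \<phi> x) = - (LINT x|lebesgue_on \<Omega>. (g x + g' x) * \<phi> x)"
    using g \<phi> L by (simp add: distrib_right has_weak_pderiv_def)
qed

lemma has_weak_pderiv_scale:
  assumes "has_weak_pderiv \<Omega> i u g"
  shows "has_weak_pderiv \<Omega> i (\<lambda>x. c * u x) (\<lambda>x. c * g x)"
  using assms unfolding has_weak_pderiv_def by (auto intro: L1loc_scale simp: mult.assoc)

lemma weak_pderiv: "has_weak_pderiv \<Omega> i u g \<Longrightarrow> has_weak_pderiv \<Omega> i u (weak_pderiv \<Omega> i u)"
  unfolding weak_pderiv_def by (rule someI[of "has_weak_pderiv \<Omega> i u" g])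

lemma weak_pderiv_AE:
  "open \<Omega> \<Longrightarrow> has_weak_pderiv \<Omega> i u g \<Longrightarrow> AE x in lebesgue_on \<Omega>. weak_pderiv \<Omega> i u x = g x"
  using has_weak_pderiv_unique weak_pderiv by blast

section \<open>The inner products of the Lebesgue and Sobolev spaces\<close>

lemma borel_measurable_lebesgue_on_AE:
  fixes f g :: "real^'d \<Rightarrow> real"
  assumes "\<Omega> \<in> sets lebesgue" and f: "f \<in> borel_measurable (lebesgue_on \<Omega>)"
    and AE: "AE x in lebesgue_on \<Omega>. f x = g x"
  shows "g \<in> borel_measurable (lebesgue_on \<Omega>)"
proof -
  have "(\<lambda>x. indicat_real \<Omega> x *\<^sub>R f x) \<in> borel_measurable lebesgue"
    using f assms(1) by (simp add: borel_measurable_restrict_space_iff)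
  moreover have "AE x in lebesgue. indicat_real \<Omega> x *\<^sub>R f x = indicat_real \<Omega> x *\<^sub>R g x"
    using AE assms(1) by (auto simp: AE_restrict_space_iff indicator_def)
  ultimately have "(\<lambda>x. indicat_real \<Omega> x *\<^sub>R g x) \<in> borel_measurable lebesgue"
    by (rule borel_measurable_AE)
  then show ?thesis using assms(1) by (simp add: borel_measurable_restrict_space_iff)
qed

lemma L2_fun_AE:
  assumes \<Omega>: "open \<Omega>" and f: "L2_fun \<Omega> f" and AE: "AE x in lebesgue_on \<Omega>. f x = g x"
  shows "L2_fun \<Omega> g"
proof -
  have m: "g \<in> borel_measurable (lebesgue_on \<Omega>)"
    using f AE \<Omega> by (intro borel_measurable_lebesgue_on_AE[of \<Omega> f g]) (auto simp: L2_fun_def)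
  have "AE x in lebesgue_on \<Omega>. (f x)\<^sup>2 = (g x)\<^sup>2" using AE by eventually_elim simp
  then have "integrable (lebesgue_on \<Omega>) (\<lambda>x. (g x)\<^sup>2)"
    using f m by (subst integrable_cong_AE[symmetric, where f = "\<lambda>x. (f x)\<^sup>2"]) (auto simp: L2_fun_def)
  then show ?thesis using m by (simp add: L2_fun_def)
qed

lemma L2_fun_mult_integrable:
  assumes "L2_fun \<Omega> u" "L2_fun \<Omega> v"
  shows "integrable (lebesgue_on \<Omega>) (\<lambda>x. u x * v x)"
proof (rule Bochner_Integration.integrable_bound)
  show "integrable (lebesgue_on \<Omega>) (\<lambda>x. (u x)\<^sup>2 + (v x)\<^sup>2)" using assms by (auto simp: L2_fun_def)
  show "(\<lambda>x. u x * v x) \<in> borel_measurable (lebesgue_on \<Omega>)" using assms by (auto simp: L2_fun_def)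
  have "\<bar>a * b\<bar> \<le> \<bar>a\<^sup>2 + b\<^sup>2\<bar>" for a b :: real
  proof -
    have "0 \<le> (\<bar>a\<bar> - \<bar>b\<bar>)\<^sup>2" by simp
    then have "2 * (\<bar>a\<bar> * \<bar>b\<bar>) \<le> a\<^sup>2 + b\<^sup>2" by (simp add: power2_diff)
    moreover have "0 \<le> \<bar>a\<bar> * \<bar>b\<bar>" by simp
    ultimately show ?thesis by (simp only: abs_mult)
  qed
  then show "AE x in lebesgue_on \<Omega>. norm (u x * v x) \<le> norm ((u x)\<^sup>2 + (v x)\<^sup>2)" by auto
qed

lemma L2_fun_add: "L2_fun \<Omega> u \<Longrightarrow> L2_fun \<Omega> v \<Longrightarrow> L2_fun \<Omega> (\<lambda>x. u x + v x)"
  using L2_fun_mult_integrable[of \<Omega> u v]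
  by (auto simp: L2_fun_def power2_sum mult.assoc)

lemma L2_fun_scale: "L2_fun \<Omega> u \<Longrightarrow> L2_fun \<Omega> (\<lambda>x. c * u x)"
  by (auto simp: L2_fun_def power_mult_distrib)

lemma L2_fun_zero: "L2_fun \<Omega> (\<lambda>x. 0)"
  by (simp add: L2_fun_def)

lemma symmetric_form_L2: "symmetric_form {u. L2_fun \<Omega> u} (L2_inner \<Omega>)"
proof
  show "subspace {u. L2_fun \<Omega> u}"
    unfolding subspace_def
    using L2_fun_zero L2_fun_add L2_fun_scale by (auto simp: plus_fun_def zero_fun_def scaleR_fun_def)
next
  fix u v w assume "u \<in> {u. L2_fun \<Omega> u}" "v \<in> {u. L2_fun \<Omega> u}" "w \<in> {u. L2_fun \<Omega> u}"
  then show "L2_inner \<Omega> (u + v) w = L2_inner \<Omega> u w + L2_inner \<Omega> v w"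
    using L2_fun_mult_integrable[of \<Omega> u w] L2_fun_mult_integrable[of \<Omega> v w]
    by (simp add: L2_inner_def distrib_right)
next
  show "L2_inner \<Omega> (c *\<^sub>R u) w = c * L2_inner \<Omega> u w" for c u w
    by (simp add: L2_inner_def mult.assoc)
  show "L2_inner \<Omega> u v = L2_inner \<Omega> v u" for u v
    by (simp add: L2_inner_def mult.commute)
  show "0 \<le> L2_inner \<Omega> u u" for u
    by (simp add: L2_inner_def)
qed

lemma L2_norm_nrm: "L2_norm \<Omega> = symmetric_form.nrm (L2_inner \<Omega>)"
  by (rule ext) (simp add: L2_norm_def symmetric_form.nrm_def[OF symmetric_form_L2])

lemma L2_inner_AE:
  assumes "open \<Omega>" "L2_fun \<Omega> u" "L2_fun \<Omega> v" "AE x in lebesgue_on \<Omega>. u x = u' x" "AE x in lebesgue_on \<Omega>. v x = v' x"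
  shows "L2_inner \<Omega> u v = L2_inner \<Omega> u' v'"
  unfolding L2_inner_def
proof (rule integral_cong_AE)
  have "L2_fun \<Omega> u'" "L2_fun \<Omega> v'" using assms L2_fun_AE by blast+
  then show "(\<lambda>x. u x * v x) \<in> borel_measurable (lebesgue_on \<Omega>)"
    "(\<lambda>x. u' x * v' x) \<in> borel_measurable (lebesgue_on \<Omega>)"
    using assms by (auto simp: L2_fun_def)
  show "AE x in lebesgue_on \<Omega>. u x * v x = u' x * v' x"
    using assms(4,5) by eventually_elim simp
qed

lemma H1_weak_pderiv:
  assumes "open \<Omega>" "H1_fun \<Omega> u"
  shows "has_weak_pderiv \<Omega> i u (weak_pderiv \<Omega> i u)" "L2_fun \<Omega> (weak_pderiv \<Omega> i u)"
proof -
  obtain g where g: "L2_fun \<Omega> g" "has_weak_pderiv \<Omega> i u g" using assms(2) by (auto simp: H1_fun_def)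
  show w: "has_weak_pderiv \<Omega> i u (weak_pderiv \<Omega> i u)" by (rule weak_pderiv[OF g(2)])
  show "L2_fun \<Omega> (weak_pderiv \<Omega> i u)"
    using has_weak_pderiv_unique[OF assms(1) g(2) w] by (rule L2_fun_AE[OF assms(1) g(1)])
qed

lemma H1_add:
  assumes "open \<Omega>" "H1_fun \<Omega> u" "H1_fun \<Omega> v"
  shows "H1_fun \<Omega> (u + v)"
    and "AE x in lebesgue_on \<Omega>. weak_pderiv \<Omega> i (u + v) x = weak_pderiv \<Omega> i u x + weak_pderiv \<Omega> i v x"
proof -
  have *: "has_weak_pderiv \<Omega> i (u + v) (\<lambda>x. weak_pderiv \<Omega> i u x + weak_pderiv \<Omega> i v x)" for i
    using has_weak_pderiv_add[OF assms(1) H1_weak_pderiv(1)[OF assms(1,2)] H1_weak_pderiv(1)[OF assms(1,3)]]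
    by (simp add: plus_fun_def)
  then show "H1_fun \<Omega> (u + v)"
    using assms L2_fun_add H1_weak_pderiv(2)[OF assms(1)] unfolding H1_fun_def by (simp add: plus_fun_def) blast
  show "AE x in lebesgue_on \<Omega>. weak_pderiv \<Omega> i (u + v) x = weak_pderiv \<Omega> i u x + weak_pderiv \<Omega> i v x"
    using weak_pderiv_AE[OF assms(1) *] .
qed

lemma H1_scale:
  assumes "open \<Omega>" "H1_fun \<Omega> u"
  shows "H1_fun \<Omega> (c *\<^sub>R u)"
    and "AE x in lebesgue_on \<Omega>. weak_pderiv \<Omega> i (c *\<^sub>R u) x = c * weak_pderiv \<Omega> i u x"
proof -
  have *: "has_weak_pderiv \<Omega> i (c *\<^sub>R u) (\<lambda>x. c * weak_pderiv \<Omega> i u x)" for i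
    using has_weak_pderiv_scale[OF H1_weak_pderiv(1)[OF assms]] by (simp add: scaleR_fun_def)
  then show "H1_fun \<Omega> (c *\<^sub>R u)"
    using assms L2_fun_scale H1_weak_pderiv(2)[OF assms(1)] unfolding H1_fun_def by (simp add: scaleR_fun_def) blast
  show "AE x in lebesgue_on \<Omega>. weak_pderiv \<Omega> i (c *\<^sub>R u) x = c * weak_pderiv \<Omega> i u x"
    using weak_pderiv_AE[OF assms(1) *] .
qed

lemma test_fun_H1:
  assumes "open \<Omega>" "test_fun \<Omega> \<phi>"
  shows "H1_fun \<Omega> \<phi>"
proof -
  obtain K where K: "compact K" "K \<subseteq> \<Omega>" "\<And>x. x \<notin> K \<Longrightarrow> \<phi> x = 0" "\<And>i x. x \<notin> K \<Longrightarrow> pderiv_at i \<phi> x = 0"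
    "continuous_on UNIV \<phi>" "\<phi> differentiable_on UNIV" "\<And>i. continuous_on UNIV (pderiv_at i \<phi>)"
    using test_funE[OF assms(2)] by blast
  have "L2_fun \<Omega> f" if f: "continuous_on UNIV f" "\<And>x. x \<notin> K \<Longrightarrow> f x = 0" for f
  proof -
    have "f \<in> borel_measurable (lebesgue_on \<Omega>)"
      using f(1) by (intro measurable_restrict_space1 measurable_completion)
        (simp add: borel_measurable_continuous_onI)
    moreover have "integrable (lebesgue_on \<Omega>) (\<lambda>x. (f x)\<^sup>2)"
      using L1loc_times_integrable[OF assms(1) L1loc_continuous[OF f(1)] K(1,2) f] by (simp add: power2_eq_square)
    ultimately show ?thesis by (simp add: L2_fun_def)
  qed
  then show ?thesis
    using K test_fun_has_weak_pderiv[OF assms] unfolding H1_fun_def by blast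
qed

lemma zero_H1: "open \<Omega> \<Longrightarrow> H1_fun \<Omega> 0"
  using test_fun_H1[OF _ test_fun_box_bump[of 1 0 \<Omega>]] H1_scale(1)[of \<Omega> _ 0]
  by (metis box_bump_def interval_eq_empty_cart(2) less_numeral_extra(1) empty_subsetI one_index scaleR_zero_left zero_index)


text \<open>The inner product of the norm \<^const>\<open>H1_norm\<close>. The choice of representatives of weak derivatives does
  not affect its value, so it is bilinear.\<close>

definition H1_inner :: "(real^'d) set \<Rightarrow> (real^'d \<Rightarrow> real) \<Rightarrow> (real^'d \<Rightarrow> real) \<Rightarrow> real" where
  "H1_inner \<Omega> u v = L2_inner \<Omega> u v + (\<Sum>i\<in>UNIV. L2_inner \<Omega> (weak_pderiv \<Omega> i u) (weak_pderiv \<Omega> i v))"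

lemma subspace_H1:
  assumes "open \<Omega>"
  shows "subspace {u. H1_fun \<Omega> u}"
  unfolding subspace_def using assms zero_H1 H1_add(1) H1_scale(1) by auto

lemma weak_pderiv_inner_add:
  assumes \<Omega>: "open \<Omega>" and H: "H1_fun \<Omega> u" "H1_fun \<Omega> v" and w: "L2_fun \<Omega> w"
  shows "L2_inner \<Omega> (weak_pderiv \<Omega> i (u + v)) w
    = L2_inner \<Omega> (weak_pderiv \<Omega> i u) w + L2_inner \<Omega> (weak_pderiv \<Omega> i v) w"
proof -
  interpret L2: symmetric_form "{u. L2_fun \<Omega> u}" "L2_inner \<Omega>" by (rule symmetric_form_L2)
  have "L2_inner \<Omega> (weak_pderiv \<Omega> i (u + v)) w = L2_inner \<Omega> (weak_pderiv \<Omega> i u + weak_pderiv \<Omega> i v) w"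
    using H1_weak_pderiv(2)[OF \<Omega> H1_add(1)[OF \<Omega> H]] w H1_add(2)[OF \<Omega> H]
    by (intro L2_inner_AE[OF \<Omega>]) auto
  also have "\<dots> = L2_inner \<Omega> (weak_pderiv \<Omega> i u) w + L2_inner \<Omega> (weak_pderiv \<Omega> i v) w"
    using H1_weak_pderiv(2)[OF \<Omega>] H w by (intro L2.add_left) auto
  finally show ?thesis .
qed

lemma weak_pderiv_inner_scale:
  assumes \<Omega>: "open \<Omega>" and H: "H1_fun \<Omega> u" and w: "L2_fun \<Omega> w"
  shows "L2_inner \<Omega> (weak_pderiv \<Omega> i (c *\<^sub>R u)) w = c * L2_inner \<Omega> (weak_pderiv \<Omega> i u) w"
proof -
  interpret L2: symmetric_form "{u. L2_fun \<Omega> u}" "L2_inner \<Omega>" by (rule symmetric_form_L2)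
  have "L2_inner \<Omega> (weak_pderiv \<Omega> i (c *\<^sub>R u)) w = L2_inner \<Omega> (c *\<^sub>R weak_pderiv \<Omega> i u) w"
    using H1_weak_pderiv(2)[OF \<Omega> H1_scale(1)[OF \<Omega> H]] w H1_scale(2)[OF \<Omega> H]
    by (intro L2_inner_AE[OF \<Omega>]) auto
  also have "\<dots> = c * L2_inner \<Omega> (weak_pderiv \<Omega> i u) w"
    using H1_weak_pderiv(2)[OF \<Omega>] H w by (intro L2.scale_left) auto
  finally show ?thesis .
qed

lemma symmetric_form_H1:
  assumes \<Omega>: "open \<Omega>"
  shows "symmetric_form {u. H1_fun \<Omega> u} (H1_inner \<Omega>)"
proof -
  interpret L2: symmetric_form "{u. L2_fun \<Omega> u}" "L2_inner \<Omega>" by (rule symmetric_form_L2)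
  note W = H1_weak_pderiv(2)[OF \<Omega>]
  have L: "L2_fun \<Omega> u" if "H1_fun \<Omega> u" for u using that by (simp add: H1_fun_def)
  show ?thesis
  proof
    show "H1_inner \<Omega> u v = H1_inner \<Omega> v u" if "u \<in> {u. H1_fun \<Omega> u}" "v \<in> {u. H1_fun \<Omega> u}" for u v
      using that W L unfolding H1_inner_def
      by (intro arg_cong2[where f = "(+)"] sum.cong refl L2.sym) auto
    show "H1_inner \<Omega> (u + v) w = H1_inner \<Omega> u w + H1_inner \<Omega> v w"
      if "u \<in> {u. H1_fun \<Omega> u}" "v \<in> {u. H1_fun \<Omega> u}" "w \<in> {u. H1_fun \<Omega> u}" for u v w
      using that W L \<Omega> by (simp add: H1_inner_def L2.add_left weak_pderiv_inner_add sum.distrib)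
    show "H1_inner \<Omega> (c *\<^sub>R u) w = c * H1_inner \<Omega> u w"
      if "u \<in> {u. H1_fun \<Omega> u}" "w \<in> {u. H1_fun \<Omega> u}" for c u w
      using that W L \<Omega>
      by (simp add: H1_inner_def L2.scale_left weak_pderiv_inner_scale sum_distrib_left distrib_left)
    show "0 \<le> H1_inner \<Omega> u u" if "u \<in> {u. H1_fun \<Omega> u}" for u
      using that W L unfolding H1_inner_def by (intro add_nonneg_nonneg sum_nonneg L2.nonneg) auto
  qed (use \<Omega> in \<open>rule subspace_H1\<close>)
qed

lemma H1_norm_nrm:
  assumes \<Omega>: "open \<Omega>" and u: "H1_fun \<Omega> u"
  shows "H1_norm \<Omega> u = symmetric_form.nrm (H1_inner \<Omega>) u"
proof -
  interpret L2: symmetric_form "{u. L2_fun \<Omega> u}" "L2_inner \<Omega>" by (rule symmetric_form_L2)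
  show ?thesis
    using H1_weak_pderiv(2)[OF \<Omega> u] u L2.nonneg
    by (simp add: H1_norm_def symmetric_form.nrm_def[OF symmetric_form_H1[OF \<Omega>]] H1_inner_def L2_norm_def H1_fun_def)
qed

lemma Ck_fun_lincomb: "Ck_fun n \<phi> \<Longrightarrow> Ck_fun n \<psi> \<Longrightarrow> Ck_fun n (\<lambda>x. c * \<phi> x + \<psi> x)"
proof (induction n arbitrary: \<phi> \<psi>)
  case 0
  then show ?case by (auto intro!: continuous_intros)
next
  case (Suc n)
  then have d: "\<phi> differentiable_on UNIV" "\<psi> differentiable_on UNIV" by auto
  have "pderiv_at i (\<lambda>x. c * \<phi> x + \<psi> x) = (\<lambda>x. c * pderiv_at i \<phi> x + pderiv_at i \<psi> x)" for i
  proof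
    fix x
    have "(\<phi> has_derivative frechet_derivative \<phi> (at x)) (at x)"
      "(\<psi> has_derivative frechet_derivative \<psi> (at x)) (at x)"
      using d by (metis UNIV_I differentiable_on_def frechet_derivative_works)+
    from has_derivative_add[OF has_derivative_mult_right[OF this(1), of c] this(2)]
    show "pderiv_at i (\<lambda>x. c * \<phi> x + \<psi> x) x = c * pderiv_at i \<phi> x + pderiv_at i \<psi> x"
      by (simp add: pderiv_at_def flip: frechet_derivative_at)
  qed
  moreover have "(\<lambda>x. c * \<phi> x + \<psi> x) differentiable_on UNIV"
    using d by (intro differentiable_on_add differentiable_on_mult) auto
  ultimately show ?case using Suc by simp
qed

lemma test_fun_zero: "test_fun \<Omega> (\<lambda>x. 0)"
proof -
  \<comment> \<open>the bump of an empty box is the zero function\<close>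
  have "box_bump 0 1 0 = (\<lambda>x::real^'a. 0)"
    by (rule ext, rule box_bump_zero) (auto simp: mem_box_cart)
  moreover have "cbox 1 0 = ({} :: (real^'a) set)" by (simp add: interval_eq_empty_cart)
  ultimately show ?thesis using test_fun_box_bump[of 1 0 \<Omega> 0] by simp
qed

lemma test_fun_lincomb:
  assumes "test_fun \<Omega> \<phi>" "test_fun \<Omega> \<psi>"
  shows "test_fun \<Omega> (\<lambda>x. c * \<phi> x + \<psi> x)"
proof -
  obtain K K' where "compact K" "K \<subseteq> \<Omega>" "\<And>x. x \<notin> K \<Longrightarrow> \<phi> x = 0"
    "compact K'" "K' \<subseteq> \<Omega>" "\<And>x. x \<notin> K' \<Longrightarrow> \<psi> x = 0"
    using assms unfolding test_fun_def by metis
  then have "compact (K \<union> K')" "K \<union> K' \<subseteq> \<Omega>" "\<forall>x. x \<notin> K \<union> K' \<longrightarrow> c * \<phi> x + \<psi> x = 0" by auto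
  then show ?thesis using assms unfolding test_fun_def by (blast intro: Ck_fun_lincomb)
qed

text \<open>Approximating test functions of two functions combine to approximating test functions of their linear combination, by
  the triangle inequality of the norm of $H^1$.\<close>

lemma subspace_H10:
  fixes \<Omega> :: "(real^'d) set"
  assumes \<Omega>: "open \<Omega>"
  shows "subspace {u. H10_fun \<Omega> u}"
proof -
  interpret H1: symmetric_form "{u. H1_fun \<Omega> u}" "H1_inner \<Omega>" by (rule symmetric_form_H1[OF \<Omega>])
  have lincomb: "H10_fun \<Omega> (c *\<^sub>R u + v)" if u: "H10_fun \<Omega> u" and v: "H10_fun \<Omega> v" for c u v
  proof -
    obtain \<phi> \<psi> where \<phi>: "\<And>n::nat. test_fun \<Omega> (\<phi> n)" "(\<lambda>n. H1_norm \<Omega> (\<lambda>x. \<phi> n x - u x)) \<longlonglongrightarrow> 0"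
      and \<psi>: "\<And>n::nat. test_fun \<Omega> (\<psi> n)" "(\<lambda>n. H1_norm \<Omega> (\<lambda>x. \<psi> n x - v x)) \<longlonglongrightarrow> 0"
      using u v unfolding H10_fun_def by blast
    have H: "H1_fun \<Omega> u" "H1_fun \<Omega> v" using u v by (auto simp: H10_fun_def)
    let ?\<chi> = "\<lambda>n x. c * \<phi> n x + \<psi> n x"
    have diffs: "\<phi> n - u \<in> {u. H1_fun \<Omega> u}" "\<psi> n - v \<in> {u. H1_fun \<Omega> u}" for n
      using H1.closed(4) H test_fun_H1[OF \<Omega>] \<phi>(1) \<psi>(1) by auto
    have le: "H1_norm \<Omega> (\<lambda>x. ?\<chi> n x - (c *\<^sub>R u + v) x)
        \<le> \<bar>c\<bar> * H1_norm \<Omega> (\<lambda>x. \<phi> n x - u x) + H1_norm \<Omega> (\<lambda>x. \<psi> n x - v x)" (is "?l n \<le> ?r n") for n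
    proof -
      have eq: "(\<lambda>x. ?\<chi> n x - (c *\<^sub>R u + v) x) = c *\<^sub>R (\<phi> n - u) + (\<psi> n - v)"
        by (auto simp: fun_eq_iff algebra_simps)
      have eqs: "(\<lambda>x. \<phi> n x - u x) = \<phi> n - u" "(\<lambda>x. \<psi> n x - v x) = \<psi> n - v"
        by (auto simp: fun_eq_iff)
      have m: "c *\<^sub>R (\<phi> n - u) + (\<psi> n - v) \<in> {u. H1_fun \<Omega> u}"
        by (intro H1.closed diffs)
      have "H1.nrm (c *\<^sub>R (\<phi> n - u) + (\<psi> n - v)) \<le> H1.nrm (c *\<^sub>R (\<phi> n - u)) + H1.nrm (\<psi> n - v)"
        by (intro H1.nrm_triangle H1.closed(3) diffs)
      also have "H1.nrm (c *\<^sub>R (\<phi> n - u)) = \<bar>c\<bar> * H1.nrm (\<phi> n - u)"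
        by (intro H1.nrm_scale diffs)
      finally show ?thesis
        unfolding eq eqs using m diffs by (simp only: mem_Collect_eq H1_norm_nrm[OF \<Omega>])
    qed
    have "(\<lambda>n. ?l n) \<longlonglongrightarrow> 0"
    proof (rule tendsto_sandwich[of "\<lambda>_. 0" _ _ ?r])
      have "?r \<longlonglongrightarrow> \<bar>c\<bar> * 0 + 0" by (intro tendsto_intros \<phi> \<psi>)
      then show "?r \<longlonglongrightarrow> 0" by simp
    qed (use le in \<open>auto simp: H1_norm_def intro!: always_eventually add_nonneg_nonneg sum_nonneg\<close>)
    moreover have "\<And>n. test_fun \<Omega> (?\<chi> n)" using \<phi>(1) \<psi>(1) by (rule test_fun_lincomb)
    moreover have "c *\<^sub>R u + v \<in> {u. H1_fun \<Omega> u}" using H by (intro H1.closed) auto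
    ultimately show ?thesis unfolding H10_fun_def by (intro conjI exI[of _ ?\<chi>] allI) (simp_all only: mem_Collect_eq)
  qed
  have zero: "H10_fun \<Omega> 0"
  proof -
    have "(\<lambda>n::nat. H1_norm \<Omega> (\<lambda>x. 0 - (0 :: real^'d \<Rightarrow> real) x)) = (\<lambda>n. H1.nrm 0)"
      using zero_H1[OF \<Omega>] by (subst H1_norm_nrm[OF \<Omega>]) (auto simp: zero_fun_def)
    also have "H1.nrm 0 = 0" using H1.zero_left[of 0] zero_H1[OF \<Omega>] by (simp add: H1.nrm_def)
    finally show ?thesis
      unfolding H10_fun_def using zero_H1[OF \<Omega>] test_fun_zero[of \<Omega>]
      by (auto intro!: exI[of _ "\<lambda>n x. 0"])
  qed
  show ?thesis
    unfolding subspace_def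
  proof (intro conjI ballI allI)
    show "u + v \<in> {u. H10_fun \<Omega> u}" if "u \<in> {u. H10_fun \<Omega> u}" "v \<in> {u. H10_fun \<Omega> u}" for u v
      using lincomb[of u v 1] that by simp
    show "c *\<^sub>R u \<in> {u. H10_fun \<Omega> u}" if "u \<in> {u. H10_fun \<Omega> u}" for c u
      using lincomb[of u 0 c] that zero by simp
  qed (use zero in simp)
qed

section \<open>The finite element space\<close>

lemma poly_deg_le_lincomb:
  assumes "poly_deg_le r q" "poly_deg_le r q'"
  shows "poly_deg_le r (\<lambda>x. c * q x + q' x)"
proof -
  obtain C C' where "\<forall>x. q x = (\<Sum>\<nu> | (\<Sum>i\<in>UNIV. \<nu> i) \<le> r. C \<nu> * (\<Prod>i\<in>UNIV. (x $ i) ^ \<nu> i))"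
    "\<forall>x. q' x = (\<Sum>\<nu> | (\<Sum>i\<in>UNIV. \<nu> i) \<le> r. C' \<nu> * (\<Prod>i\<in>UNIV. (x $ i) ^ \<nu> i))"
    using assms unfolding poly_deg_le_def by blast
  then show ?thesis
    unfolding poly_deg_le_def
    by (intro exI[of _ "\<lambda>\<nu>. c * C \<nu> + C' \<nu>"])
      (simp add: sum_distrib_left sum.distrib distrib_right mult.assoc)
qed

lemma poly_deg_le_zero: "poly_deg_le r (\<lambda>x. 0)"
  unfolding poly_deg_le_def by (intro exI[of _ "\<lambda>_. 0"]) simp

lemma finite_multi_indices: "finite {\<nu> :: 'd::finite \<Rightarrow> nat. (\<Sum>i\<in>UNIV. \<nu> i) \<le> r}"
proof (rule finite_subset)
  show "{\<nu> :: 'd \<Rightarrow> nat. (\<Sum>i\<in>UNIV. \<nu> i) \<le> r} \<subseteq> (\<Pi>\<^sub>E i\<in>UNIV. {..r})"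
  proof
    fix \<nu> :: "'d \<Rightarrow> nat" assume "\<nu> \<in> {\<nu>. (\<Sum>i\<in>UNIV. \<nu> i) \<le> r}"
    moreover have "\<nu> i \<le> (\<Sum>i\<in>UNIV. \<nu> i)" for i by (rule member_le_sum) auto
    ultimately have "\<nu> i \<le> r" for i using le_trans by blast
    then show "\<nu> \<in> (\<Pi>\<^sub>E i\<in>UNIV. {..r})" by auto
  qed
  show "finite (\<Pi>\<^sub>E i\<in>(UNIV :: 'd set). {..r})" by (intro finite_PiE) auto
qed

lemma continuous_poly_deg_le:
  fixes q :: "real^'d \<Rightarrow> real"
  shows "poly_deg_le r q \<Longrightarrow> continuous_on UNIV q"
  unfolding poly_deg_le_def
proof (elim exE)
  fix C :: "('d \<Rightarrow> nat) \<Rightarrow> real" assume q: "\<forall>x. q x = (\<Sum>\<nu> | (\<Sum>i\<in>UNIV. \<nu> i) \<le> r. C \<nu> * (\<Prod>i\<in>UNIV. (x $ i) ^ \<nu> i))"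
  have "continuous_on UNIV (\<lambda>x::real^'d. \<Sum>\<nu> | (\<Sum>i\<in>UNIV. \<nu> i) \<le> r. C \<nu> * (\<Prod>i\<in>UNIV. (x $ i) ^ \<nu> i))"
    by (intro continuous_intros)
  then show "continuous_on UNIV q" using q by (simp add: fun_eq_iff cong: continuous_on_cong)
qed

lemma subspace_fe_space:
  assumes "open \<Omega>"
  shows "subspace (fe_space \<Omega> \<T> r)"
proof -
  have lincomb: "c *\<^sub>R u + v \<in> fe_space \<Omega> \<T> r" if "u \<in> fe_space \<Omega> \<T> r" "v \<in> fe_space \<Omega> \<T> r" for c u v
  proof -
    have "c *\<^sub>R u + v \<in> {u. H10_fun \<Omega> u}"
      using subspace_H10[OF assms] that by (intro subspace_add subspace_scale) (auto simp: fe_space_def)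
    moreover have "\<exists>q. poly_deg_le r q \<and> (\<forall>x\<in>\<tau>. (c *\<^sub>R u + v) x = q x)" if \<tau>: "\<tau> \<in> \<T>" for \<tau>
    proof -
      obtain q q' where "poly_deg_le r q" "\<forall>x\<in>\<tau>. u x = q x" "poly_deg_le r q'" "\<forall>x\<in>\<tau>. v x = q' x"
        using \<tau> \<open>u \<in> _\<close> \<open>v \<in> _\<close> unfolding fe_space_def by blast
      then show ?thesis
        by (intro exI[of _ "\<lambda>x. c * q x + q' x"]) (auto intro: poly_deg_le_lincomb)
    qed
    ultimately show ?thesis using that by (auto simp: fe_space_def)
  qed
  have zero: "0 \<in> fe_space \<Omega> \<T> r"
    using subspace_0[OF subspace_H10[OF assms]] poly_deg_le_zero[of r] by (auto simp: fe_space_def)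
  show ?thesis
    unfolding subspace_def
  proof (intro conjI ballI allI)
    show "u + v \<in> fe_space \<Omega> \<T> r" if "u \<in> fe_space \<Omega> \<T> r" "v \<in> fe_space \<Omega> \<T> r" for u v
      using lincomb[of u v 1] that by simp
    show "c *\<^sub>R u \<in> fe_space \<Omega> \<T> r" if "u \<in> fe_space \<Omega> \<T> r" for c u
      using lincomb[of u 0 c] that zero by simp
  qed (rule zero)
qed

text \<open>Every point of the domain is assigned to one of the elements that contain it. The monomials cut off to the sets of
  points assigned to one element are discontinuous, but they span a space that contains all finite element functions.\<close>

lemma finite_span_fe_space:
  fixes \<Omega> :: "(real^'d) set"
  assumes \<T>: "conformal_triangulation \<Omega> \<T>"
  shows "\<exists>S. finite S \<and> fe_space \<Omega> \<T> r \<subseteq> span S"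
proof -
  have fin: "finite \<T>" and cover: "\<Union>\<T> = closure \<Omega>"
    using \<T> by (auto simp: conformal_triangulation_def triangulation_def)
  \<comment> \<open>the element to which a point is assigned\<close>
  define \<sigma> where "\<sigma> x = (SOME \<tau>. \<tau> \<in> \<T> \<and> x \<in> \<tau>)" for x
  have \<sigma>: "\<sigma> x \<in> \<T>" "x \<in> \<sigma> x" if "x \<in> \<Omega>" for x
  proof -
    have "\<exists>\<tau>. \<tau> \<in> \<T> \<and> x \<in> \<tau>" using cover closure_subset[of \<Omega>] that by blast
    from someI_ex[OF this] show "\<sigma> x \<in> \<T>" "x \<in> \<sigma> x" by (auto simp: \<sigma>_def)
  qed
  define N where "N = {\<nu> :: 'd \<Rightarrow> nat. (\<Sum>i\<in>UNIV. \<nu> i) \<le> r}"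
  define b where "b \<tau> \<nu> x = (if x \<in> \<Omega> \<and> \<sigma> x = \<tau> then \<Prod>i\<in>UNIV. (x $ i) ^ \<nu> i else 0)"
    for \<tau> and \<nu> :: "'d \<Rightarrow> nat" and x :: "real^'d"
  let ?S = "(\<lambda>(\<tau>, \<nu>). b \<tau> \<nu>) ` (\<T> \<times> N)"
  have "v \<in> span ?S" if v: "v \<in> fe_space \<Omega> \<T> r" for v
  proof -
    have "\<exists>C. \<forall>x\<in>\<tau>. v x = (\<Sum>\<nu>\<in>N. C \<nu> * (\<Prod>i\<in>UNIV. (x $ i) ^ \<nu> i))" if "\<tau> \<in> \<T>" for \<tau>
      using v that unfolding fe_space_def poly_deg_le_def N_def by fastforce
    then obtain C where C: "\<And>\<tau> x. \<tau> \<in> \<T> \<Longrightarrow> x \<in> \<tau> \<Longrightarrow> v x = (\<Sum>\<nu>\<in>N. C \<tau> \<nu> * (\<Prod>i\<in>UNIV. (x $ i) ^ \<nu> i))"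
      by metis
    have "v = (\<Sum>\<tau>\<in>\<T>. \<Sum>\<nu>\<in>N. C \<tau> \<nu> *\<^sub>R b \<tau> \<nu>)"
    proof
      fix x
      show "v x = (\<Sum>\<tau>\<in>\<T>. \<Sum>\<nu>\<in>N. C \<tau> \<nu> *\<^sub>R b \<tau> \<nu>) x"
      proof (cases "x \<in> \<Omega>")
        case True
        have "(\<Sum>\<tau>\<in>\<T>. \<Sum>\<nu>\<in>N. C \<tau> \<nu> *\<^sub>R b \<tau> \<nu>) x
            = (\<Sum>\<tau>\<in>\<T>. if \<tau> = \<sigma> x then \<Sum>\<nu>\<in>N. C \<tau> \<nu> * (\<Prod>i\<in>UNIV. (x $ i) ^ \<nu> i) else 0)"
          unfolding sum_fun_apply using True by (intro sum.cong refl) (auto simp: b_def)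
        also have "\<dots> = (\<Sum>\<nu>\<in>N. C (\<sigma> x) \<nu> * (\<Prod>i\<in>UNIV. (x $ i) ^ \<nu> i))"
          using fin \<sigma>(1)[OF True] by simp
        also have "\<dots> = v x" by (rule C[OF \<sigma>[OF True], symmetric])
        finally show ?thesis by simp
      next
        case False
        then show ?thesis using v by (simp add: sum_fun_apply b_def fe_space_def)
      qed
    qed
    also have "\<dots> \<in> span ?S"
      by (intro span_sum span_scale span_base) auto
    finally show ?thesis .
  qed
  moreover have "finite ?S" using fin finite_multi_indices[of r] by (auto simp: N_def)
  ultimately show ?thesis by blast
qed

text \<open>A function with vanishing norm vanishes almost everywhere. If it did not vanish at some point of an element, then it
  would not vanish on a non-empty open subset of the interior of that element, since elements are closures of their
  interiors and the function is continuous on them.\<close>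

lemma fe_space_definite:
  fixes \<Omega> :: "(real^'d) set"
  assumes \<Omega>: "open \<Omega>" and \<T>: "conformal_triangulation \<Omega> \<T>" and v: "v \<in> fe_space \<Omega> \<T> r"
    and 0: "L2_inner \<Omega> v v = 0"
  shows "v = 0"
proof -
  have L2: "L2_fun \<Omega> v" using v by (auto simp: fe_space_def H10_fun_def H1_fun_def)
  have "AE x in lebesgue_on \<Omega>. (v x)\<^sup>2 = 0"
    using 0 L2 by (subst integral_nonneg_eq_0_iff_AE[symmetric])
      (auto simp: L2_inner_def L2_fun_def power2_eq_square)
  then have "AE x in lebesgue. x \<in> \<Omega> \<longrightarrow> v x = 0" using \<Omega> by (simp add: AE_restrict_space_iff)
  then obtain Z where Z: "Z \<in> null_sets lebesgue" "\<And>x. x \<in> \<Omega> \<Longrightarrow> x \<notin> Z \<Longrightarrow> v x = 0"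
    unfolding completion.AE_iff_null_sets by auto
  have "v x = 0" if x: "x \<in> \<Omega>" for x
  proof (rule ccontr)
    assume vx: "v x \<noteq> 0"
    have "x \<in> \<Union>\<T>"
      using \<T> closure_subset[of \<Omega>] x unfolding conformal_triangulation_def by blast
    then obtain \<tau> where \<tau>: "\<tau> \<in> \<T>" "x \<in> \<tau>" by blast
    have simplex: "int CARD('d) simplex \<tau>" using \<T> \<tau> by (auto simp: conformal_triangulation_def)
    obtain q where q: "poly_deg_le r q" "\<forall>y\<in>\<tau>. v y = q y" using v \<tau> by (auto simp: fe_space_def)
    have "interior \<tau> = rel_interior \<tau>"
      using aff_dim_simplex[OF simplex] by (simp add: interior_rel_interior_gen)
    then have "interior \<tau> \<noteq> {}"
      using rel_interior_eq_empty[OF convex_simplex[OF simplex]] \<tau> by auto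
    then have cl: "closure (interior \<tau>) = \<tau>"
      using convex_closure_interior[OF convex_simplex[OF simplex]] closed_simplex[OF simplex] by simp
    have openq: "open {y. q y \<noteq> 0}"
      using continuous_poly_deg_le[OF q(1)] by (intro open_Collect_neq) auto
    let ?U = "{y. q y \<noteq> 0} \<inter> \<Omega>"
    have "open ?U" "x \<in> ?U" using openq \<Omega> x vx q \<tau> by auto
    then have ne: "?U \<inter> interior \<tau> \<noteq> {}"
      using open_Int_closure_eq_empty[of ?U "interior \<tau>"] cl \<tau> by blast
    have "?U \<inter> interior \<tau> \<subseteq> Z"
      using Z(2) q(2) interior_subset[of \<tau>] by fastforce
    then have "negligible (?U \<inter> interior \<tau>)"
      using Z(1) negligible_subset by (auto simp: negligible_iff_null_sets[symmetric])
    moreover have "open (?U \<inter> interior \<tau>)" using openq \<Omega> by auto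
    ultimately show False using ne open_not_negligible by blast
  qed
  moreover have "v x = 0" if "x \<notin> \<Omega>" for x using v that by (simp add: fe_space_def)
  ultimately show ?thesis by (auto simp: fun_eq_iff)
qed

lemma fe_space_H1: "v \<in> fe_space \<Omega> \<T> r \<Longrightarrow> H1_fun \<Omega> v"
  by (auto simp: fe_space_def H10_fun_def)

lemma finite_inner_product_fe_space:
  assumes \<Omega>: "open \<Omega>" and \<T>: "conformal_triangulation \<Omega> \<T>"
  shows "finite_inner_product (fe_space \<Omega> \<T> r) (L2_inner \<Omega>)"
proof -
  interpret L2: symmetric_form "{u. L2_fun \<Omega> u}" "L2_inner \<Omega>" by (rule symmetric_form_L2)
  interpret symmetric_form "fe_space \<Omega> \<T> r" "L2_inner \<Omega>"
    by (rule L2.on_subspace[OF subspace_fe_space[OF \<Omega>]]) (auto dest: fe_space_H1 simp: H1_fun_def)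
  show ?thesis
    by unfold_locales (use fe_space_definite[OF \<Omega> \<T>] finite_span_fe_space[OF \<T>] in auto)
qed

section \<open>The modulus of continuity\<close>

text \<open>The primitive of the kernel in the consistency error. Its total increment is finite by assumption on the modulus.\<close>

definition modulus_primitive :: "(real \<Rightarrow> real) \<Rightarrow> real \<Rightarrow> real" where
  "modulus_primitive \<omega> s = (LINT r:{0<..s}|lebesgue. \<omega> r * r powr (-3/2))"

lemma modulus_primitive_increment:
  assumes \<omega>: "admissible_modulus T \<omega>" and ab: "0 \<le> b" "b < a" "a \<le> T"
  shows "(a - b) * (\<omega> a * a powr (-3/2)) \<le> modulus_primitive \<omega> a - modulus_primitive \<omega> b"
proof -
  let ?\<phi> = "\<lambda>s. \<omega> s * s powr (-3/2)"
  have int: "set_integrable lebesgue {0<..T} ?\<phi>"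
    using \<omega> unfolding admissible_modulus_def set_integrable_def by (simp add: integrable_restrict_space)
  have si: "set_integrable lebesgue {c<..d} ?\<phi>" if "0 \<le> c" "d \<le> T" for c d
    by (rule set_integrable_subset[OF int]) (use that in auto)
  have "modulus_primitive \<omega> a = modulus_primitive \<omega> b + (LINT r:{b<..a}|lebesgue. ?\<phi> r)"
  proof -
    have "{0<..a} = {0<..b} \<union> {b<..a}" using ab by auto
    then show ?thesis
      unfolding modulus_primitive_def using ab si
      by (simp add: set_integral_Un)
  qed
  moreover have "(LINT r:{b<..a}|lebesgue. ?\<phi> a) \<le> (LINT r:{b<..a}|lebesgue. ?\<phi> r)"
  proof (rule set_integral_mono)
    show "set_integrable lebesgue {b<..a} (\<lambda>r. ?\<phi> a)"
      unfolding set_integrable_def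
      by (intro integrable_scaleR_left integrable_real_indicator) (use ab in auto)
    show "set_integrable lebesgue {b<..a} ?\<phi>" using ab by (intro si) auto
    show "?\<phi> a \<le> ?\<phi> r" if "r \<in> {b<..a}" for r
    proof -
      have "antimono_on {0<..T} (\<lambda>s. \<omega> s / s powr (3/2))"
        using \<omega> by (simp add: admissible_modulus_def)
      then have "\<omega> a / a powr (3/2) \<le> \<omega> r / r powr (3/2)"
        by (rule monotone_onD) (use that ab in auto)
      then show ?thesis by (simp add: powr_minus_divide)
    qed
  qed
  moreover have "(LINT r:{b<..a}|lebesgue. ?\<phi> a) = (a - b) * ?\<phi> a"
    unfolding set_lebesgue_integral_def using ab by simp
  ultimately show ?thesis by linarith
qed

text \<open>Compare the integral over \<open>(0, s]\<close> with the value of the non-increasing integrand at \<open>s\<close>.\<close>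

lemma modulus_le_sqrt:
  assumes \<omega>: "admissible_modulus T \<omega>" and s: "0 < s" "s \<le> T"
  shows "\<omega> s \<le> (modulus_primitive \<omega> T - modulus_primitive \<omega> 0) * sqrt s"
proof -
  have nonneg: "0 \<le> \<omega> a" if "0 \<le> a" "a \<le> T" for a using \<omega> that by (auto simp: admissible_modulus_def)
  have "modulus_primitive \<omega> s \<le> modulus_primitive \<omega> T"
  proof (cases "s = T")
    case False
    then have "0 \<le> (T - s) * (\<omega> T * T powr (-3/2))" using s nonneg[of T] by auto
    also have "\<dots> \<le> modulus_primitive \<omega> T - modulus_primitive \<omega> s"
      using s False by (intro modulus_primitive_increment[OF \<omega>]) auto
    finally show ?thesis by simp
  qed simp
  then have "s * (\<omega> s * s powr (-3/2)) \<le> modulus_primitive \<omega> T - modulus_primitive \<omega> 0"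
    using modulus_primitive_increment[OF \<omega>, of 0 s] s by simp
  then have "s * (\<omega> s * s powr (-3/2)) * sqrt s \<le> (modulus_primitive \<omega> T - modulus_primitive \<omega> 0) * sqrt s"
    using s by (intro mult_right_mono) auto
  moreover have "s * (\<omega> s * s powr (-3/2)) * sqrt s = \<omega> s"
  proof -
    have "s * (\<omega> s * s powr (-3/2)) * sqrt s = \<omega> s * (s powr 1 * s powr (-3/2) * s powr (1/2))"
      using s by (simp add: powr_half_sqrt mult_ac)
    also have "s powr 1 * s powr (-3/2) * s powr (1/2) = s powr (1 + (-3/2) + 1/2)"
      by (simp only: powr_add)
    also have "\<dots> = 1" using s by simp
    finally show ?thesis by simp
  qed
  ultimately show ?thesis by linarith
qed

lemma modulus_tendsto_0:
  assumes \<omega>: "admissible_modulus T \<omega>" and "T > 0"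
    and d: "d \<longlonglongrightarrow> 0" "\<And>n::nat. 0 \<le> d n \<and> d n \<le> T"
  shows "(\<lambda>n. \<omega> (d n)) \<longlonglongrightarrow> 0"
proof -
  let ?J = "modulus_primitive \<omega> T - modulus_primitive \<omega> 0"
  have nonneg: "0 \<le> \<omega> a" if "0 \<le> a" "a \<le> T" for a using \<omega> that by (auto simp: admissible_modulus_def)
  have \<omega>0: "\<omega> 0 = 0"
  proof -
    have "(\<lambda>n. ?J * sqrt (T * inverse (real (Suc n)))) \<longlonglongrightarrow> ?J * sqrt (T * 0)"
      by (intro tendsto_intros LIMSEQ_inverse_real_of_nat)
    moreover have "\<omega> 0 \<le> ?J * sqrt (T * inverse (real (Suc n)))" for n
    proof -
      let ?s = "T * inverse (real (Suc n))"
      have s: "0 < ?s" "?s \<le> T" using \<open>T > 0\<close> by (auto simp: field_simps)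
      have "mono_on {0..T} \<omega>" using \<omega> by (simp add: admissible_modulus_def)
      then have "\<omega> 0 \<le> \<omega> ?s" by (rule monotone_onD) (use s in auto)
      also have "\<dots> \<le> ?J * sqrt ?s" by (rule modulus_le_sqrt[OF \<omega> s])
      finally show ?thesis .
    qed
    ultimately have "\<omega> 0 \<le> 0" using LIMSEQ_le_const by fastforce
    then show ?thesis using nonneg[of 0] \<open>T > 0\<close> by simp
  qed
  have J: "0 \<le> ?J"
    using modulus_primitive_increment[OF \<omega>, of 0 T] nonneg[of T] \<open>T > 0\<close>
    by (smt (verit) mult_nonneg_nonneg powr_ge_zero)
  have le: "\<omega> (d n) \<le> ?J * sqrt (d n)" for n
    using modulus_le_sqrt[OF \<omega>, of "d n"] d(2)[of n] \<omega>0 J by (cases "d n = 0") auto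
  show ?thesis
  proof (rule tendsto_sandwich[of "\<lambda>_. 0" _ _ "\<lambda>n. ?J * sqrt (d n)"])
    have "(\<lambda>n. ?J * sqrt (d n)) \<longlonglongrightarrow> ?J * sqrt 0" by (intro tendsto_intros d)
    then show "(\<lambda>n. ?J * sqrt (d n)) \<longlonglongrightarrow> 0" by simp
  qed (use le nonneg d in auto)
qed

section \<open>Coefficients at every single time\<close>

text \<open>The properties of the coefficients at one instant, in the form in which the bilinear form at that instant needs them;
  ellipticity holds outside one null set for all directions at once.\<close>

definition good_coeffs :: "(real^'d) set \<Rightarrow> real \<Rightarrow> real \<Rightarrow> ('d \<Rightarrow> 'd \<Rightarrow> real^'d \<Rightarrow> real) \<Rightarrow> bool" where
  "good_coeffs \<Omega> \<alpha> K b \<longleftrightarrow>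
     (\<forall>i j. b i j \<in> borel_measurable (lebesgue_on \<Omega>)) \<and>
     (AE x in lebesgue_on \<Omega>. (\<forall>i j. \<bar>b i j x\<bar> \<le> K \<and> b i j x = b j i x) \<and>
        (\<forall>\<xi>::real^'d. \<alpha> * (norm \<xi>)\<^sup>2 \<le> (\<Sum>i\<in>UNIV. \<Sum>j\<in>UNIV. b i j x * \<xi> $ i * \<xi> $ j)))"

lemma AE_all2:
  fixes P :: "'i::countable \<Rightarrow> 'j::countable \<Rightarrow> 'a \<Rightarrow> bool"
  shows "(\<And>i j. AE x in M. P i j x) \<Longrightarrow> AE x in M. \<forall>i j. P i j x"
  by (simp add: AE_all_countable)

text \<open>Lebesgue measure on the product is the completion of the product of Borel measures, for which Fubini's theorem
  applies.\<close>

lemma AE_space_time: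
  fixes \<Omega> :: "'a::euclidean_space set" and J :: "real set"
  assumes "open \<Omega>" "open J" and AE: "AE (t, x) in lebesgue_on (J \<times> \<Omega>). P t x"
  shows "AE t in lborel. t \<in> J \<longrightarrow> (AE x in lborel. x \<in> \<Omega> \<longrightarrow> P t x)"
proof -
  have "AE z in lebesgue. z \<in> J \<times> \<Omega> \<longrightarrow> P (fst z) (snd z)"
    using AE assms(1,2) by (simp add: AE_restrict_space_iff open_Times case_prod_beta)
  then have "AE z in lborel \<Otimes>\<^sub>M lborel. z \<in> J \<times> \<Omega> \<longrightarrow> P (fst z) (snd z)"
    unfolding lborel_prod by (simp add: AE_completion_iff)
  then have "AE t in lborel. AE x in lborel. (t, x) \<in> J \<times> \<Omega> \<longrightarrow> P t x"
    by (auto dest: lborel_pair.AE_pair)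
  then show ?thesis by eventually_elim auto
qed

lemma measurable_space_time:
  fixes \<Omega> :: "(real^'d) set" and J :: "real set" and f :: "real \<Rightarrow> real^'d \<Rightarrow> real"
  assumes "open \<Omega>" "open J" and f: "(\<lambda>(t, x). f t x) \<in> borel_measurable (lebesgue_on (J \<times> \<Omega>))"
  shows "AE t in lborel. t \<in> J \<longrightarrow> f t \<in> borel_measurable (lebesgue_on \<Omega>)"
proof -
  let ?F = "\<lambda>z. indicat_real (J \<times> \<Omega>) z *\<^sub>R (case z of (t, x) \<Rightarrow> f t x)"
  have "?F \<in> borel_measurable lebesgue"
    using f assms(1,2) by (simp add: borel_measurable_restrict_space_iff open_Times)
  then obtain g where g: "g \<in> borel_measurable lborel" and AE: "AE z in lborel. ?F z = g z"
    using completion_ex_borel_measurable_real by blast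
  have "AE z in lborel \<Otimes>\<^sub>M lborel. ?F z = g z" using AE unfolding lborel_prod .
  then have "AE t in lborel. AE x in lborel. ?F (t, x) = g (t, x)"
    by (rule lborel_pair.AE_pair)
  then show ?thesis
  proof eventually_elim
    case (elim t)
    show ?case
    proof
      assume t: "t \<in> J"
      have "g \<in> borel_measurable (borel \<Otimes>\<^sub>M borel)" using g by (simp add: borel_prod)
      then have "(\<lambda>x. g (t, x)) \<in> borel_measurable borel" by measurable
      then have "(\<lambda>x. g (t, x)) \<in> borel_measurable (lebesgue_on \<Omega>)"
        by (intro measurable_restrict_space1 measurable_completion) simp
      moreover have "AE x in lebesgue. ?F (t, x) = g (t, x)" using elim by (rule AE_completion)
      then have "AE x in lebesgue_on \<Omega>. g (t, x) = f t x"
        using t assms(1) by (auto simp: AE_restrict_space_iff indicator_def)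
      ultimately show "f t \<in> borel_measurable (lebesgue_on \<Omega>)"
        using assms(1) by (auto intro: borel_measurable_lebesgue_on_AE[rotated])
    qed
  qed
qed

lemma quadratic_form_dense:
  fixes b :: "'d::finite \<Rightarrow> 'd \<Rightarrow> real" and D :: "(real^'d) set"
  assumes D: "closure D = UNIV"
    and le: "\<And>\<xi>. \<xi> \<in> D \<Longrightarrow> \<alpha> * (norm \<xi>)\<^sup>2 \<le> (\<Sum>i\<in>UNIV. \<Sum>j\<in>UNIV. b i j * \<xi> $ i * \<xi> $ j)"
  shows "\<alpha> * (norm \<xi>)\<^sup>2 \<le> (\<Sum>i\<in>UNIV. \<Sum>j\<in>UNIV. b i j * \<xi> $ i * \<xi> $ j)"
proof -
  have "closed {\<xi>::real^'d. \<alpha> * (norm \<xi>)\<^sup>2 \<le> (\<Sum>i\<in>UNIV. \<Sum>j\<in>UNIV. b i j * \<xi> $ i * \<xi> $ j)}"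
    by (intro closed_Collect_le continuous_intros)
  then have "closure D \<subseteq> {\<xi>. \<alpha> * (norm \<xi>)\<^sup>2 \<le> (\<Sum>i\<in>UNIV. \<Sum>j\<in>UNIV. b i j * \<xi> $ i * \<xi> $ j)}"
    by (rule closure_minimal[rotated]) (use le in auto)
  then show ?thesis using D by auto
qed

text \<open>Fubini's theorem gives all properties at almost every time. Ellipticity passes from a countable dense set of
  directions to all directions by continuity.\<close>

lemma good_coeffs_AE:
  fixes \<Omega> :: "(real^'d) set"
  assumes \<Omega>: "open \<Omega>" and a: "admissible_coeffs \<Omega> T a \<alpha> \<omega>"
  obtains K where "K \<ge> 0" "AE t in lborel. t \<in> {0<..<T} \<longrightarrow> good_coeffs \<Omega> \<alpha> K (\<lambda>i j. a i j t)"
proof -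
  have bd: "\<forall>i j. \<exists>B. AE (t, x) in lebesgue_on ({0<..<T} \<times> \<Omega>). \<bar>a i j t x\<bar> \<le> B"
    using a by (simp add: admissible_coeffs_def)
  then obtain B where B: "\<And>i j. AE (t, x) in lebesgue_on ({0<..<T} \<times> \<Omega>). \<bar>a i j t x\<bar> \<le> B i j" by metis
  define K where "K = (\<Sum>i\<in>UNIV. \<Sum>j\<in>UNIV. \<bar>B i j\<bar>)"
  have BK: "B i j \<le> K" for i j
  proof -
    have "\<bar>B i j\<bar> \<le> (\<Sum>j\<in>UNIV. \<bar>B i j\<bar>)" by (rule member_le_sum) auto
    also have "\<dots> \<le> K" unfolding K_def by (rule member_le_sum[of i UNIV "\<lambda>i. \<Sum>j\<in>UNIV. \<bar>B i j\<bar>"]) (auto intro: sum_nonneg)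
    finally show ?thesis by simp
  qed
  obtain D :: "(real^'d) set" where D: "countable D" "closure D = UNIV"
    using separable[of "UNIV :: (real^'d) set"] by (metis UNIV_I closure_UNIV subset_UNIV top.extremum_uniqueI)
  have J: "open {0<..<T}" by simp
  have "AE t in lborel. \<forall>i j. t \<in> {0<..<T} \<longrightarrow> a i j t \<in> borel_measurable (lebesgue_on \<Omega>)"
    by (intro AE_all2 measurable_space_time[OF \<Omega> J]) (use a in \<open>simp add: admissible_coeffs_def\<close>)
  moreover have "AE t in lborel. \<forall>i j. t \<in> {0<..<T} \<longrightarrow> (AE x in lborel. x \<in> \<Omega> \<longrightarrow> \<bar>a i j t x\<bar> \<le> B i j)"
    by (intro AE_all2 AE_space_time[OF \<Omega> J B])
  moreover have "AE t in lborel. \<forall>i j. t \<in> {0<..<T} \<longrightarrow> (AE x in lborel. x \<in> \<Omega> \<longrightarrow> a i j t x = a j i t x)"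
    by (intro AE_all2 AE_space_time[OF \<Omega> J]) (use a in \<open>simp add: admissible_coeffs_def\<close>)
  moreover have "AE t in lborel. \<forall>\<xi>\<in>D. t \<in> {0<..<T} \<longrightarrow> (AE x in lborel. x \<in> \<Omega> \<longrightarrow>
      \<alpha> * (norm \<xi>)\<^sup>2 \<le> (\<Sum>i\<in>UNIV. \<Sum>j\<in>UNIV. a i j t x * \<xi> $ i * \<xi> $ j))"
    by (intro AE_ball_countable' D(1) AE_space_time[OF \<Omega> J]) (use a in \<open>simp add: admissible_coeffs_def\<close>)
  ultimately have "AE t in lborel. t \<in> {0<..<T} \<longrightarrow> good_coeffs \<Omega> \<alpha> K (\<lambda>i j. a i j t)"
  proof eventually_elim
    case (elim t)
    show ?case
    proof
      assume t: "t \<in> {0<..<T}"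
      have "AE x in lborel. \<forall>i j. x \<in> \<Omega> \<longrightarrow> \<bar>a i j t x\<bar> \<le> B i j"
        by (intro AE_all2) (use elim(2) t in blast)
      moreover have "AE x in lborel. \<forall>i j. x \<in> \<Omega> \<longrightarrow> a i j t x = a j i t x"
        by (intro AE_all2) (use elim(3) t in blast)
      moreover have "AE x in lborel. \<forall>\<xi>\<in>D. x \<in> \<Omega> \<longrightarrow>
          \<alpha> * (norm \<xi>)\<^sup>2 \<le> (\<Sum>i\<in>UNIV. \<Sum>j\<in>UNIV. a i j t x * \<xi> $ i * \<xi> $ j)"
        by (intro AE_ball_countable' D(1)) (use elim(4) t in blast)
      ultimately have "AE x in lborel. x \<in> \<Omega> \<longrightarrow> (\<forall>i j. \<bar>a i j t x\<bar> \<le> K \<and> a i j t x = a j i t x) \<and>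
        (\<forall>\<xi>::real^'d. \<alpha> * (norm \<xi>)\<^sup>2 \<le> (\<Sum>i\<in>UNIV. \<Sum>j\<in>UNIV. a i j t x * \<xi> $ i * \<xi> $ j))"
      proof eventually_elim
        case (elim x)
        show ?case
        proof (intro impI conjI allI)
          assume x: "x \<in> \<Omega>"
          show "\<bar>a i j t x\<bar> \<le> K" "a i j t x = a j i t x" for i j
            using elim(1,2) x BK order_trans by blast+
          show "\<alpha> * (norm \<xi>)\<^sup>2 \<le> (\<Sum>i\<in>UNIV. \<Sum>j\<in>UNIV. a i j t x * \<xi> $ i * \<xi> $ j)" for \<xi>
            by (rule quadratic_form_dense[OF D(2)]) (use elim(3) x in blast)
        qed
      qed
      then have "AE x in lebesgue_on \<Omega>. (\<forall>i j. \<bar>a i j t x\<bar> \<le> K \<and> a i j t x = a j i t x) \<and>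
        (\<forall>\<xi>::real^'d. \<alpha> * (norm \<xi>)\<^sup>2 \<le> (\<Sum>i\<in>UNIV. \<Sum>j\<in>UNIV. a i j t x * \<xi> $ i * \<xi> $ j))"
        using \<Omega> by (subst AE_restrict_space_iff) (auto dest: AE_completion)
      then show "good_coeffs \<Omega> \<alpha> K (\<lambda>i j. a i j t)" using elim(1) t by (simp add: good_coeffs_def)
    qed
  qed
  moreover have "K \<ge> 0" by (auto simp: K_def intro: sum_nonneg)
  ultimately show ?thesis using that by blast
qed

lemma good_coeffs_limit:
  fixes \<Omega> :: "(real^'d) set"
  assumes \<Omega>: "open \<Omega>" and good: "\<And>n::nat. good_coeffs \<Omega> \<alpha> K (b n)"
    and \<epsilon>: "\<epsilon> \<longlonglongrightarrow> 0"
    and close: "\<And>n i j. AE x in lebesgue_on \<Omega>. \<bar>b n i j x - b' i j x\<bar> \<le> \<epsilon> n"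
  shows "good_coeffs \<Omega> \<alpha> K b'"
proof -
  have "AE x in lebesgue_on \<Omega>. \<forall>n i j. \<bar>b n i j x - b' i j x\<bar> \<le> \<epsilon> n"
    unfolding AE_all_countable using close by blast
  then have lim: "AE x in lebesgue_on \<Omega>. \<forall>i j. (\<lambda>n. b n i j x) \<longlonglongrightarrow> b' i j x"
  proof eventually_elim
    case (elim x)
    show ?case
    proof (intro allI)
      fix i j
      have "(\<lambda>n. b n i j x - b' i j x) \<longlonglongrightarrow> 0"
        by (rule Lim_null_comparison[OF _ \<epsilon>]) (use elim in auto)
      then show "(\<lambda>n. b n i j x) \<longlonglongrightarrow> b' i j x" by (simp add: LIM_zero_iff)
    qed
  qed
  have meas: "b' i j \<in> borel_measurable (lebesgue_on \<Omega>)" for i j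
  proof (rule borel_measurable_lebesgue_on_AE[of \<Omega> "\<lambda>x. lim (\<lambda>n. b n i j x)"])
    show "(\<lambda>x. lim (\<lambda>n. b n i j x)) \<in> borel_measurable (lebesgue_on \<Omega>)"
      by (rule borel_measurable_lim_metric) (use good in \<open>simp add: good_coeffs_def\<close>)
    show "AE x in lebesgue_on \<Omega>. lim (\<lambda>n. b n i j x) = b' i j x"
      using lim by eventually_elim (simp add: limI)
  qed (use \<Omega> in simp)
  have "AE x in lebesgue_on \<Omega>. \<forall>n. (\<forall>i j. \<bar>b n i j x\<bar> \<le> K \<and> b n i j x = b n j i x) \<and>
        (\<forall>\<xi>::real^'d. \<alpha> * (norm \<xi>)\<^sup>2 \<le> (\<Sum>i\<in>UNIV. \<Sum>j\<in>UNIV. b n i j x * \<xi> $ i * \<xi> $ j))"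
    unfolding AE_all_countable using good unfolding good_coeffs_def by blast
  with lim have "AE x in lebesgue_on \<Omega>. (\<forall>i j. \<bar>b' i j x\<bar> \<le> K \<and> b' i j x = b' j i x) \<and>
        (\<forall>\<xi>::real^'d. \<alpha> * (norm \<xi>)\<^sup>2 \<le> (\<Sum>i\<in>UNIV. \<Sum>j\<in>UNIV. b' i j x * \<xi> $ i * \<xi> $ j))"
  proof eventually_elim
    case (elim x)
    have "\<bar>b' i j x\<bar> \<le> K" for i j
      by (rule LIMSEQ_le_const2[OF tendsto_rabs[of "\<lambda>n. b n i j x"]]) (use elim in auto)
    moreover have "b' i j x = b' j i x" for i j
    proof -
      have "(\<lambda>n. b n i j x) \<longlonglongrightarrow> b' i j x" "(\<lambda>n. b n j i x) \<longlonglongrightarrow> b' j i x" using elim(1) by auto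
      moreover have "(\<lambda>n. b n i j x) = (\<lambda>n. b n j i x)" using elim(2) by blast
      ultimately show ?thesis using LIMSEQ_unique by metis
    qed
    moreover have "\<alpha> * (norm \<xi>)\<^sup>2 \<le> (\<Sum>i\<in>UNIV. \<Sum>j\<in>UNIV. b' i j x * \<xi> $ i * \<xi> $ j)" for \<xi> :: "real^'d"
    proof (rule LIMSEQ_le_const)
      show "(\<lambda>n. \<Sum>i\<in>UNIV. \<Sum>j\<in>UNIV. b n i j x * \<xi> $ i * \<xi> $ j)
          \<longlonglongrightarrow> (\<Sum>i\<in>UNIV. \<Sum>j\<in>UNIV. b' i j x * \<xi> $ i * \<xi> $ j)"
        using elim(1) by (intro tendsto_intros) auto
    qed (use elim(2) in auto)
    ultimately show ?case by blast
  qed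
  then show ?thesis using meas by (simp add: good_coeffs_def)
qed

text \<open>The times at which the properties hold are dense, and by the modulus of continuity the coefficients at any other time
  are limits, uniformly up to null sets, of coefficients at such times.\<close>

lemma good_coeffs_all_times:
  fixes \<Omega> :: "(real^'d) set"
  assumes \<Omega>: "open \<Omega>" and T: "T > 0" and \<omega>: "admissible_modulus T \<omega>"
    and a: "admissible_coeffs \<Omega> T a \<alpha> \<omega>"
  obtains K where "K \<ge> 0" "\<And>t. t \<in> {0..T} \<Longrightarrow> good_coeffs \<Omega> \<alpha> K (\<lambda>i j. a i j t)"
proof -
  obtain K where K: "K \<ge> 0" "AE t in lborel. t \<in> {0<..<T} \<longrightarrow> good_coeffs \<Omega> \<alpha> K (\<lambda>i j. a i j t)"
    using good_coeffs_AE[OF \<Omega> a] by blast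
  have "good_coeffs \<Omega> \<alpha> K (\<lambda>i j. a i j t)" if t: "t \<in> {0..T}" for t
  proof -
    have "\<exists>s\<in>{0<..<T}. good_coeffs \<Omega> \<alpha> K (\<lambda>i j. a i j s) \<and> \<bar>s - t\<bar> < e" if e: "e > 0" for e
    proof (rule ccontr)
      assume none: "\<not> ?thesis"
      let ?U = "{max 0 (t - e)<..<min T (t + e)}"
      have "AE s in lebesgue. s \<in> {0<..<T} \<longrightarrow> good_coeffs \<Omega> \<alpha> K (\<lambda>i j. a i j s)"
        using K(2) by (rule AE_completion)
      then have "AE s in lebesgue. s \<notin> ?U"
        by eventually_elim (use none in auto)
      then have "negligible ?U"
        by (simp add: negligible_iff_null_sets completion.null_sets_iff_AE)
      moreover have "?U \<noteq> {}" using t e T by auto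
      ultimately show False using open_not_negligible[OF open_greaterThanLessThan] by blast
    qed
    note approx = this
    have "\<forall>n::nat. \<exists>s. s \<in> {0<..<T} \<and> good_coeffs \<Omega> \<alpha> K (\<lambda>i j. a i j s) \<and> \<bar>s - t\<bar> < inverse (real (Suc n))"
      using approx[of "inverse (real (Suc _))"] by (auto simp: Bex_def)
    then obtain s where s: "\<And>n::nat. s n \<in> {0<..<T}" "\<And>n. good_coeffs \<Omega> \<alpha> K (\<lambda>i j. a i j (s n))"
      "\<And>n. \<bar>s n - t\<bar> < inverse (real (Suc n))" by metis
    have "(\<lambda>n. \<bar>s n - t\<bar>) \<longlonglongrightarrow> 0"
      by (rule tendsto_sandwich[OF _ _ tendsto_const LIMSEQ_inverse_real_of_nat])
        (use s(3) in \<open>auto intro!: always_eventually less_imp_le\<close>)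
    moreover have "0 \<le> \<bar>s n - t\<bar> \<and> \<bar>s n - t\<bar> \<le> T" for n using s(1)[of n] t by auto
    ultimately have "(\<lambda>n. \<omega> \<bar>s n - t\<bar>) \<longlonglongrightarrow> 0" by (rule modulus_tendsto_0[OF \<omega> T])
    then show ?thesis
    proof (rule good_coeffs_limit[OF \<Omega> s(2)])
      show "AE x in lebesgue_on \<Omega>. \<bar>a i j (s n) x - a i j t x\<bar> \<le> \<omega> \<bar>s n - t\<bar>" for n i j
        using a s(1)[of n] t by (auto simp: admissible_coeffs_def)
    qed
  qed
  then show ?thesis using that K by blast
qed

section \<open>The bilinear form at a fixed time\<close>

lemma L2_fun_abs: "L2_fun \<Omega> f \<Longrightarrow> L2_fun \<Omega> (\<lambda>x. \<bar>f x\<bar>)"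
  by (auto simp: L2_fun_def)

lemma L2_norm_abs: "L2_norm \<Omega> (\<lambda>x. \<bar>f x\<bar>) = L2_norm \<Omega> f"
  by (simp add: L2_norm_def L2_inner_def)

lemma L2_norm_nonneg: "0 \<le> L2_norm \<Omega> f"
  by (simp add: L2_norm_def L2_inner_def)

lemma L2_Cauchy_Schwarz: "L2_fun \<Omega> f \<Longrightarrow> L2_fun \<Omega> g \<Longrightarrow> \<bar>L2_inner \<Omega> f g\<bar> \<le> L2_norm \<Omega> f * L2_norm \<Omega> g"
  using symmetric_form.Cauchy_Schwarz[OF symmetric_form_L2, of f \<Omega> g] by (simp add: L2_norm_nrm)

lemma weighted_product:
  assumes c: "c \<in> borel_measurable (lebesgue_on \<Omega>)" "AE x in lebesgue_on \<Omega>. \<bar>c x\<bar> \<le> K"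
    and K: "K \<ge> 0" and f: "L2_fun \<Omega> f" and g: "L2_fun \<Omega> g"
  shows "integrable (lebesgue_on \<Omega>) (\<lambda>x. c x * f x * g x)"
    and "\<bar>LINT x|lebesgue_on \<Omega>. c x * f x * g x\<bar> \<le> K * L2_norm \<Omega> f * L2_norm \<Omega> g"
proof -
  have int: "integrable (lebesgue_on \<Omega>) (\<lambda>x. K * (\<bar>f x\<bar> * \<bar>g x\<bar>))"
    using L2_fun_mult_integrable[OF L2_fun_abs[OF f] L2_fun_abs[OF g]] by simp
  have le: "AE x in lebesgue_on \<Omega>. \<bar>c x * f x * g x\<bar> \<le> K * (\<bar>f x\<bar> * \<bar>g x\<bar>)"
    using c(2) by eventually_elim (simp add: abs_mult mult.assoc mult_right_mono)
  have meas: "(\<lambda>x. c x * f x * g x) \<in> borel_measurable (lebesgue_on \<Omega>)"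
    using c f g by (auto simp: L2_fun_def)
  show I: "integrable (lebesgue_on \<Omega>) (\<lambda>x. c x * f x * g x)"
    by (rule Bochner_Integration.integrable_bound[OF int meas])
      (use le K in \<open>auto simp: abs_mult\<close>)
  have "\<bar>LINT x|lebesgue_on \<Omega>. c x * f x * g x\<bar> \<le> (LINT x|lebesgue_on \<Omega>. \<bar>c x * f x * g x\<bar>)"
    by (rule integral_abs_bound)
  also have "\<dots> \<le> (LINT x|lebesgue_on \<Omega>. K * (\<bar>f x\<bar> * \<bar>g x\<bar>))"
    using I int le by (intro integral_mono_AE) auto
  also have "\<dots> = K * L2_inner \<Omega> (\<lambda>x. \<bar>f x\<bar>) (\<lambda>x. \<bar>g x\<bar>)" by (simp add: L2_inner_def)
  also have "\<dots> \<le> K * (L2_norm \<Omega> f * L2_norm \<Omega> g)"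
    using L2_Cauchy_Schwarz[OF L2_fun_abs[OF f] L2_fun_abs[OF g]] K
    by (intro mult_left_mono) (auto simp: L2_norm_abs)
  finally show "\<bar>LINT x|lebesgue_on \<Omega>. c x * f x * g x\<bar> \<le> K * L2_norm \<Omega> f * L2_norm \<Omega> g"
    by (simp add: mult.assoc)
qed

lemma bform_zero_right:
  assumes \<Omega>: "open \<Omega>"
  shows "bform \<Omega> a t w 0 = 0"
proof -
  have "AE x in lebesgue_on \<Omega>. weak_pderiv \<Omega> j 0 x = 0" for j
    using H1_scale(2)[OF \<Omega> zero_H1[OF \<Omega>], of j 0] by simp
  then have "AE x in lebesgue_on \<Omega>. \<forall>j. weak_pderiv \<Omega> j 0 x = 0" by (simp add: AE_all_countable)
  then have "AE x in lebesgue_on \<Omega>.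
      (\<Sum>i\<in>UNIV. \<Sum>j\<in>UNIV. a i j t x * weak_pderiv \<Omega> i w x * weak_pderiv \<Omega> j 0 x) = 0"
    by eventually_elim simp
  then show ?thesis unfolding bform_def by (rule integral_eq_zero_AE)
qed

text \<open>The sum of the norms of the partial derivatives is the seminorm that the double sum in the bilinear form produces
  directly; it is equivalent to the norm of the gradient.\<close>

definition gradient_sum :: "(real^'d) set \<Rightarrow> (real^'d \<Rightarrow> real) \<Rightarrow> real" where
  "gradient_sum \<Omega> u = (\<Sum>i\<in>UNIV. L2_norm \<Omega> (weak_pderiv \<Omega> i u))"

lemma gradient_sum_nonneg: "0 \<le> gradient_sum \<Omega> u"
  by (simp add: gradient_sum_def sum_nonneg L2_norm_nonneg)

context
  fixes \<Omega> :: "(real^'d) set" and \<alpha> K t :: real and a :: "'d \<Rightarrow> 'd \<Rightarrow> real \<Rightarrow> real^'d \<Rightarrow> real"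
  assumes \<Omega>: "open \<Omega>" and \<alpha>: "\<alpha> > 0" and K: "K \<ge> 0"
    and good: "good_coeffs \<Omega> \<alpha> K (\<lambda>i j. a i j t)"
begin

lemma coeff_measurable: "a i j t \<in> borel_measurable (lebesgue_on \<Omega>)"
  using good by (simp add: good_coeffs_def)

lemma coeff_AE:
  "AE x in lebesgue_on \<Omega>. \<bar>a i j t x\<bar> \<le> K"
  "AE x in lebesgue_on \<Omega>. a i j t x = a j i t x"
  "AE x in lebesgue_on \<Omega>. \<forall>\<xi>::real^'d. \<alpha> * (norm \<xi>)\<^sup>2 \<le> (\<Sum>i\<in>UNIV. \<Sum>j\<in>UNIV. a i j t x * \<xi> $ i * \<xi> $ j)"
proof -
  have *: "AE x in lebesgue_on \<Omega>. (\<forall>i j. \<bar>a i j t x\<bar> \<le> K \<and> a i j t x = a j i t x) \<and>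
        (\<forall>\<xi>::real^'d. \<alpha> * (norm \<xi>)\<^sup>2 \<le> (\<Sum>i\<in>UNIV. \<Sum>j\<in>UNIV. a i j t x * \<xi> $ i * \<xi> $ j))"
    using good unfolding good_coeffs_def by (rule conjunct2)
  show "AE x in lebesgue_on \<Omega>. \<bar>a i j t x\<bar> \<le> K" using * by eventually_elim blast
  show "AE x in lebesgue_on \<Omega>. a i j t x = a j i t x" using * by eventually_elim blast
  show "AE x in lebesgue_on \<Omega>. \<forall>\<xi>::real^'d. \<alpha> * (norm \<xi>)\<^sup>2 \<le> (\<Sum>i\<in>UNIV. \<Sum>j\<in>UNIV. a i j t x * \<xi> $ i * \<xi> $ j)"
    using * by eventually_elim blast
qed

lemma coeff_product_integrable:
  "L2_fun \<Omega> f \<Longrightarrow> L2_fun \<Omega> g \<Longrightarrow> integrable (lebesgue_on \<Omega>) (\<lambda>x. a i j t x * f x * g x)"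
  by (rule weighted_product(1)[OF coeff_measurable coeff_AE(1) K])

lemma coeff_product_AE:
  assumes "L2_fun \<Omega> f" "L2_fun \<Omega> g" "AE x in lebesgue_on \<Omega>. f x = f' x"
  shows "(LINT x|lebesgue_on \<Omega>. a i j t x * f x * g x) = (LINT x|lebesgue_on \<Omega>. a i j t x * f' x * g x)"
proof (rule integral_cong_AE)
  have "L2_fun \<Omega> f'" using L2_fun_AE[OF \<Omega> assms(1,3)] .
  then show "(\<lambda>x. a i j t x * f x * g x) \<in> borel_measurable (lebesgue_on \<Omega>)"
    "(\<lambda>x. a i j t x * f' x * g x) \<in> borel_measurable (lebesgue_on \<Omega>)"
    using assms coeff_product_integrable by (auto intro!: borel_measurable_integrable)
  show "AE x in lebesgue_on \<Omega>. a i j t x * f x * g x = a i j t x * f' x * g x"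
    using assms(3) by eventually_elim simp
qed

lemma bform_expand:
  assumes "H1_fun \<Omega> u" "H1_fun \<Omega> v"
  shows "bform \<Omega> a t u v
    = (\<Sum>i\<in>UNIV. \<Sum>j\<in>UNIV. LINT x|lebesgue_on \<Omega>. a i j t x * weak_pderiv \<Omega> i u x * weak_pderiv \<Omega> j v x)"
  unfolding bform_def using H1_weak_pderiv(2)[OF \<Omega>] assms coeff_product_integrable
  by (subst Bochner_Integration.integral_sum | intro sum.cong refl Bochner_Integration.integrable_sum | simp)+

lemma symmetric_form_bform: "symmetric_form {u. H1_fun \<Omega> u} (bform \<Omega> a t)"
proof
  note W = H1_weak_pderiv(2)[OF \<Omega>]
  show "subspace {u. H1_fun \<Omega> u}" by (rule subspace_H1[OF \<Omega>])
  show "bform \<Omega> a t u v = bform \<Omega> a t v u" if "u \<in> {u. H1_fun \<Omega> u}" "v \<in> {u. H1_fun \<Omega> u}" for u v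
  proof -
    have H: "H1_fun \<Omega> u" "H1_fun \<Omega> v" using that by auto
    have "(LINT x|lebesgue_on \<Omega>. a i j t x * weak_pderiv \<Omega> i u x * weak_pderiv \<Omega> j v x)
        = (LINT x|lebesgue_on \<Omega>. a j i t x * weak_pderiv \<Omega> j v x * weak_pderiv \<Omega> i u x)" for i j
    proof (rule integral_cong_AE)
      show "AE x in lebesgue_on \<Omega>. a i j t x * weak_pderiv \<Omega> i u x * weak_pderiv \<Omega> j v x
          = a j i t x * weak_pderiv \<Omega> j v x * weak_pderiv \<Omega> i u x"
        using coeff_AE(2)[of i j] by eventually_elim simp
    qed (use W H coeff_product_integrable in \<open>auto intro!: borel_measurable_integrable\<close>)
    then show ?thesis unfolding bform_expand[OF H] bform_expand[OF H(2,1)]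
      by (subst sum.swap) simp
  qed
  show "bform \<Omega> a t (u + v) w = bform \<Omega> a t u w + bform \<Omega> a t v w"
    if "u \<in> {u. H1_fun \<Omega> u}" "v \<in> {u. H1_fun \<Omega> u}" "w \<in> {u. H1_fun \<Omega> u}" for u v w
  proof -
    have H: "H1_fun \<Omega> u" "H1_fun \<Omega> v" "H1_fun \<Omega> w" "H1_fun \<Omega> (u + v)"
      using that H1_add(1)[OF \<Omega>] by auto
    have "(LINT x|lebesgue_on \<Omega>. a i j t x * weak_pderiv \<Omega> i (u + v) x * weak_pderiv \<Omega> j w x)
        = (LINT x|lebesgue_on \<Omega>. a i j t x * weak_pderiv \<Omega> i u x * weak_pderiv \<Omega> j w x)
        + (LINT x|lebesgue_on \<Omega>. a i j t x * weak_pderiv \<Omega> i v x * weak_pderiv \<Omega> j w x)" for i j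
      using coeff_product_AE[OF W[OF H(4)] W[OF H(3)] H1_add(2)[OF \<Omega> H(1,2)]]
        coeff_product_integrable[OF W[OF H(1)] W[OF H(3)]] coeff_product_integrable[OF W[OF H(2)] W[OF H(3)]]
      by (simp add: distrib_left distrib_right)
    then show ?thesis using H by (simp add: bform_expand sum.distrib)
  qed
  show "bform \<Omega> a t (c *\<^sub>R u) w = c * bform \<Omega> a t u w"
    if "u \<in> {u. H1_fun \<Omega> u}" "w \<in> {u. H1_fun \<Omega> u}" for c u w
  proof -
    have H: "H1_fun \<Omega> u" "H1_fun \<Omega> w" "H1_fun \<Omega> (c *\<^sub>R u)" using that H1_scale(1)[OF \<Omega>] by auto
    have "(LINT x|lebesgue_on \<Omega>. a i j t x * weak_pderiv \<Omega> i (c *\<^sub>R u) x * weak_pderiv \<Omega> j w x)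
        = c * (LINT x|lebesgue_on \<Omega>. a i j t x * weak_pderiv \<Omega> i u x * weak_pderiv \<Omega> j w x)" for i j
    proof -
      have "(LINT x|lebesgue_on \<Omega>. a i j t x * weak_pderiv \<Omega> i (c *\<^sub>R u) x * weak_pderiv \<Omega> j w x)
          = (LINT x|lebesgue_on \<Omega>. a i j t x * (c * weak_pderiv \<Omega> i u x) * weak_pderiv \<Omega> j w x)"
        by (rule coeff_product_AE[OF W[OF H(3)] W[OF H(2)] H1_scale(2)[OF \<Omega> H(1)]])
      also have "\<dots> = (LINT x|lebesgue_on \<Omega>. c * (a i j t x * weak_pderiv \<Omega> i u x * weak_pderiv \<Omega> j w x))"
        by (simp only: mult_ac)
      finally show ?thesis by simp
    qed
    then show ?thesis using H by (simp add: bform_expand sum_distrib_left)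
  qed
  show "0 \<le> bform \<Omega> a t u u" if "u \<in> {u. H1_fun \<Omega> u}" for u
    unfolding bform_def
  proof (rule integral_nonneg_AE)
    show "AE x in lebesgue_on \<Omega>.
        0 \<le> (\<Sum>i\<in>UNIV. \<Sum>j\<in>UNIV. a i j t x * weak_pderiv \<Omega> i u x * weak_pderiv \<Omega> j u x)"
      using coeff_AE(3)
    proof eventually_elim
      case (elim x)
      have "0 \<le> \<alpha> * (norm (\<chi> i. weak_pderiv \<Omega> i u x))\<^sup>2" using \<alpha> by simp
      also have "\<dots> \<le> (\<Sum>i\<in>UNIV. \<Sum>j\<in>UNIV. a i j t x * (\<chi> i. weak_pderiv \<Omega> i u x) $ i * (\<chi> i. weak_pderiv \<Omega> i u x) $ j)"
        using elim by blast
      finally show ?case by simp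
    qed
  qed
qed

text \<open>Ellipticity is integrated with the gradient as direction at each point. The number of coordinates comes from comparing
  the square of a sum with the sum of squares.\<close>

lemma coercive:
  assumes u: "H1_fun \<Omega> u"
  shows "(gradient_sum \<Omega> u)\<^sup>2 \<le> (real CARD('d) / \<alpha>) * bform \<Omega> a t u u"
proof -
  note W = H1_weak_pderiv(2)[OF \<Omega> u]
  have "\<alpha> * (\<Sum>i\<in>UNIV. (L2_norm \<Omega> (weak_pderiv \<Omega> i u))\<^sup>2)
      = \<alpha> * (\<Sum>i\<in>UNIV. LINT x|lebesgue_on \<Omega>. (weak_pderiv \<Omega> i u x)\<^sup>2)"
    by (simp add: L2_norm_def L2_inner_def power2_eq_square)
  also have "\<dots> = (LINT x|lebesgue_on \<Omega>. \<alpha> * (\<Sum>i\<in>UNIV. (weak_pderiv \<Omega> i u x)\<^sup>2))"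
    using W by (simp add: L2_fun_def)
  also have "\<dots> \<le> bform \<Omega> a t u u"
    unfolding bform_def
  proof (rule integral_mono_AE)
    show "integrable (lebesgue_on \<Omega>) (\<lambda>x. \<alpha> * (\<Sum>i\<in>UNIV. (weak_pderiv \<Omega> i u x)\<^sup>2))"
      using W by (simp add: L2_fun_def)
    show "integrable (lebesgue_on \<Omega>)
        (\<lambda>x. \<Sum>i\<in>UNIV. \<Sum>j\<in>UNIV. a i j t x * weak_pderiv \<Omega> i u x * weak_pderiv \<Omega> j u x)"
      using W coeff_product_integrable by (intro Bochner_Integration.integrable_sum) auto
    show "AE x in lebesgue_on \<Omega>. \<alpha> * (\<Sum>i\<in>UNIV. (weak_pderiv \<Omega> i u x)\<^sup>2)
        \<le> (\<Sum>i\<in>UNIV. \<Sum>j\<in>UNIV. a i j t x * weak_pderiv \<Omega> i u x * weak_pderiv \<Omega> j u x)"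
      using coeff_AE(3)
    proof eventually_elim
      case (elim x)
      let ?\<xi> = "\<chi> i. weak_pderiv \<Omega> i u x"
      have "(norm ?\<xi>)\<^sup>2 = (\<Sum>i\<in>UNIV. (weak_pderiv \<Omega> i u x)\<^sup>2)"
        unfolding power2_norm_eq_inner inner_vec_def by (simp add: power2_eq_square)
      moreover have "\<alpha> * (norm ?\<xi>)\<^sup>2 \<le> (\<Sum>i\<in>UNIV. \<Sum>j\<in>UNIV. a i j t x * ?\<xi> $ i * ?\<xi> $ j)"
        using elim by blast
      ultimately show ?case by simp
    qed
  qed
  finally have "(\<Sum>i\<in>UNIV. (L2_norm \<Omega> (weak_pderiv \<Omega> i u))\<^sup>2) \<le> bform \<Omega> a t u u / \<alpha>"
    using \<alpha> by (simp add: field_simps)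
  then have "real CARD('d) * (\<Sum>i\<in>UNIV. (L2_norm \<Omega> (weak_pderiv \<Omega> i u))\<^sup>2)
      \<le> real CARD('d) * (bform \<Omega> a t u u / \<alpha>)" by (intro mult_left_mono) auto
  moreover have "(gradient_sum \<Omega> u)\<^sup>2 \<le> real CARD('d) * (\<Sum>i\<in>UNIV. (L2_norm \<Omega> (weak_pderiv \<Omega> i u))\<^sup>2)"
    unfolding gradient_sum_def
    using sum_squared_le_sum_of_squares[of "\<lambda>i. L2_norm \<Omega> (weak_pderiv \<Omega> i u)" UNIV] by (simp add: mult.commute)
  ultimately show ?thesis by simp
qed

end

lemma bform_modulus:
  fixes \<Omega> :: "(real^'d) set"
  assumes \<Omega>: "open \<Omega>" and good: "good_coeffs \<Omega> \<alpha> K (\<lambda>i j. a i j t)" "good_coeffs \<Omega> \<alpha> K (\<lambda>i j. a i j s)"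
    and K: "K \<ge> 0" "\<alpha> > 0" and \<epsilon>: "\<epsilon> \<ge> 0" "\<And>i j. AE x in lebesgue_on \<Omega>. \<bar>a i j t x - a i j s x\<bar> \<le> \<epsilon>"
    and H: "H1_fun \<Omega> u" "H1_fun \<Omega> v"
  shows "\<bar>bform \<Omega> a t u v - bform \<Omega> a s u v\<bar> \<le> \<epsilon> * gradient_sum \<Omega> u * gradient_sum \<Omega> v"
proof -
  note W = H1_weak_pderiv(2)[OF \<Omega>]
  let ?D = "weak_pderiv \<Omega>"
  have "bform \<Omega> a t u v - bform \<Omega> a s u v
      = (\<Sum>i\<in>UNIV. \<Sum>j\<in>UNIV. LINT x|lebesgue_on \<Omega>. (a i j t x - a i j s x) * ?D i u x * ?D j v x)"
    using coeff_product_integrable[where a = a, OF \<Omega> K(2,1) good(1)] coeff_product_integrable[where a = a, OF \<Omega> K(2,1) good(2)] W H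
    unfolding bform_expand[where a = a, OF \<Omega> K(2,1) good(1) H] bform_expand[where a = a, OF \<Omega> K(2,1) good(2) H]
      sum_subtractf[symmetric]
    by (intro sum.cong refl) (simp add: left_diff_distrib)
  also have "\<bar>\<dots>\<bar> \<le> (\<Sum>i\<in>UNIV. \<Sum>j\<in>UNIV. \<bar>LINT x|lebesgue_on \<Omega>. (a i j t x - a i j s x) * ?D i u x * ?D j v x\<bar>)"
    by (rule order_trans[OF sum_abs sum_mono[OF sum_abs]])
  also have "\<dots> \<le> (\<Sum>i\<in>UNIV. \<Sum>j\<in>UNIV. \<epsilon> * L2_norm \<Omega> (?D i u) * L2_norm \<Omega> (?D j v))"
  proof (intro sum_mono weighted_product(2))
    show "(\<lambda>x. a i j t x - a i j s x) \<in> borel_measurable (lebesgue_on \<Omega>)" for i j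
      using good by (intro borel_measurable_diff) (simp_all add: good_coeffs_def)
  qed (use \<epsilon> W H in auto)
  also have "\<dots> = \<epsilon> * (gradient_sum \<Omega> u * gradient_sum \<Omega> v)"
    unfolding gradient_sum_def by (subst sum_product) (simp only: sum_distrib_left mult.assoc)
  finally show ?thesis by (simp only: mult.assoc)
qed

section \<open>Averages over the time steps\<close>

text \<open>Lebesgue measure is complete, so both sides are measurable or none is, and measurability need not be known in advance.
  This is used for the pairing of the data with a fixed function.\<close>

lemma lebesgue_cong_AE:
  fixes f g :: "'a::euclidean_space \<Rightarrow> real"
  assumes AE: "AE x in lebesgue. f x = g x"
  shows "integrable lebesgue f \<longleftrightarrow> integrable lebesgue g" "(LINT x|lebesgue. f x) = (LINT x|lebesgue. g x)"
proof -
  have AE': "AE x in lebesgue. g x = f x" using AE by eventually_elim simp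
  have "integrable lebesgue f \<longleftrightarrow> integrable lebesgue g"
    if "f \<in> borel_measurable lebesgue" using that AE borel_measurable_AE[OF that AE] by (intro integrable_cong_AE)
  moreover have "f \<in> borel_measurable lebesgue \<longleftrightarrow> g \<in> borel_measurable lebesgue"
    using borel_measurable_AE[OF _ AE] borel_measurable_AE[OF _ AE'] by blast
  ultimately show iff: "integrable lebesgue f \<longleftrightarrow> integrable lebesgue g"
    using borel_measurable_integrable by blast
  show "(LINT x|lebesgue. f x) = (LINT x|lebesgue. g x)"
  proof (cases "integrable lebesgue f")
    case True
    then show ?thesis using iff AE by (intro integral_cong_AE) (auto intro: borel_measurable_integrable)
  next
    case False
    then show ?thesis using iff by (simp add: not_integrable_integral_eq)
  qed
qed

lemma integrable_on_step:
  fixes h :: "real \<Rightarrow> real"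
  assumes "continuous_on {0..T} h" "0 \<le> c" "d \<le> T"
  shows "integrable (lebesgue_on {c<..d}) h"
proof -
  have "integrable (lebesgue_on {c..d}) h"
    using assms by (intro continuous_imp_integrable_real continuous_on_subset[OF assms(1)]) auto
  then have "set_integrable lebesgue {c..d} h"
    by (simp add: set_integrable_def integrable_restrict_space)
  then have "set_integrable lebesgue {c<..d} h" by (rule set_integrable_subset) auto
  then show ?thesis by (simp add: set_integrable_def integrable_restrict_space)
qed

definition average :: "real \<Rightarrow> real \<Rightarrow> (real \<Rightarrow> real) \<Rightarrow> real" where
  "average c d h = 1 / (d - c) * (LINT t|lebesgue_on {c<..d}. h t)"

lemma measure_step [simp]: "c < d \<Longrightarrow> measure (lebesgue_on {c<..d}) {c<..d::real} = d - c"
  by (simp add: measure_restrict_space)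

lemma integrable_const_step: "integrable (lebesgue_on {c<..d::real}) (\<lambda>t. y::real)"
proof -
  have "integrable lebesgue (\<lambda>t. indicat_real {c<..d} t *\<^sub>R y)"
    by (intro integrable_scaleR_left integrable_real_indicator) (cases "c \<le> d"; simp)+
  then show ?thesis by (simp add: integrable_restrict_space)
qed

lemma average_bounds:
  assumes "c < d" "integrable (lebesgue_on {c<..d}) h"
  shows "(\<And>t. t \<in> {c<..d} \<Longrightarrow> lo \<le> h t) \<Longrightarrow> lo \<le> average c d h"
    and "(\<And>t. t \<in> {c<..d} \<Longrightarrow> h t \<le> hi) \<Longrightarrow> average c d h \<le> hi"
proof -
  assume "\<And>t. t \<in> {c<..d} \<Longrightarrow> lo \<le> h t"
  then have "(LINT t|lebesgue_on {c<..d}. lo) \<le> (LINT t|lebesgue_on {c<..d}. h t)"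
    using assms integrable_const_step by (intro integral_mono) auto
  then show "lo \<le> average c d h" using assms by (simp add: average_def field_simps)
next
  assume "\<And>t. t \<in> {c<..d} \<Longrightarrow> h t \<le> hi"
  then have "(LINT t|lebesgue_on {c<..d}. h t) \<le> (LINT t|lebesgue_on {c<..d}. hi)"
    using assms integrable_const_step by (intro integral_mono) auto
  then show "average c d h \<le> hi" using assms by (simp add: average_def field_simps)
qed

lemma average_diff_le:
  assumes "c < d" "c' < d'" "integrable (lebesgue_on {c<..d}) h" "integrable (lebesgue_on {c'<..d'}) h"
    and "\<And>t s. t \<in> {c<..d} \<Longrightarrow> s \<in> {c'<..d'} \<Longrightarrow> \<bar>h t - h s\<bar> \<le> \<epsilon>"
  shows "\<bar>average c d h - average c' d' h\<bar> \<le> \<epsilon>"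
proof -
  have 1: "\<bar>average c d h - h s\<bar> \<le> \<epsilon>" if s: "s \<in> {c'<..d'}" for s
    using average_bounds(1)[OF assms(1,3), of "h s - \<epsilon>"] average_bounds(2)[OF assms(1,3), of "h s + \<epsilon>"]
      assms(5)[OF _ s] by (smt (verit))
  show ?thesis
    using average_bounds(1)[OF assms(2,4), of "average c d h - \<epsilon>"]
      average_bounds(2)[OF assms(2,4), of "average c d h + \<epsilon>"] 1 by (smt (verit))
qed

text \<open>Jensen's inequality: integrate the tangent of the power function at the average.\<close>

lemma average_powr_le:
  assumes "c < d" "p \<ge> 1" "\<And>t. t \<in> {c<..d} \<Longrightarrow> 0 \<le> n t"
    and n: "integrable (lebesgue_on {c<..d}) n" "integrable (lebesgue_on {c<..d}) (\<lambda>t. n t powr p)"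
  shows "(d - c) * average c d n powr p \<le> (LINT t|lebesgue_on {c<..d}. n t powr p)"
proof -
  define y where "y = average c d n"
  have y0: "y \<ge> 0" unfolding y_def using assms by (intro average_bounds(1)) auto
  show ?thesis
  proof (cases "y = 0")
    case True
    then show ?thesis unfolding y_def by (auto intro!: integral_nonneg_AE)
  next
    case False
    have int: "(LINT t|lebesgue_on {c<..d}. n t) = (d - c) * y"
      using assms(1) by (simp add: y_def average_def)
    have "(d - c) * y powr p = (LINT t|lebesgue_on {c<..d}. y powr p + p * y powr (p - 1) * (n t - y))"
      using n integrable_const_step[of c d] assms(1) by (simp add: int)
    also have "\<dots> \<le> (LINT t|lebesgue_on {c<..d}. n t powr p)"
      using n integrable_const_step[of c d] assms y0 False
      by (intro integral_mono powr_above_tangent Bochner_Integration.integrable_add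
          integrable_mult_right Bochner_Integration.integrable_diff) auto
    finally show ?thesis by (simp add: y_def)
  qed
qed

section \<open>The scheme of the finite element discretization\<close>

text \<open>The discretization apart from the data and its solution. The hypotheses on the coefficients are in the form provided
  by \<open>good_coeffs_all_times\<close>.\<close>

locale fe_discretization =
  fixes \<Omega> :: "(real^'d) set" and T \<alpha> K :: real
    and a :: "'d \<Rightarrow> 'd \<Rightarrow> real \<Rightarrow> real^'d \<Rightarrow> real" and \<omega> :: "real \<Rightarrow> real"
    and M :: nat and \<theta> :: "nat \<Rightarrow> real" and \<T> :: "(real^'d) set set" and r :: nat
  assumes \<Omega>: "open \<Omega>" and T: "T > 0" and \<alpha>: "\<alpha> > 0" and K: "K \<ge> 0"
    and \<omega>: "admissible_modulus T \<omega>"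
    and good: "t \<in> {0..T} \<Longrightarrow> good_coeffs \<Omega> \<alpha> K (\<lambda>i j. a i j t)"
    and close: "t \<in> {0..T} \<Longrightarrow> s \<in> {0..T} \<Longrightarrow> AE x in lebesgue_on \<Omega>. \<bar>a i j t x - a i j s x\<bar> \<le> \<omega> \<bar>t - s\<bar>"
    and mesh: "time_mesh T M \<theta>"
    and \<T>: "conformal_triangulation \<Omega> \<T>"
begin

abbreviation V :: "(real^'d \<Rightarrow> real) set" where
  "V \<equiv> fe_space \<Omega> \<T> r"

sublocale finite_inner_product V "L2_inner \<Omega>"
  by (rule finite_inner_product_fe_space[OF \<Omega> \<T>])

text \<open>The form of the averaged operator on the \<open>m\<close>-th step.\<close>

definition am :: "nat \<Rightarrow> (real^'d \<Rightarrow> real) \<Rightarrow> (real^'d \<Rightarrow> real) \<Rightarrow> real" where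
  "am m v w = average (\<theta> (m - 1)) (\<theta> m) (\<lambda>t. bform \<Omega> a t v w)"

abbreviation I :: "nat \<Rightarrow> real set" where
  "I m \<equiv> {\<theta> (m - 1)<..\<theta> m}"

abbreviation k :: "nat \<Rightarrow> real" where
  "k m \<equiv> \<theta> m - \<theta> (m - 1)"

lemma \<theta>_ends: "\<theta> 0 = 0" "\<theta> M = T"
  using mesh by (auto simp: time_mesh_def)

lemma \<theta>_step: "m \<in> {1..M} \<Longrightarrow> \<theta> (m - 1) < \<theta> m"
  using mesh unfolding time_mesh_def by (cases m) auto

lemma \<theta>_mono: "i \<le> j \<Longrightarrow> j \<le> M \<Longrightarrow> \<theta> i \<le> \<theta> j"
proof (induction rule: dec_induct)
  case (step n)
  then show ?case using \<theta>_step[of "Suc n"] by simp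
qed simp

lemma \<theta>_bounds: "m \<le> M \<Longrightarrow> 0 \<le> \<theta> m \<and> \<theta> m \<le> T"
  using \<theta>_mono[of 0 m] \<theta>_mono[of m M] \<theta>_ends by simp

lemma step_bounds: "m \<in> {1..M} \<Longrightarrow> 0 \<le> \<theta> (m - 1)" "m \<in> {1..M} \<Longrightarrow> \<theta> m \<le> T"
  using \<theta>_bounds[of "m - 1"] \<theta>_bounds[of m] by auto

lemma step_subset: "m \<in> {1..M} \<Longrightarrow> t \<in> I m \<Longrightarrow> t \<in> {0..T}"
  using step_bounds[of m] by auto

lemma step_unique:
  assumes "m \<in> {1..M}" "m' \<in> {1..M}" "t \<in> I m" "t \<in> I m'"
  shows "m = m'"
proof (rule ccontr)
  assume "m \<noteq> m'"
  then consider "m \<le> m' - 1" | "m' \<le> m - 1" by linarith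
  then show False
  proof cases
    case 1
    then have "\<theta> m \<le> \<theta> (m' - 1)" using assms by (intro \<theta>_mono) auto
    then show False using assms by simp
  next
    case 2
    then have "\<theta> m' \<le> \<theta> (m - 1)" using assms by (intro \<theta>_mono) auto
    then show False using assms by simp
  qed
qed

lemma \<omega>_nonneg: "0 \<le> s \<Longrightarrow> s \<le> T \<Longrightarrow> 0 \<le> \<omega> s"
  using \<omega> by (auto simp: admissible_modulus_def)

lemma form_at: "t \<in> {0..T} \<Longrightarrow> symmetric_form V (bform \<Omega> a t)"
  using symmetric_form.on_subspace[OF symmetric_form_bform[where a = a and t = t, OF \<Omega> \<alpha> K good] subspace_fe_space[OF \<Omega>]]
    fe_space_H1 by blast

lemma modulus_at:
  assumes "t \<in> {0..T}" "s \<in> {0..T}" "v \<in> V" "w \<in> V"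
  shows "\<bar>bform \<Omega> a t v w - bform \<Omega> a s v w\<bar> \<le> \<omega> \<bar>t - s\<bar> * gradient_sum \<Omega> v * gradient_sum \<Omega> w"
  using assms by (intro bform_modulus[OF \<Omega> good good K \<alpha>] close \<omega>_nonneg fe_space_H1) auto

text \<open>Continuity in time makes all time integrals of the form well defined.\<close>

lemma bform_continuous:
  assumes "v \<in> V" "w \<in> V"
  shows "continuous_on {0..T} (\<lambda>t. bform \<Omega> a t v w)"
  unfolding continuous_on_sequentially comp_def
proof (intro allI ballI impI, elim conjE)
  fix x :: "nat \<Rightarrow> real" and t assume t: "t \<in> {0..T}" and x: "\<forall>n. x n \<in> {0..T}" "x \<longlonglongrightarrow> t"
  let ?c = "gradient_sum \<Omega> v * gradient_sum \<Omega> w"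
  have "(\<lambda>n. \<bar>x n - t\<bar>) \<longlonglongrightarrow> \<bar>t - t\<bar>" by (intro tendsto_intros x)
  then have "(\<lambda>n. \<bar>x n - t\<bar>) \<longlonglongrightarrow> 0" by simp
  moreover have "0 \<le> \<bar>x n - t\<bar> \<and> \<bar>x n - t\<bar> \<le> T" for n using x(1)[rule_format, of n] t by auto
  ultimately have "(\<lambda>n. \<omega> \<bar>x n - t\<bar>) \<longlonglongrightarrow> 0" by (rule modulus_tendsto_0[OF \<omega> T])
  then have "(\<lambda>n. \<omega> \<bar>x n - t\<bar> * ?c) \<longlonglongrightarrow> 0 * ?c" by (intro tendsto_intros)
  then have lim: "(\<lambda>n. \<omega> \<bar>x n - t\<bar> * ?c) \<longlonglongrightarrow> 0" by simp
  have "(\<lambda>n. bform \<Omega> a (x n) v w - bform \<Omega> a t v w) \<longlonglongrightarrow> 0"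
    by (rule Lim_null_comparison[OF _ lim])
      (use modulus_at[OF _ t assms] x(1) in \<open>auto intro!: always_eventually simp: mult.assoc\<close>)
  then show "(\<lambda>n. bform \<Omega> a (x n) v w) \<longlonglongrightarrow> bform \<Omega> a t v w" by (simp add: LIM_zero_iff)
qed

lemma bform_integrable:
  assumes "m \<in> {1..M}" "v \<in> V" "w \<in> V"
  shows "integrable (lebesgue_on (I m)) (\<lambda>t. bform \<Omega> a t v w)"
  using integrable_on_step[OF bform_continuous[OF assms(2,3)]] step_bounds[OF assms(1)] by blast

lemma integral_step_cong:
  fixes g h :: "real \<Rightarrow> real"
  shows "(\<And>t. t \<in> {c<..d} \<Longrightarrow> g t = h t) \<Longrightarrow>
    (LINT t|lebesgue_on {c<..d}. g t) = (LINT t|lebesgue_on {c<..d}. h t)"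
  by (intro Bochner_Integration.integral_cong) auto

lemma symmetric_form_am:
  assumes m: "m \<in> {1..M}"
  shows "symmetric_form V (am m)"
proof
  have F: "symmetric_form V (bform \<Omega> a t)" if "t \<in> I m" for t
    using form_at step_subset[OF m that] by blast
  show "am m u v = am m v u" if "u \<in> V" "v \<in> V" for u v
  proof -
    have "(LINT t|lebesgue_on (I m). bform \<Omega> a t u v)
        = (LINT t|lebesgue_on (I m). bform \<Omega> a t v u)"
      by (rule integral_step_cong) (rule symmetric_form.sym[OF F that])
    then show ?thesis by (simp add: am_def average_def)
  qed
  show "am m (u + v) w = am m u w + am m v w" if "u \<in> V" "v \<in> V" "w \<in> V" for u v w
  proof -
    have "(LINT t|lebesgue_on (I m). bform \<Omega> a t (u + v) w)
        = (LINT t|lebesgue_on (I m). bform \<Omega> a t u w + bform \<Omega> a t v w)"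
      by (rule integral_step_cong) (rule symmetric_form.add_left[OF F that])
    then show ?thesis using bform_integrable[OF m] that by (simp add: am_def average_def add_divide_distrib)
  qed
  show "am m (c *\<^sub>R u) w = c * am m u w" if "u \<in> V" "w \<in> V" for c u w
  proof -
    have "(LINT t|lebesgue_on (I m). bform \<Omega> a t (c *\<^sub>R u) w)
        = (LINT t|lebesgue_on (I m). c * bform \<Omega> a t u w)"
      by (rule integral_step_cong) (rule symmetric_form.scale_left[OF F that])
    then show ?thesis by (simp add: am_def average_def)
  qed
  show "0 \<le> am m u u" if "u \<in> V" for u
    unfolding am_def
    by (rule average_bounds(1)[OF \<theta>_step[OF m] bform_integrable[OF m that that]])
      (rule symmetric_form.nonneg[OF F that])
qed (rule subspace)

lemma am_coercive:
  assumes m: "m \<in> {1..M}" and v: "v \<in> V"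
  shows "gradient_sum \<Omega> v \<le> sqrt (real CARD('d) / \<alpha>) * sqrt (am m v v)"
proof -
  have "(gradient_sum \<Omega> v)\<^sup>2 / (real CARD('d) / \<alpha>) \<le> am m v v"
    unfolding am_def
  proof (rule average_bounds(1)[OF \<theta>_step[OF m] bform_integrable[OF m v v]])
    fix t assume "t \<in> I m"
    then have "(gradient_sum \<Omega> v)\<^sup>2 \<le> (real CARD('d) / \<alpha>) * bform \<Omega> a t v v"
      using coercive[where a = a and t = t, OF \<Omega> \<alpha> K good fe_space_H1[OF v]] step_subset[OF m] by blast
    then show "(gradient_sum \<Omega> v)\<^sup>2 / (real CARD('d) / \<alpha>) \<le> bform \<Omega> a t v v"
      using \<alpha> by (simp add: field_simps)
  qed
  then have "(gradient_sum \<Omega> v)\<^sup>2 \<le> (real CARD('d) / \<alpha>) * am m v v"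
    using \<alpha> by (simp add: field_simps)
  then have "sqrt ((gradient_sum \<Omega> v)\<^sup>2) \<le> sqrt ((real CARD('d) / \<alpha>) * am m v v)"
    by (rule real_sqrt_le_mono)
  then show ?thesis by (simp only: real_sqrt_abs abs_of_nonneg[OF gradient_sum_nonneg] real_sqrt_mult)
qed

text \<open>Any two times in the \<open>j\<close>-th and the \<open>m\<close>-th step differ by at most \<open>t m - t (j -
  1)\<close>, and by coercivity the gradients are controlled by either averaged form.\<close>

lemma am_modulus:
  assumes jm: "1 \<le> j" "j < m" "m \<le> M" and V: "v \<in> V" "w \<in> V"
  shows "\<bar>am m v w - am j v w\<bar>
    \<le> (real CARD('d) / \<alpha>) * \<omega> (\<theta> m - \<theta> (j - 1)) * sqrt (am j v v) * sqrt (am m w w)"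
proof -
  let ?s = "\<theta> m - \<theta> (j - 1)" and ?q = "sqrt (real CARD('d) / \<alpha>)"
  have m: "m \<in> {1..M}" and j: "j \<in> {1..M}" using jm by auto
  have s: "0 \<le> ?s" "?s \<le> T"
  proof -
    have "0 \<le> \<theta> (j - 1)" "\<theta> m \<le> T" "\<theta> (j - 1) \<le> \<theta> m"
      using step_bounds[OF j] step_bounds[OF m] \<theta>_mono[of "j - 1" m] jm by linarith+
    then show "0 \<le> ?s" "?s \<le> T" by linarith+
  qed
  have "\<bar>am m v w - am j v w\<bar> \<le> \<omega> ?s * gradient_sum \<Omega> v * gradient_sum \<Omega> w"
    unfolding am_def
  proof (rule average_diff_le[OF \<theta>_step[OF m] \<theta>_step[OF j] bform_integrable[OF m V] bform_integrable[OF j V]])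
    fix t s' assume t: "t \<in> I m" and s': "s' \<in> I j"
    have "\<theta> j \<le> \<theta> (m - 1)" using jm by (intro \<theta>_mono) auto
    then have "\<bar>t - s'\<bar> \<in> {0..T}" "?s \<in> {0..T}" "\<bar>t - s'\<bar> \<le> ?s" using t s' s by auto
    moreover have "mono_on {0..T} \<omega>" using \<omega> by (simp add: admissible_modulus_def)
    ultimately have "\<omega> \<bar>t - s'\<bar> \<le> \<omega> ?s" by (simp only: monotone_on_def)
    then have "\<omega> \<bar>t - s'\<bar> * gradient_sum \<Omega> v * gradient_sum \<Omega> w \<le> \<omega> ?s * gradient_sum \<Omega> v * gradient_sum \<Omega> w"
      by (intro mult_right_mono gradient_sum_nonneg)
    then show "\<bar>bform \<Omega> a t v w - bform \<Omega> a s' v w\<bar> \<le> \<omega> ?s * gradient_sum \<Omega> v * gradient_sum \<Omega> w"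
      using modulus_at[OF step_subset[OF m t] step_subset[OF j s'] V] by linarith
  qed
  also have "\<dots> \<le> \<omega> ?s * (?q * sqrt (am j v v)) * (?q * sqrt (am m w w))"
    using am_coercive[OF j V(1)] am_coercive[OF m V(2)] \<omega>_nonneg[OF s] gradient_sum_nonneg[of \<Omega>]
      symmetric_form.nonneg[OF symmetric_form_am[OF j] V(1)] \<alpha>
    by (intro mult_mono mult_nonneg_nonneg) auto
  also have "\<dots> = (?q * ?q) * \<omega> ?s * sqrt (am j v v) * sqrt (am m w w)" by (simp only: mult_ac)
  also have "?q * ?q = real CARD('d) / \<alpha>" using \<alpha> by simp
  finally show ?thesis .
qed

text \<open>In an orthonormal basis the coefficients of the discrete operator are values of the form, and averaging commutes with
  the finite expansion.\<close>

lemma A_kh_eq: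
  assumes m: "m \<in> {1..M}" and v: "v \<in> V"
  shows "A_kh \<Omega> a V \<theta> m v = form_operator V (L2_inner \<Omega>) (am m) v"
proof -
  obtain E where E: "finite E" "E \<subseteq> V" "\<And>v. v \<in> V \<Longrightarrow> v = (\<Sum>e\<in>E. L2_inner \<Omega> v e *\<^sub>R e)"
    using orthonormal_basis by blast
  have op: "form_operator V (L2_inner \<Omega>) g v = (\<Sum>e\<in>E. g v e *\<^sub>R e)" if "symmetric_form V g" for g
  proof -
    interpret P: form_pair V "L2_inner \<Omega>" g
      using that finite_inner_product_axioms by (simp add: form_pair_def)
    have "P.A v = (\<Sum>e\<in>E. L2_inner \<Omega> (P.A v) e *\<^sub>R e)" using v by (intro E(3)) simp
    also have "\<dots> = (\<Sum>e\<in>E. g v e *\<^sub>R e)"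
      using E(2) v by (intro sum.cong refl) (auto simp: P.A_form)
    finally show ?thesis .
  qed
  show ?thesis
  proof
    fix x
    have "(LINT t|lebesgue_on (I m). A_h \<Omega> a V t v x)
        = (LINT t|lebesgue_on (I m). (\<Sum>e\<in>E. bform \<Omega> a t v e * e x))"
    proof (rule integral_step_cong)
      fix t assume "t \<in> I m"
      then have "A_h \<Omega> a V t v = (\<Sum>e\<in>E. bform \<Omega> a t v e *\<^sub>R e)"
        using op[OF form_at[OF step_subset[OF m]]] by (simp add: A_h_def form_operator_def)
      then show "A_h \<Omega> a V t v x = (\<Sum>e\<in>E. bform \<Omega> a t v e * e x)" by (simp add: sum_fun_apply)
    qed
    also have "\<dots> = (\<Sum>e\<in>E. (LINT t|lebesgue_on (I m). bform \<Omega> a t v e) * e x)"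
      using bform_integrable[OF m v] E(2) by (subst Bochner_Integration.integral_sum) auto
    finally have "A_kh \<Omega> a V \<theta> m v x = (\<Sum>e\<in>E. am m v e * e x)"
      by (simp add: A_kh_def subint_def tstep_def am_def average_def sum_distrib_left sum_divide_distrib)
    also have "\<dots> = form_operator V (L2_inner \<Omega>) (am m) v x"
      by (simp add: op[OF symmetric_form_am[OF m]] sum_fun_apply)
    finally show "A_kh \<Omega> a V \<theta> m v x = form_operator V (L2_inner \<Omega>) (am m) v x" .
  qed
qed

text \<open>The last step contains the final time \<open>T\<close>, which the open time interval does not; the difference is a
  null set.\<close>

lemma integral_time_step:
  fixes g h :: "real \<Rightarrow> real"
  assumes m: "m \<in> {1..M}"
    and g: "\<And>t. t \<in> {0<..<T} \<Longrightarrow> g t = (if t \<in> I m then h t else 0)"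
  shows "(LINT t|lebesgue_on {0<..<T}. g t) = (LINT t|lebesgue_on (I m). h t)"
proof -
  have "AE t in lebesgue. t \<noteq> T" by (rule AE_completion[OF AE_lborel_singleton])
  then have "AE t in lebesgue. indicat_real {0<..<T} t *\<^sub>R g t = indicat_real (I m) t *\<^sub>R h t"
  proof eventually_elim
    case (elim t)
    then show ?case using g[of t] step_bounds[OF m] by (auto simp: indicator_def)
  qed
  then show ?thesis by (simp add: integral_restrict_space lebesgue_cong_AE(2))
qed


context
  fixes p :: real and f u :: "real \<Rightarrow> real^'d \<Rightarrow> real"
  assumes p: "p \<ge> 1" and f: "Lp_L2_fun p \<Omega> {0<..<T} f"
    and sol: "fully_discrete_solution \<Omega> T a V M \<theta> f u"
begin

text \<open>The values of the discrete solution on the steps, preceded by the initial value zero, so that the first step has the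
  same form as all others.\<close>

definition U :: "nat \<Rightarrow> real^'d \<Rightarrow> real" where
  "U m = (if m = 0 then 0 else piece \<theta> u m)"

definition load :: "nat \<Rightarrow> (real^'d \<Rightarrow> real) \<Rightarrow> real" where
  "load m \<psi> = (LINT t|lebesgue_on (I m). L2_inner \<Omega> (f t) \<psi>)"

definition F :: "nat \<Rightarrow> real" where
  "F m = average (\<theta> (m - 1)) (\<theta> m) (\<lambda>t. L2_norm \<Omega> (f t))"

lemma u_const:
  assumes m: "m \<in> {1..M}"
  shows "U m \<in> V" and "t \<in> I m \<Longrightarrow> u t = U m"
proof -
  have "u \<in> X_kh V M \<theta>" using sol by (simp add: fully_discrete_solution_def)
  then obtain v where v: "v \<in> V" "\<And>t. t \<in> I m \<Longrightarrow> u t = v"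
    using m unfolding X_kh_def subint_def by blast
  moreover have "U m = v" using v(2)[of "\<theta> m"] \<theta>_step[OF m] m by (simp add: U_def piece_def)
  ultimately show "U m \<in> V" "t \<in> I m \<Longrightarrow> u t = U m" by auto
qed

lemma U_in: "m \<le> M \<Longrightarrow> U m \<in> V"
  using u_const(1)[of m] by (cases "m = 0") (auto simp: U_def)

text \<open>Test with the function that equals \<open>\<psi>\<close> on the \<open>m\<close>-th step and vanishes on all others.\<close>

lemma step_scheme:
  assumes m: "m \<in> {1..M}" and \<psi>: "\<psi> \<in> V"
  shows "L2_inner \<Omega> (U m - U (m - 1)) \<psi> + k m * am m (U m) \<psi> = load m \<psi>"
proof -
  define \<phi> where "\<phi> t = (if t \<in> I m then \<psi> else 0)" for t
  have at: "piece \<theta> \<phi> m' = (if m' = m then \<psi> else 0)" if m': "m' \<in> {1..M}" for m'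
    using step_unique[OF m m', of "\<theta> m'"] \<theta>_step[OF m'] by (auto simp: piece_def \<phi>_def)
  have "\<phi> \<in> X_kh V M \<theta>"
    unfolding X_kh_def subint_def
  proof (intro CollectI ballI)
    fix m' assume m': "m' \<in> {1..M}"
    show "\<exists>v\<in>V. \<forall>t\<in>I m'. \<phi> t = v"
    proof (cases "m' = m")
      case True
      then show ?thesis using \<psi> by (intro bexI[of _ \<psi>]) (auto simp: \<phi>_def)
    next
      case False
      then have "\<phi> t = 0" if "t \<in> I m'" for t
        using step_unique[OF m m' _ that] by (auto simp: \<phi>_def)
      then show ?thesis by (intro bexI[of _ 0]) auto
    qed
  qed
  then have eq: "(LINT t|lebesgue_on {0<..<T}. bform \<Omega> a t (u t) (\<phi> t))
        + (\<Sum>m'=2..M. L2_inner \<Omega> (\<lambda>x. piece \<theta> u m' x - piece \<theta> u (m' - 1) x) (piece \<theta> \<phi> m'))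
        + L2_inner \<Omega> (piece \<theta> u 1) (piece \<theta> \<phi> 1)
        = (LINT t|lebesgue_on {0<..<T}. L2_inner \<Omega> (f t) (\<phi> t))"
    using sol unfolding fully_discrete_solution_def by blast
  have "(LINT t|lebesgue_on {0<..<T}. bform \<Omega> a t (u t) (\<phi> t))
      = (LINT t|lebesgue_on (I m). bform \<Omega> a t (U m) \<psi>)"
    by (rule integral_time_step[OF m])
      (use u_const(2)[OF m] bform_zero_right[OF \<Omega>] in \<open>auto simp: \<phi>_def\<close>)
  also have "\<dots> = k m * am m (U m) \<psi>"
    using \<theta>_step[OF m] by (simp add: am_def average_def)
  finally have 1: "(LINT t|lebesgue_on {0<..<T}. bform \<Omega> a t (u t) (\<phi> t)) = k m * am m (U m) \<psi>" .
  have 2: "(LINT t|lebesgue_on {0<..<T}. L2_inner \<Omega> (f t) (\<phi> t)) = load m \<psi>"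
    unfolding load_def
    by (rule integral_time_step[OF m]) (auto simp: \<phi>_def L2_inner_def)
  have M1: "1 \<in> {1..M}" using m by auto
  have zero: "L2_inner \<Omega> w 0 = 0" for w by (simp add: L2_inner_def)
  have "(\<Sum>m'=2..M. L2_inner \<Omega> (\<lambda>x. piece \<theta> u m' x - piece \<theta> u (m' - 1) x) (piece \<theta> \<phi> m'))
      = (\<Sum>m'=2..M. if m' = m then L2_inner \<Omega> (U m - U (m - 1)) \<psi> else 0)"
  proof (intro sum.cong refl)
    fix m' assume m': "m' \<in> {2..M}"
    have "(\<lambda>x. piece \<theta> u m' x - piece \<theta> u (m' - 1) x) = U m' - U (m' - 1)"
      using m' by (auto simp: U_def fun_eq_iff)
    then show "L2_inner \<Omega> (\<lambda>x. piece \<theta> u m' x - piece \<theta> u (m' - 1) x) (piece \<theta> \<phi> m')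
        = (if m' = m then L2_inner \<Omega> (U m - U (m - 1)) \<psi> else 0)"
      using at[of m'] m' zero by simp
  qed
  also have "\<dots> = (if m = 1 then 0 else L2_inner \<Omega> (U m - U (m - 1)) \<psi>)" using m by auto
  finally have 3: "(\<Sum>m'=2..M. L2_inner \<Omega> (\<lambda>x. piece \<theta> u m' x - piece \<theta> u (m' - 1) x) (piece \<theta> \<phi> m'))
    = (if m = 1 then 0 else L2_inner \<Omega> (U m - U (m - 1)) \<psi>)" .
  have 4: "L2_inner \<Omega> (piece \<theta> u 1) (piece \<theta> \<phi> 1) = (if m = 1 then L2_inner \<Omega> (U m - U (m - 1)) \<psi> else 0)"
    using at[OF M1] zero by (auto simp: U_def)
  show ?thesis using eq unfolding 1 2 3 4 by (simp split: if_splits)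
qed

lemma integrable_time_step:
  fixes g :: "real \<Rightarrow> real"
  assumes m: "m \<in> {1..M}" and g: "integrable (lebesgue_on {0<..<T}) g"
  shows "integrable (lebesgue_on (I m)) g"
    and "(LINT t|lebesgue_on (I m). g t)
      = (LINT t|lebesgue. indicat_real (I m) t *\<^sub>R (indicat_real {0<..<T} t *\<^sub>R g t))"
    and "integrable lebesgue (\<lambda>t. indicat_real (I m) t *\<^sub>R (indicat_real {0<..<T} t *\<^sub>R g t))"
proof -
  have int: "integrable lebesgue (\<lambda>t. indicat_real {0<..<T} t *\<^sub>R g t)"
    using g by (simp add: integrable_restrict_space)
  show int': "integrable lebesgue (\<lambda>t. indicat_real (I m) t *\<^sub>R (indicat_real {0<..<T} t *\<^sub>R g t))"
    by (rule integrable_mult_indicator[OF _ int]) simp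
  have "AE t in lebesgue. t \<noteq> T" by (rule AE_completion[OF AE_lborel_singleton])
  then have AE: "AE t in lebesgue. indicat_real (I m) t *\<^sub>R (indicat_real {0<..<T} t *\<^sub>R g t)
      = indicat_real (I m) t *\<^sub>R g t"
  proof eventually_elim
    case (elim t)
    then show ?case using step_bounds[OF m] by (auto simp: indicator_def)
  qed
  show "integrable (lebesgue_on (I m)) g"
    using int' lebesgue_cong_AE(1)[OF AE] by (simp add: integrable_restrict_space)
  show "(LINT t|lebesgue_on (I m). g t)
      = (LINT t|lebesgue. indicat_real (I m) t *\<^sub>R (indicat_real {0<..<T} t *\<^sub>R g t))"
    using lebesgue_cong_AE(2)[OF AE] by (simp add: integral_restrict_space)
qed

lemma f_norm_integrable:
  "integrable (lebesgue_on {0<..<T}) (\<lambda>t. L2_norm \<Omega> (f t) powr p)"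
  "integrable (lebesgue_on {0<..<T}) (\<lambda>t. L2_norm \<Omega> (f t))"
proof -
  show int: "integrable (lebesgue_on {0<..<T}) (\<lambda>t. L2_norm \<Omega> (f t) powr p)"
    using f by (simp add: Lp_L2_fun_def)
  show "integrable (lebesgue_on {0<..<T}) (\<lambda>t. L2_norm \<Omega> (f t))"
  proof (rule Bochner_Integration.integrable_bound)
    have "integrable lebesgue (\<lambda>t. indicat_real {0<..<T} t *\<^sub>R (1::real))"
      using T by (intro integrable_scaleR_left integrable_real_indicator) auto
    then have "integrable (lebesgue_on {0<..<T}) (\<lambda>t. 1::real)" by (simp add: integrable_restrict_space)
    then show "integrable (lebesgue_on {0<..<T}) (\<lambda>t. 1 + L2_norm \<Omega> (f t) powr p)" using int by simp
    have "(\<lambda>t. (L2_norm \<Omega> (f t) powr p) powr (1 / p)) \<in> borel_measurable (lebesgue_on {0<..<T})"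
      using borel_measurable_integrable[OF int] by measurable
    then show "(\<lambda>t. L2_norm \<Omega> (f t)) \<in> borel_measurable (lebesgue_on {0<..<T})"
      using p L2_norm_nonneg[of \<Omega>] by (simp add: powr_powr)
    have "y \<le> 1 + y powr p" if "y \<ge> 0" for y :: real
    proof (cases "y \<le> 1")
      case False
      then have "y powr 1 \<le> y powr p" using p by (intro powr_mono) auto
      then show ?thesis using False by simp
    qed (smt (verit) powr_ge_zero)
    then show "AE t in lebesgue_on {0<..<T}. norm (L2_norm \<Omega> (f t)) \<le> norm (1 + L2_norm \<Omega> (f t) powr p)"
      using L2_norm_nonneg[of \<Omega>] by (intro AE_I2) (smt (verit) real_norm_def)
  qed
qed

text \<open>If the pairing of the data with \<open>\<psi>\<close> is not integrable, then its integral is zero by convention and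
  the bound is trivial.\<close>

lemma load_bound:
  assumes m: "m \<in> {1..M}" and \<psi>: "\<psi> \<in> V"
  shows "\<bar>load m \<psi>\<bar> \<le> k m * F m * sqrt (L2_inner \<Omega> \<psi> \<psi>)"
proof -
  let ?S = "I m"
  have \<psi>2: "L2_fun \<Omega> \<psi>" using fe_space_H1[OF \<psi>] by (simp add: H1_fun_def)
  have n: "integrable (lebesgue_on ?S) (\<lambda>t. L2_norm \<Omega> (f t))"
    by (rule integrable_time_step(1)[OF m f_norm_integrable(2)])
  have "AE t in lebesgue. t \<in> {0<..<T} \<longrightarrow> L2_fun \<Omega> (f t)"
    using f by (simp add: Lp_L2_fun_def strongly_measurable_L2_def AE_restrict_space_iff)
  moreover have "AE t in lebesgue. t \<noteq> T" by (rule AE_completion[OF AE_lborel_singleton])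
  ultimately have "AE t in lebesgue. t \<in> ?S \<longrightarrow> L2_fun \<Omega> (f t)"
  proof eventually_elim
    case (elim t)
    then show ?case using step_bounds[OF m] by auto
  qed
  then have AE: "AE t in lebesgue_on ?S. \<bar>L2_inner \<Omega> (f t) \<psi>\<bar> \<le> L2_norm \<Omega> (f t) * L2_norm \<Omega> \<psi>"
    by (subst AE_restrict_space_iff) (auto elim!: eventually_mono intro: L2_Cauchy_Schwarz[OF _ \<psi>2])
  have F: "(LINT t|lebesgue_on ?S. L2_norm \<Omega> (f t) * L2_norm \<Omega> \<psi>) = k m * F m * L2_norm \<Omega> \<psi>"
    using \<theta>_step[OF m] n by (simp add: F_def average_def)
  have "\<bar>load m \<psi>\<bar> \<le> (LINT t|lebesgue_on ?S. L2_norm \<Omega> (f t) * L2_norm \<Omega> \<psi>)"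
  proof (cases "integrable (lebesgue_on ?S) (\<lambda>t. L2_inner \<Omega> (f t) \<psi>)")
    case True
    have "\<bar>load m \<psi>\<bar> \<le> (LINT t|lebesgue_on ?S. \<bar>L2_inner \<Omega> (f t) \<psi>\<bar>)"
      unfolding load_def by (rule integral_abs_bound)
    also have "\<dots> \<le> (LINT t|lebesgue_on ?S. L2_norm \<Omega> (f t) * L2_norm \<Omega> \<psi>)"
      using True n AE by (intro integral_mono_AE) auto
    finally show ?thesis .
  next
    case False
    then have "load m \<psi> = 0" by (simp add: load_def not_integrable_integral_eq)
    then show ?thesis by (auto intro!: integral_nonneg_AE simp: L2_norm_nonneg)
  qed
  then show ?thesis unfolding F by (simp add: L2_norm_def)
qed

lemma F_nonneg: "m \<in> {1..M} \<Longrightarrow> 0 \<le> F m"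
  unfolding F_def
  by (rule average_bounds(1)[OF \<theta>_step integrable_time_step(1)[OF _ f_norm_integrable(2)]])
    (auto simp: L2_norm_nonneg)

lemma F_sum:
  "(\<Sum>m=1..M. k m * F m powr p) \<le> (LINT t|lebesgue_on {0<..<T}. L2_norm \<Omega> (f t) powr p)"
proof -
  let ?g = "\<lambda>t. L2_norm \<Omega> (f t) powr p"
  let ?G = "\<lambda>t. indicat_real {0<..<T} t *\<^sub>R ?g t"
  have intG: "integrable lebesgue ?G" using f_norm_integrable(1) by (simp add: integrable_restrict_space)
  have "(\<Sum>m=1..M. k m * F m powr p)
      \<le> (\<Sum>m=1..M. LINT t|lebesgue_on (I m). ?g t)"
    unfolding F_def using f_norm_integrable
    by (intro sum_mono average_powr_le \<theta>_step p integrable_time_step(1)) (auto simp: L2_norm_nonneg)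
  also have "\<dots> = (\<Sum>m=1..M. LINT t|lebesgue. indicat_real (I m) t *\<^sub>R ?G t)"
    by (intro sum.cong refl integrable_time_step(2) f_norm_integrable)
  also have "\<dots> = (LINT t|lebesgue. (\<Sum>m=1..M. indicat_real (I m) t *\<^sub>R ?G t))"
    by (rule Bochner_Integration.integral_sum[symmetric]) (rule integrable_time_step(3)[OF _ f_norm_integrable(1)])
  also have "\<dots> \<le> (LINT t|lebesgue. ?G t)"
  proof (rule integral_mono)
    show "integrable lebesgue (\<lambda>t. \<Sum>m=1..M. indicat_real (I m) t *\<^sub>R ?G t)"
      by (rule Bochner_Integration.integrable_sum) (rule integrable_time_step(3)[OF _ f_norm_integrable(1)])
    show "(\<Sum>m=1..M. indicat_real (I m) t *\<^sub>R ?G t) \<le> ?G t" for t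
    proof (cases "\<exists>m\<in>{1..M}. t \<in> I m")
      case True
      then obtain m where m: "m \<in> {1..M}" "t \<in> I m" by blast
      have "(\<Sum>m=1..M. indicat_real (I m) t *\<^sub>R ?G t)
          = (\<Sum>m'=1..M. if m' = m then ?G t else 0)"
      proof (intro sum.cong refl)
        fix m' assume "m' \<in> {1..M}"
        then show "indicat_real (I m') t *\<^sub>R ?G t = (if m' = m then ?G t else 0)"
          using step_unique[OF m(1) _ m(2)] m(2) by (cases "t \<in> I m'") auto
      qed
      also have "\<dots> = ?G t" using m(1) by simp
      finally show ?thesis by (simp only: order_refl)
    next
      case False
      then have zero: "(\<Sum>m=1..M. indicat_real (I m) t *\<^sub>R ?G t) = 0"
        by (intro sum.neutral) auto
      have "0 \<le> ?G t" by simp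
      then show ?thesis unfolding zero .
    qed
  qed (rule intG)
  also have "\<dots> = (LINT t|lebesgue_on {0<..<T}. ?g t)" by (simp add: integral_restrict_space)
  finally show ?thesis .
qed

text \<open>The bound on the operator part is \<open>maximal_regularity\<close>. Testing the scheme with the jump itself bounds
  its difference quotient by the mean of the data plus the operator part. The constant is \<open>3 R + 2\<close>
  because the \<open>p\<close>-th powers \<open>R\<^sup>p\<close>, \<open>2\<^sup>p\<close> and \<open>(2
  R)\<^sup>p\<close> are collected in one power.\<close>

lemma discrete_estimate:
  fixes \<kappa> kk J \<mu> :: real
  assumes \<kappa>: "\<kappa> > 0"
    and ratio: "\<And>j. 1 \<le> j \<Longrightarrow> j < M \<Longrightarrow> \<theta> j - \<theta> (j - 1) \<le> \<kappa> * (\<theta> (Suc j) - \<theta> j)"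
      "\<And>j. 1 \<le> j \<Longrightarrow> j < M \<Longrightarrow> \<theta> (Suc j) - \<theta> j \<le> \<kappa> * k j"
    and kk: "0 < kk" "\<And>m. m \<in> {1..M} \<Longrightarrow> kk \<le> \<theta> m - \<theta> (m - 1)"
    and J: "modulus_primitive \<omega> T - modulus_primitive \<omega> 0 \<le> J" "J > 0"
    and \<mu>: "\<mu> > 0" "real CARD('d) / \<alpha> * sqrt ((1 + \<kappa>) / \<mu>) * J \<le> 1 / 4"
  defines "R \<equiv> 2 * (1 + ln (T / kk) + real CARD('d) / \<alpha> * (2 + \<kappa>) * J * (8 * sqrt T * exp (\<mu> * T)))"
  shows "(\<Sum>m=1..M.
          Lp_L2_norm p \<Omega> (subint \<theta> m) (\<lambda>t. A_kh \<Omega> a V \<theta> m (piece \<theta> u m)) powr p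
          + tstep \<theta> m * L2_norm \<Omega> (\<lambda>x. jump \<theta> u (m - 1) x / tstep \<theta> m) powr p) powr (1 / p)
      \<le> (3 * R + 2) * Lp_L2_norm p \<Omega> {0<..<T} f"
    (is "?S powr _ \<le> _")
proof -
  let ?L = "real CARD('d) / \<alpha>"
  have L: "?L > 0" using \<alpha> by simp
  have M1: "M \<ge> 1" using \<theta>_ends T by (cases M) auto
  have lag: "0 \<le> \<theta> m - \<theta> (j - 1) \<and> \<theta> m - \<theta> (j - 1) \<le> T" if "1 \<le> j" "j < m" "m \<le> M" for j m
  proof -
    have "0 \<le> \<theta> (j - 1)" "\<theta> m \<le> T" "\<theta> (j - 1) \<le> \<theta> m"
      using step_bounds[of j] step_bounds[of m] \<theta>_mono[of "j - 1" m] that by simp_all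
    then show ?thesis by simp
  qed
  interpret E: euler_scheme V "L2_inner \<Omega>" am \<theta> M \<kappa> ?L \<omega> U load F
  proof (intro euler_scheme.intro euler_scheme_axioms.intro)
    show "finite_inner_product V (L2_inner \<Omega>)" by (rule finite_inner_product_axioms)
    show "0 \<le> \<omega> (\<theta> m - \<theta> (j - 1))" if "1 \<le> j" "j < m" "m \<le> M" for j m
      using lag[OF that] by (intro \<omega>_nonneg) auto
    show "\<bar>am m v w - am j v w\<bar>
        \<le> ?L * \<omega> (\<theta> m - \<theta> (j - 1)) * sqrt (am j v v) * sqrt (am m w w)"
      if "1 \<le> j" "j < m" "m \<le> M" "v \<in> V" "w \<in> V" for j m v w
      using that by (rule am_modulus)
    show "L2_inner \<Omega> (U m - U (m - 1)) \<psi> + k m * am m (U m) \<psi> = load m \<psi>"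
      if "m \<in> {1..M}" "\<psi> \<in> V" for m \<psi>
      using that by (rule step_scheme)
    show "\<bar>load m \<psi>\<bar> \<le> k m * F m * sqrt (L2_inner \<Omega> \<psi> \<psi>)"
      if "m \<in> {1..M}" "\<psi> \<in> V" for m \<psi>
      using that by (rule load_bound)
    show "symmetric_form V (am m)" "\<theta> (m - 1) < \<theta> m" "0 \<le> F m" if "m \<in> {1..M}" for m
      using that symmetric_form_am \<theta>_step F_nonneg by blast+
    show "\<theta> j - \<theta> (j - 1) \<le> \<kappa> * (\<theta> (Suc j) - \<theta> j)" "\<theta> (Suc j) - \<theta> j \<le> \<kappa> * k j"
      if "1 \<le> j" "j < M" for j
      using that by (rule ratio)+
    show "U m \<in> V" if "m \<le> M" for m using that by (rule U_in)
    show "U 0 = 0" by (simp add: U_def)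
  qed (use \<kappa> L in auto)
  let ?G = "LINT t|lebesgue_on {0<..<T}. L2_norm \<Omega> (f t) powr p"
  define D where "D m = L2_norm \<Omega> (\<lambda>x. jump \<theta> u (m - 1) x / tstep \<theta> m)" for m
  have X: "E.X m = L2_norm \<Omega> (A_kh \<Omega> a V \<theta> m (piece \<theta> u m))" if m: "m \<in> {1..M}" for m
    using A_kh_eq[OF m u_const(1)[OF m]] m by (simp add: E.X_def L2_norm_nrm U_def)
  have G0: "0 \<le> ?G" by (intro integral_nonneg_AE) simp
  have pF: "E.pnorm p F \<le> ?G" unfolding E.pnorm_def by (rule F_sum)
  have pX: "E.pnorm p E.X \<le> R powr p * ?G"
  proof -
    have "E.pnorm p E.X \<le> R powr p * E.pnorm p F"
      unfolding R_def
      by (rule E.maximal_regularity[where G = "modulus_primitive \<omega>" and J = J and T = T])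
        (use p \<theta>_ends M1 kk \<omega>_nonneg modulus_primitive_increment[OF \<omega>] J \<mu> L in auto)
    also have "\<dots> \<le> R powr p * ?G" using pF by (intro mult_left_mono) auto
    finally show ?thesis .
  qed
  have D0: "0 \<le> D m" for m by (simp add: D_def L2_norm_nonneg)
  have D_le: "D m \<le> F m + E.X m" if m: "m \<in> {1..M}" for m
  proof -
    let ?d = "U m - U (m - 1)"
    interpret P: form_pair V "L2_inner \<Omega>" "am m"
      using finite_inner_product_axioms symmetric_form_am[OF m] by (simp add: form_pair_def)
    have d: "?d \<in> V" "U m \<in> V" using U_in[of m] U_in[of "m - 1"] m by auto
    have k: "k m > 0" using \<theta>_step[OF m] by simp
    have "jump \<theta> u (m - 1) = ?d" using m by (auto simp: jump_def U_def fun_eq_iff)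
    then have "D m = nrm ((1 / k m) *\<^sub>R ?d)"
      by (simp add: D_def L2_norm_nrm tstep_def scaleR_fun_def divide_inverse mult.commute)
    also have "\<dots> = nrm ?d / k m" using d k by (subst nrm_scale) auto
    finally have D: "D m = nrm ?d / k m" .
    have "nrm ?d * nrm ?d = L2_inner \<Omega> ?d ?d" using nrm_sq[OF d(1)] by (simp add: power2_eq_square)
    also have "\<dots> = load m ?d - k m * L2_inner \<Omega> (P.A (U m)) ?d"
      using step_scheme[OF m d(1)] d by (simp add: P.A_form)
    also have "\<dots> \<le> k m * F m * nrm ?d + k m * (E.X m * nrm ?d)"
    proof -
      have "load m ?d \<le> k m * F m * nrm ?d" using load_bound[OF m d(1)] by (simp add: nrm_def)
      moreover have "- L2_inner \<Omega> (P.A (U m)) ?d \<le> E.X m * nrm ?d"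
        using Cauchy_Schwarz[OF P.A_in[OF d(2)] d(1)] by (simp add: E.X_def)
      then have "k m * (- L2_inner \<Omega> (P.A (U m)) ?d) \<le> k m * (E.X m * nrm ?d)"
        using k by (intro mult_left_mono) auto
      ultimately show ?thesis by simp
    qed
    also have "\<dots> = (k m * (F m + E.X m)) * nrm ?d" by (simp add: algebra_simps)
    finally have "nrm ?d * nrm ?d \<le> (k m * (F m + E.X m)) * nrm ?d" .
    moreover have "0 \<le> k m * (F m + E.X m)" using k F_nonneg[OF m] E.X_nonneg[OF m] by simp
    ultimately have "nrm ?d \<le> k m * (F m + E.X m)"
      using nrm_nonneg[OF d(1)] by (cases "nrm ?d = 0") auto
    then show ?thesis unfolding D using k by (simp add: field_simps)
  qed
  have "E.pnorm p D \<le> E.pnorm p (\<lambda>m. F m + E.X m)"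
    using p D0 D_le by (intro E.pnorm_mono)
  also have "\<dots> \<le> 2 powr p * (E.pnorm p F + E.pnorm p E.X)"
    using p F_nonneg E.X_nonneg by (intro E.pnorm_add)
  also have "\<dots> \<le> 2 powr p * (?G + R powr p * ?G)"
    using pF pX by (intro mult_left_mono add_mono) auto
  finally have pD: "E.pnorm p D \<le> 2 powr p * (?G + R powr p * ?G)" .
  have "kk \<le> T" using kk(2)[of 1] M1 \<theta>_ends \<theta>_bounds[of 1] by simp
  then have "0 \<le> ln (T / kk)" using kk by simp
  then have R: "R \<ge> 0" using L \<kappa> J T unfolding R_def by (intro mult_nonneg_nonneg add_nonneg_nonneg) auto
  have X_term: "Lp_L2_norm p \<Omega> (subint \<theta> m) (\<lambda>t. A_kh \<Omega> a V \<theta> m (piece \<theta> u m)) powr p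
      = k m * E.X m powr p" if m: "m \<in> {1..M}" for m
  proof -
    have "0 \<le> k m * E.X m powr p" using \<theta>_step[OF m] by simp
    then show ?thesis
      using \<theta>_step[OF m] p by (simp add: Lp_L2_norm_def subint_def X[OF m, symmetric] powr_powr)
  qed
  have "?S
      = E.pnorm p E.X + E.pnorm p D"
    using X_term unfolding E.pnorm_def sum.distrib[symmetric] by (intro sum.cong refl) (simp add: D_def tstep_def)
  also have "\<dots> \<le> R powr p * ?G + 2 powr p * (?G + R powr p * ?G)"
    using pX pD by simp
  also have "\<dots> = (R powr p + 2 powr p + (2 * R) powr p) * ?G"
    by (simp add: powr_mult algebra_simps)
  also have "\<dots> \<le> (3 * R + 2) powr p * ?G"
  proof (rule mult_right_mono[OF _ G0])
    have "R powr p + 2 powr p + (2 * R) powr p \<le> (R + 2) powr p + (2 * R) powr p"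
      using R p by (intro add_right_mono powr_superadditive) auto
    also have "\<dots> \<le> ((R + 2) + 2 * R) powr p"
      using R p by (intro powr_superadditive) auto
    finally show "R powr p + 2 powr p + (2 * R) powr p \<le> (3 * R + 2) powr p" by (simp add: algebra_simps)
  qed
  finally have "?S
      \<le> (3 * R + 2) powr p * ?G" .
  then have "?S powr (1 / p)
      \<le> ((3 * R + 2) powr p * ?G) powr (1 / p)"
    using p \<theta>_step
    by (intro powr_mono2 sum_nonneg add_nonneg_nonneg mult_nonneg_nonneg) (auto simp: tstep_def less_imp_le)
  also have "\<dots> = ((3 * R + 2) powr p) powr (1 / p) * ?G powr (1 / p)"
    by (rule powr_mult)
  also have "((3 * R + 2) powr p) powr (1 / p) = 3 * R + 2" using p R by (simp add: powr_powr)
  finally show ?thesis by (simp add: Lp_L2_norm_def)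
qed

end

end

theorem corollary3p17:
  fixes \<Omega> :: "(real^'d) set"
    and T \<alpha> c \<beta> \<kappa> :: real
    and a :: "'d \<Rightarrow> 'd \<Rightarrow> real \<Rightarrow> real^'d \<Rightarrow> real"
    and \<omega> :: "real \<Rightarrow> real"
  assumes "polyhedral_lipschitz_domain \<Omega>"
    and "T > 0"
    and "admissible_modulus T \<omega>"
    and "admissible_coeffs \<Omega> T a \<alpha> \<omega>"
    and "c > 0" and "\<beta> > 0" and "\<kappa> > 0"
  shows "\<exists>\<mu>>0. \<exists>\<delta>\<^sub>0>0. \<exists>C>0.
    \<forall>(M::nat) \<theta> \<T> (r::nat) (p::real) f u.
      time_mesh T M \<theta> \<and> mesh_conditions T c \<beta> \<kappa> M \<theta> \<and> kmax M \<theta> - kmin M \<theta> \<le> \<delta>\<^sub>0 \<and>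
      conformal_triangulation \<Omega> \<T> \<and> r \<ge> 1 \<and> p \<ge> 1 \<and>
      Lp_L2_fun p \<Omega> {0<..<T} f \<and>
      fully_discrete_solution \<Omega> T a (fe_space \<Omega> \<T> r) M \<theta> f u
      \<longrightarrow>
      (\<Sum>m=1..M.
          Lp_L2_norm p \<Omega> (subint \<theta> m)
            (\<lambda>t. A_kh \<Omega> a (fe_space \<Omega> \<T> r) \<theta> m (piece \<theta> u m)) powr p
          + tstep \<theta> m * L2_norm \<Omega> (\<lambda>x. jump \<theta> u (m - 1) x / tstep \<theta> m) powr p) powr (1 / p)
      \<le> C * exp (\<mu> * T) * ln (T / kmax M \<theta>) * Lp_L2_norm p \<Omega> {0<..<T} f"
proof -
  have \<Omega>: "open \<Omega>" using assms(1) by (simp add: polyhedral_lipschitz_domain_def lipschitz_domain_def)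
  note T = \<open>T > 0\<close> and \<omega> = \<open>admissible_modulus T \<omega>\<close> and \<kappa> = \<open>\<kappa> > 0\<close>
  have \<alpha>: "\<alpha> > 0" using assms(4) by (simp add: admissible_coeffs_def)
  obtain K where K: "K \<ge> 0" and good: "\<And>t. t \<in> {0..T} \<Longrightarrow> good_coeffs \<Omega> \<alpha> K (\<lambda>i j. a i j t)"
    using good_coeffs_all_times[OF \<Omega> T \<omega> assms(4)] by blast
  have close: "AE x in lebesgue_on \<Omega>. \<bar>a i j t x - a i j s x\<bar> \<le> \<omega> \<bar>t - s\<bar>" if "t \<in> {0..T}" "s \<in> {0..T}" for i j t s
    using assms(4) that by (auto simp: admissible_coeffs_def)
  define L where "L = real CARD('d) / \<alpha>"
  \<comment> \<open>one is added because the increment of the primitive vanishes if \<open>\<omega>\<close> does, and a positive number is needed\<close>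
  define J where "J = modulus_primitive \<omega> T - modulus_primitive \<omega> 0 + 1"
  \<comment> \<open>chosen such that the bound for the weighted kernel is exactly a quarter\<close>
  define \<mu> where "\<mu> = (1 + \<kappa>) * (4 * L * J)\<^sup>2"
  define Q where "Q = L * (2 + \<kappa>) * J * (8 * sqrt T)"
  \<comment> \<open>the logarithm of the smallest step is comparable to that of the largest one, by the lower bound on the steps\<close>
  define C1 where "C1 = \<beta> + \<bar>(1 - \<beta>) * ln T - ln c\<bar>"
  define C where "C = 8 + 6 * C1 + 6 * Q"
  have L: "L > 0" using \<alpha> by (simp add: L_def)
  have "0 \<le> \<omega> T" using \<omega> T by (auto simp: admissible_modulus_def)
  then have "0 \<le> (T - 0) * (\<omega> T * T powr (-3/2))" using T by simp
  then have J: "J > 0" using modulus_primitive_increment[OF \<omega>, of 0 T] T by (simp add: J_def)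
  have \<mu>: "\<mu> > 0" using L J \<kappa> by (simp add: \<mu>_def)
  have "sqrt ((1 + \<kappa>) / \<mu>) = 1 / (4 * L * J)"
    using L J \<kappa> by (simp add: \<mu>_def real_sqrt_divide real_sqrt_mult)
  then have \<mu>L: "L * sqrt ((1 + \<kappa>) / \<mu>) * J \<le> 1 / 4" using L J by simp
  have Q: "Q > 0" using L J \<kappa> T by (simp add: Q_def)
  have C1: "C1 > 0" using \<open>\<beta> > 0\<close> by (simp add: C1_def)
  have C: "C > 0" using Q C1 by (simp add: C_def)
  show ?thesis
  proof (rule exI[of _ \<mu>], rule conjI[OF \<mu>], rule exI[of _ 1], rule conjI[OF zero_less_one],
      rule exI[of _ C], rule conjI[OF C], intro allI impI, elim conjE)
    fix M :: nat and \<theta> \<T> and r :: nat and p :: real and f u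
    assume mesh: "time_mesh T M \<theta>" and cond: "mesh_conditions T c \<beta> \<kappa> M \<theta>"
      and \<T>: "conformal_triangulation \<Omega> \<T>" and p: "p \<ge> 1" and f: "Lp_L2_fun p \<Omega> {0<..<T} f"
      and sol: "fully_discrete_solution \<Omega> T a (fe_space \<Omega> \<T> r) M \<theta> f u"
    interpret fe_discretization \<Omega> T \<alpha> K a \<omega> M \<theta> \<T> r
      by unfold_locales (fact \<Omega> T \<alpha> K \<omega> mesh \<T> | rule good close; assumption)+
    have M1: "M \<ge> 1" using \<theta>_ends T by (cases M) auto
    have step0: "tstep \<theta> m > 0" if "m \<in> {1..M}" for m using \<theta>_step[OF that] by (simp add: tstep_def)
    have kmin_in: "kmin M \<theta> \<in> tstep \<theta> ` {1..M}" unfolding kmin_def using M1 by (intro Min_in) auto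
    have kmax_in: "kmax M \<theta> \<in> tstep \<theta> ` {1..M}" unfolding kmax_def using M1 by (intro Max_in) auto
    have kmin0: "kmin M \<theta> > 0" and kmax0: "kmax M \<theta> > 0" using kmin_in kmax_in step0 by auto
    have kmin_le: "kmin M \<theta> \<le> \<theta> m - \<theta> (m - 1)" if "m \<in> {1..M}" for m
      unfolding kmin_def tstep_def[symmetric] using that by (intro Min_le) auto
    have ratio: "\<theta> j - \<theta> (j - 1) \<le> \<kappa> * (\<theta> (Suc j) - \<theta> j)" "\<theta> (Suc j) - \<theta> j \<le> \<kappa> * (\<theta> j - \<theta> (j - 1))"
      if j: "1 \<le> j" "j < M" for j
    proof -
      have "inverse \<kappa> \<le> tstep \<theta> j / tstep \<theta> (j + 1)" "tstep \<theta> j / tstep \<theta> (j + 1) \<le> \<kappa>"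
        using cond j by (auto simp: mesh_conditions_def)
      then have "tstep \<theta> j \<le> \<kappa> * tstep \<theta> (j + 1)" "tstep \<theta> (j + 1) \<le> \<kappa> * tstep \<theta> j"
        using step0[of j] step0[of "j + 1"] j \<kappa> by (simp_all add: field_simps)
      then show "\<theta> j - \<theta> (j - 1) \<le> \<kappa> * (\<theta> (Suc j) - \<theta> j)" "\<theta> (Suc j) - \<theta> j \<le> \<kappa> * (\<theta> j - \<theta> (j - 1))"
        by (simp_all add: tstep_def)
    qed
    let ?l = "ln (T / kmax M \<theta>)" and ?E = "exp (\<mu> * T)"
    \<comment> \<open>the logarithm dominates constants because the steps are at most a quarter of the time interval\<close>
    have l1: "?l \<ge> 1"
    proof -
      have "exp 1 \<le> (4::real)" using exp_le by linarith
      also have "4 \<le> T / kmax M \<theta>" using cond kmax0 by (simp add: mesh_conditions_def field_simps)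
      finally show ?thesis using kmax0 T by (subst ln_ge_iff) auto
    qed
    have E1: "?E \<ge> 1" using \<mu> T by simp
    have lk: "ln (T / kmin M \<theta>) \<le> C1 * ?l"
    proof -
      have "ln (c * kmax M \<theta> powr \<beta>) \<le> ln (kmin M \<theta>)"
        using cond kmax0 \<open>c > 0\<close> by (intro ln_mono) (auto simp: mesh_conditions_def)
      then have "ln c + \<beta> * ln (kmax M \<theta>) \<le> ln (kmin M \<theta>)"
        using kmax0 \<open>c > 0\<close> by (simp add: ln_mult ln_powr)
      moreover have "ln (kmax M \<theta>) = ln T - ?l" using kmax0 T by (simp add: ln_div)
      ultimately have "ln c + \<beta> * (ln T - ?l) \<le> ln (kmin M \<theta>)" by simp
      moreover have "ln (T / kmin M \<theta>) = ln T - ln (kmin M \<theta>)"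
        using kmin0 T by (simp add: ln_div)
      ultimately have "ln (T / kmin M \<theta>) \<le> ((1 - \<beta>) * ln T - ln c) + \<beta> * ?l"
        by (simp add: left_diff_distrib right_diff_distrib)
      also have "(1 - \<beta>) * ln T - ln c \<le> \<bar>(1 - \<beta>) * ln T - ln c\<bar> * ?l"
        using mult_left_mono[OF l1 abs_ge_zero[of "(1 - \<beta>) * ln T - ln c"]] by simp
      finally show ?thesis by (simp add: C1_def algebra_simps)
    qed
    let ?R = "2 * (1 + ln (T / kmin M \<theta>) + L * (2 + \<kappa>) * J * (8 * sqrt T * ?E))"
    have "3 * ?R + 2 = 8 + 6 * ln (T / kmin M \<theta>) + 6 * Q * ?E"
      by (simp add: Q_def algebra_simps)
    also have "\<dots> \<le> 8 * (?E * ?l) + 6 * C1 * (?E * ?l) + 6 * Q * (?E * ?l)"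
    proof -
      have "1 \<le> e * l \<and> l \<le> e * l \<and> e \<le> e * l" if "1 \<le> e" "1 \<le> l" for e l :: real
      proof -
        have "1 * l \<le> e * l" "e * 1 \<le> e * l" using that by (intro mult_right_mono mult_left_mono; simp)+
        then show ?thesis using that by linarith
      qed
      from this[OF E1 l1] have "1 \<le> ?E * ?l" "?l \<le> ?E * ?l" "?E \<le> ?E * ?l" by blast+
      then have "C1 * ?l \<le> C1 * (?E * ?l)" "Q * ?E \<le> Q * (?E * ?l)"
        using C1 Q by (intro mult_left_mono; simp)+
      then show ?thesis using lk \<open>1 \<le> ?E * ?l\<close> by linarith
    qed
    also have "\<dots> = C * ?E * ?l" by (simp add: C_def algebra_simps)
    finally have const: "3 * ?R + 2 \<le> C * ?E * ?l" .
    let ?S = "(\<Sum>m=1..M.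
      Lp_L2_norm p \<Omega> (subint \<theta> m)
        (\<lambda>t. A_kh \<Omega> a (fe_space \<Omega> \<T> r) \<theta> m (piece \<theta> u m)) powr p
      + tstep \<theta> m * L2_norm \<Omega> (\<lambda>x. jump \<theta> u (m - 1) x / tstep \<theta> m) powr p)"
    have "?S powr (1 / p)
      \<le> (3 * ?R + 2) * Lp_L2_norm p \<Omega> {0<..<T} f"
      unfolding L_def
      by (rule discrete_estimate[OF p f sol \<kappa> ratio kmin0 kmin_le _ J \<mu>])
        (use \<mu>L in \<open>simp_all add: J_def L_def\<close>)
    also have "\<dots> \<le> C * ?E * ?l * Lp_L2_norm p \<Omega> {0<..<T} f"
      using const by (intro mult_right_mono) (simp_all add: Lp_L2_norm_def)
    finally show "?S powr (1 / p)
      \<le> C * ?E * ?l * Lp_L2_norm p \<Omega> {0<..<T} f" .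
  qed
qed

end
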